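(* Let $M$ be a smooth manifold and let $H:T^*M\to\mathbb{R}$ be a smooth convex Hamiltonian, with associated $\breve M$, $\wp$, $\Gamma$, $\mathfrak S$ and $\varsigma$. The function $\varsigma$, defined on $T^*\breve M\setminus\Gamma$, extends with the value $1$ on $\Gamma$ to a locally Lipschitz function on $T^*\breve M$. The involution $\mathfrak S$ is smooth on $T^*\breve M\setminus\Gamma$, and it extends to a $C^1$ fiber preserving diffeomorphism of $T^*\breve M$ which fixes $\Gamma$. Moreover, for $x=(q,\wp(q))\in\Gamma$, in cotangent coordinates $(q,p)$, $$d\mathfrak S_x=\begin{bmatrix} Id & 0\\ 2\,d\wp_q & -Id\end{bmatrix}.$$
   Context: Smooth means $C^\infty$. A Hamiltonian $H:T^*M\to\mathbb{R}$ is convex if its fiberwise Hessian $\partial^2_{pp}H$ is positive definite at each point. $\breve M$ is the set of $q\in M$ such that the restriction of $H$ to $T^*_qM$ has a minimum; this minimum is attained at a unique point denoted $(q,\wp(q))$. The set $\breve M$ is open in $M$, $\wp$ is a smooth section of $T^*\breve M$, and $\Gamma\subset T^*M$ denotes its graph. For $q\in\breve M$ and $p\in T^*_qM$, $p\neq\wp(q)$, there is one and only one $\tilde p\neq p$ in $T^*_qM$ such that $\partial_pH(q,p)$ and $\partial_pH(q,\tilde p)$ are proportional and $H(q,\tilde p)=H(q,p)$ (it is the minimizer of the linear form $\partial_pH(q,p)$ on $T_q^*M\cap\{H=H(q,p)\}$). One sets $\mathfrak S(q,p):=(q,\tilde p)$, which defines an involution of $T^*\breve M\setminus\Gamma$,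 and $\varsigma(q,p)>0$ is the proportionality coefficient defined by $\partial_pH(\mathfrak S(q,p))=-\varsigma(q,p)\,\partial_pH(q,p)$. *)

theory Defs
  imports "HOL-Analysis.Analysis"
begin

(* C^k regularity of a map on an open subset of a Euclidean space: f is differentiable and all
   its directional derivatives are C^(k-1). Only meant for open S. *)
primrec Ck_on :: "nat \<Rightarrow> ('a::euclidean_space \<Rightarrow> 'b::euclidean_space) \<Rightarrow> 'a set \<Rightarrow> bool" where
  "Ck_on 0 f S \<longleftrightarrow> continuous_on S f"
| "Ck_on (Suc k) f S \<longleftrightarrow>
     (\<forall>x\<in>S. f differentiable (at x)) \<and> (\<forall>v. Ck_on k (\<lambda>x. frechet_derivative f (at x) v) S)"

(* A chart (U, \<phi>); values of \<phi> outside U are irrelevant. *)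
type_synonym ('m, 'e) chart = "'m set \<times> ('m \<Rightarrow> 'e)"

definition chart_inv :: "('m, 'e) chart \<Rightarrow> 'e \<Rightarrow> 'm" where
  "chart_inv c = inv_into (fst c) (snd c)"

definition manifold_carrier :: "('m, 'e) chart set \<Rightarrow> 'm set" where
  "manifold_carrier A = (\<Union>c\<in>A. fst c)"

definition atlas_topology :: "('m, 'e::euclidean_space) chart set \<Rightarrow> 'm topology" where
  "atlas_topology A = topology_generated_by {fst c \<inter> snd c -` S | c S. c \<in> A \<and> open S}"

(* A smooth manifold is given by a smooth atlas on the set "manifold_carrier A" and carries the topology
   induced by the charts. The atlas need not be maximal, but may be. *)
definition smooth_manifold :: "('m, 'e::euclidean_space) chart set \<Rightarrow> bool" where
  "smooth_manifold A \<longleftrightarrow>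
     (\<forall>c\<in>A. inj_on (snd c) (fst c) \<and> open (snd c ` fst c)) \<and>
     (\<forall>c\<in>A. \<forall>d\<in>A. open (snd c ` (fst c \<inter> fst d)) \<and>
        (\<forall>k. Ck_on k (snd d \<circ> chart_inv c) (snd c ` (fst c \<inter> fst d)))) \<and>
     Hausdorff_space (atlas_topology A) \<and> second_countable (atlas_topology A)"

(* F is a C^k map from the open subset W of the manifold A into the manifold B. Openness of the
   coordinate domains amounts to W being open and F being continuous. *)
definition Ck_map ::
  "nat \<Rightarrow> ('m, 'd::euclidean_space) chart set \<Rightarrow> ('n, 'e::euclidean_space) chart set \<Rightarrow>
   'm set \<Rightarrow> ('m \<Rightarrow> 'n) \<Rightarrow> bool" where
  "Ck_map k A B W F \<longleftrightarrow>
     W \<subseteq> manifold_carrier A \<and> F ` W \<subseteq> manifold_carrier B \<and>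
     (\<forall>c\<in>A. \<forall>d\<in>B. let D = snd c ` (W \<inter> fst c \<inter> F -` fst d) in
        open D \<and> Ck_on k (snd d \<circ> F \<circ> chart_inv c) D)"

definition smooth_map ::
  "('m, 'd::euclidean_space) chart set \<Rightarrow> ('n, 'e::euclidean_space) chart set \<Rightarrow>
   'm set \<Rightarrow> ('m \<Rightarrow> 'n) \<Rightarrow> bool" where
  "smooth_map A B W F \<longleftrightarrow> (\<forall>k. Ck_map k A B W F)"

definition Ck_diffeo_of ::
  "nat \<Rightarrow> ('m, 'e::euclidean_space) chart set \<Rightarrow> 'm set \<Rightarrow> ('m \<Rightarrow> 'm) \<Rightarrow> bool" where
  "Ck_diffeo_of k A W F \<longleftrightarrow>
     bij_betw F W W \<and> Ck_map k A A W F \<and> Ck_map k A A W (inv_into W F)"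

definition euclidean_atlas :: "('e, 'e::euclidean_space) chart set" where
  "euclidean_atlas = {(UNIV, id)}"

definition locally_lipschitz_fun ::
  "('m, 'e::euclidean_space) chart set \<Rightarrow> 'm set \<Rightarrow> ('m \<Rightarrow> real) \<Rightarrow> bool" where
  "locally_lipschitz_fun A W f \<longleftrightarrow>
     (\<forall>c\<in>A. \<forall>x \<in> snd c ` (W \<inter> fst c). \<exists>r>0. \<exists>L.
        L-lipschitz_on (ball x r \<inter> snd c ` (W \<inter> fst c)) (f \<circ> chart_inv c))"

(* A covector at q is a family of coordinate vectors, one for each chart c around q, obeying the
   transformation law of covectors under changes of coordinates: p c is the image of p d under
   the adjoint of the derivative of the transition map from c to d. The coordinate space 'e is
   identified with its dual by the inner product. Components at charts not containing q are set
   to 0, so that the vector space operations are pointwise and a covector is determined by its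
   component in any chart around q. *)
type_synonym ('m, 'e) covector = "('m, 'e) chart \<Rightarrow> 'e"

definition cotangent_space ::
  "('m, 'e::euclidean_space) chart set \<Rightarrow> 'm \<Rightarrow> ('m, 'e) covector set" where
  "cotangent_space A q = {p.
     (\<forall>c\<in>A. \<forall>d\<in>A. q \<in> fst c \<longrightarrow> q \<in> fst d \<longrightarrow>
        (\<forall>v. p c \<bullet> v = p d \<bullet> frechet_derivative (snd d \<circ> chart_inv c) (at (snd c q)) v)) \<and>
     (\<forall>c. \<not> (c \<in> A \<and> q \<in> fst c) \<longrightarrow> p c = 0)}"

definition cotangent_over ::
  "('m, 'e::euclidean_space) chart set \<Rightarrow> 'm set \<Rightarrow> ('m \<times> ('m, 'e) covector) set" where
  "cotangent_over A Q = Sigma Q (cotangent_space A)"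

abbreviation cotangent_bundle ::
  "('m, 'e::euclidean_space) chart set \<Rightarrow> ('m \<times> ('m, 'e) covector) set" where
  "cotangent_bundle A \<equiv> cotangent_over A (manifold_carrier A)"

definition cotangent_chart ::
  "('m, 'e::euclidean_space) chart set \<Rightarrow> ('m, 'e) chart \<Rightarrow>
   ('m \<times> ('m, 'e) covector, 'e \<times> 'e) chart" where
  "cotangent_chart A c = (cotangent_over A (fst c), \<lambda>(q, p). (snd c q, p c))"

definition cotangent_atlas ::
  "('m, 'e::euclidean_space) chart set \<Rightarrow> ('m \<times> ('m, 'e) covector, 'e \<times> 'e) chart set" where
  "cotangent_atlas A = cotangent_chart A ` A"

definition fiber_shift ::
  "('m, 'e::euclidean_space) covector \<Rightarrow> real \<Rightarrow> ('m, 'e) covector \<Rightarrow> ('m, 'e) covector" where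
  "fiber_shift p t \<delta> = (\<lambda>c. p c + t *\<^sub>R \<delta> c)"

(* The vertical derivative of H at (q, p), as a linear form in the covector \<delta> at q. *)
definition fiber_deriv ::
  "('m \<times> ('m, 'e::euclidean_space) covector \<Rightarrow> real) \<Rightarrow>
   'm \<times> ('m, 'e) covector \<Rightarrow> ('m, 'e) covector \<Rightarrow> real" where
  "fiber_deriv H x \<delta> = deriv (\<lambda>t. H (fst x, fiber_shift (snd x) t \<delta>)) 0"

definition fiber_hessian ::
  "('m \<times> ('m, 'e::euclidean_space) covector \<Rightarrow> real) \<Rightarrow>
   'm \<times> ('m, 'e) covector \<Rightarrow> ('m, 'e) covector \<Rightarrow> ('m, 'e) covector \<Rightarrow> real" where
  "fiber_hessian H x \<delta> \<epsilon> = deriv (\<lambda>s. fiber_deriv H (fst x, fiber_shift (snd x) s \<delta>) \<epsilon>) 0"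

definition convex_hamiltonian ::
  "('m, 'e::euclidean_space) chart set \<Rightarrow> ('m \<times> ('m, 'e) covector \<Rightarrow> real) \<Rightarrow> bool" where
  "convex_hamiltonian A H \<longleftrightarrow>
     (\<forall>x \<in> cotangent_bundle A. \<forall>\<delta> \<in> cotangent_space A (fst x).
        \<delta> \<noteq> (\<lambda>_. 0) \<longrightarrow> fiber_hessian H x \<delta> \<delta> > 0)"

definition breve ::
  "('m, 'e::euclidean_space) chart set \<Rightarrow> ('m \<times> ('m, 'e) covector \<Rightarrow> real) \<Rightarrow> 'm set" where
  "breve A H = {q \<in> manifold_carrier A.
     \<exists>p \<in> cotangent_space A q. \<forall>p' \<in> cotangent_space A q. H (q, p) \<le> H (q, p')}"

definition wp ::
  "('m, 'e::euclidean_space) chart set \<Rightarrow> ('m \<times> ('m, 'e) covector \<Rightarrow> real) \<Rightarrow>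
   'm \<Rightarrow> ('m, 'e) covector" where
  "wp A H q = (THE p. p \<in> cotangent_space A q \<and>
     (\<forall>p' \<in> cotangent_space A q. H (q, p) \<le> H (q, p')))"

definition wp_graph ::
  "('m, 'e::euclidean_space) chart set \<Rightarrow> ('m \<times> ('m, 'e) covector \<Rightarrow> real) \<Rightarrow>
   ('m \<times> ('m, 'e) covector) set" where
  "wp_graph A H = (\<lambda>q. (q, wp A H q)) ` breve A H"

(* Meaningful on cotangent_over A (breve A H) - wp_graph A H, where the vertical derivative of H at
   x does not vanish; proportionality to it can therefore be written with a single factor. *)
definition level_involution ::
  "('m, 'e::euclidean_space) chart set \<Rightarrow> ('m \<times> ('m, 'e) covector \<Rightarrow> real) \<Rightarrow>
   'm \<times> ('m, 'e) covector \<Rightarrow> 'm \<times> ('m, 'e) covector" where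
  "level_involution A H x = (fst x, THE p'. p' \<in> cotangent_space A (fst x) \<and> p' \<noteq> snd x \<and>
     (\<exists>s. \<forall>\<delta> \<in> cotangent_space A (fst x).
        fiber_deriv H (fst x, p') \<delta> = s * fiber_deriv H x \<delta>) \<and>
     H (fst x, p') = H x)"

definition varsig ::
  "('m, 'e::euclidean_space) chart set \<Rightarrow> ('m \<times> ('m, 'e) covector \<Rightarrow> real) \<Rightarrow>
   'm \<times> ('m, 'e) covector \<Rightarrow> real" where
  "varsig A H x = (THE s. s > 0 \<and> (\<forall>\<delta> \<in> cotangent_space A (fst x).
     fiber_deriv H (level_involution A H x) \<delta> = - s * fiber_deriv H x \<delta>))"

end

theory Submission
  imports Defs
begin

text \<open>In coordinates, the point opposite to \<open>p\<close> and the factor \<open>\<varsigma>\<close> solve, off the minimum, an equation to which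
  the implicit function theorem applies, because the fiber Hessian is positive definite. To see what
  happens at the minimum, translate it to \<open>p = 0\<close> and blow it up: the functions
  \<open>N (q, r) \<theta> = (H (q, r *\<^sub>R \<theta>) - H (q, 0)) / r\<^sup>2\<close> form a smooth family of convex functions of \<open>\<theta>\<close> with
  parameters \<open>(q, r)\<close>, including \<open>r = 0\<close>, where \<open>N\<close> is a quadratic form. Opposite points of \<open>H\<close> are the
  rescaled opposite points of \<open>N\<close>, and for the quadratic form these are \<open>\<theta>\<close> and \<open>- \<theta>\<close> with factor \<open>1\<close>. Hence
  the opposite of \<open>p\<close> and the factor differ from \<open>- p\<close> and \<open>1\<close> by \<open>O(\<bar>p\<bar>\<^sup>2)\<close> and \<open>O(\<bar>p\<bar>)\<close>, and their derivatives
  by \<open>O(\<bar>p\<bar>)\<close> and \<open>O(1)\<close>.\<close>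

section \<open>Maps of class $C^k$\<close>

text \<open>The equation for the opposite point and the factor degenerates at the minimum: the
  minimum, paired with itself, solves it with every factor, so no implicit function theorem can
  start there. The blow-up removes this, because \<theta> stays on the unit sphere, away from the
  minimum of \<open>N (q, r)\<close>, even at r = 0. Smoothness of N through r = 0 comes from
  writing it as an integral of the fiber Hessian instead of a quotient. The opposite map of N minus
  its value (- \<theta>, 1) at r = 0 vanishes at r = 0 together with its first q and \<theta>
  derivatives, so it and these derivatives are O(r), uniformly on compact sets. Putting \<theta> = p
  / r costs a factor 1 / r in a p derivative; the point, but not the factor, regains it from the
  rescaling by r. This asymmetry separates the C^1 conclusion for the involution from the Lipschitz
  one for the factor. The differentiation keeps r constant and takes r = \<bar>p\<bar> only at the
  point considered, so the norm is never differentiated. All this happens on an open set times a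
  vector space; charts only transport the result.\<close>

lemma Ck_on_cong:
  assumes "open S" "\<And>x. x \<in> S \<Longrightarrow> f x = g x" "Ck_on k f S"
  shows "Ck_on k g S"
  using assms
proof (induction k arbitrary: f g)
  case 0
  then show ?case by (simp cong: continuous_on_cong)
next
  case (Suc k)
  have d: "g differentiable (at x)" "frechet_derivative f (at x) = frechet_derivative g (at x)" if "x \<in> S" for x
  proof -
    have "f differentiable (at x)" using Suc.prems(3) that by simp
    then have "(f has_derivative frechet_derivative f (at x)) (at x)"
      by (simp add: frechet_derivative_works)
    then have "(g has_derivative frechet_derivative f (at x)) (at x)"
      by (rule has_derivative_transform_within_open[OF _ Suc.prems(1) that]) (use Suc.prems in auto)
    then show "g differentiable (at x)" "frechet_derivative f (at x) = frechet_derivative g (at x)"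
      by (auto simp: differentiable_def frechet_derivative_at)
  qed
  have "Ck_on k (\<lambda>x. frechet_derivative g (at x) v) S" for v
    using Suc.IH[of "\<lambda>x. frechet_derivative f (at x) v"] Suc.prems d by auto
  then show ?case using d by auto
qed

lemma Ck_on_has_derivative:
  assumes "Ck_on (Suc k) f S" "x \<in> S"
  shows "(f has_derivative frechet_derivative f (at x)) (at x)"
  using assms by (simp add: frechet_derivative_works)

text \<open>\<open>frechet_derivative\<close> is a choice operator, awkward on concrete maps. By
  uniqueness of derivatives an explicit family f' may stand in for it; this is how most lemmas below
  climb one order.\<close>

lemma Ck_on_SucI:
  assumes "open S" "\<And>x. x \<in> S \<Longrightarrow> (f has_derivative f' x) (at x)" "\<And>v. Ck_on k (\<lambda>x. f' x v) S"
  shows "Ck_on (Suc k) f S"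
proof -
  have "f' x = frechet_derivative f (at x)" if "x \<in> S" for x
    using assms(2)[OF that] by (rule frechet_derivative_at)
  then have "Ck_on k (\<lambda>x. frechet_derivative f (at x) v) S" for v
    by (intro Ck_on_cong[OF assms(1) _ assms(3)[of v]]) auto
  then show ?thesis using assms(2) by (auto simp: differentiable_def)
qed

lemma Ck_on_imp_continuous_on: "Ck_on k f S \<Longrightarrow> continuous_on S f"
  by (cases k)
    (auto intro!: continuous_at_imp_continuous_on differentiable_imp_continuous_within)

lemma Ck_on_Suc_imp: "Ck_on (Suc k) f S \<Longrightarrow> Ck_on k f S"
proof (induction k arbitrary: f)
  case 0
  then show ?case using Ck_on_imp_continuous_on[OF 0] by simp
next
  case (Suc k)
  then show ?case by (metis Ck_on.simps(2))
qed

lemma Ck_on_le: "Ck_on k f S \<Longrightarrow> j \<le> k \<Longrightarrow> Ck_on j f S"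
proof (induction k)
  case (Suc k)
  then show ?case using Ck_on_Suc_imp[of k f S] by (cases "j = Suc k") (auto simp del: Ck_on.simps)
qed simp

lemma Ck_on_subset: "Ck_on k f S \<Longrightarrow> T \<subseteq> S \<Longrightarrow> Ck_on k f T"
  by (induction k arbitrary: f) (auto intro: continuous_on_subset)

lemma Ck_on_local:
  assumes "\<And>x. x \<in> S \<Longrightarrow> \<exists>U. open U \<and> x \<in> U \<and> Ck_on k f U"
  shows "Ck_on k f S"
  using assms
proof (induction k arbitrary: f)
  case 0
  then show ?case
    by (metis Ck_on.simps(1) continuous_at_imp_continuous_on continuous_on_eq_continuous_at)
next
  case (Suc k)
  have "f differentiable (at x)" if "x \<in> S" for x
    using Suc.prems[OF that] by auto
  moreover have "Ck_on k (\<lambda>x. frechet_derivative f (at x) v) S" for v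
    using Suc.prems by (intro Suc.IH) fastforce
  ultimately show ?case by simp
qed

lemma Ck_on_const: "Ck_on k (\<lambda>x. c) S"
  by (induction k arbitrary: c) (auto simp: frechet_derivative_const)

lemma Ck_on_bounded_linear:
  assumes "open S" "bounded_linear L" "Ck_on k f S"
  shows "Ck_on k (\<lambda>x. L (f x)) S"
  using assms(3)
proof (induction k arbitrary: f)
  case 0
  then show ?case using bounded_linear.continuous_on[OF assms(2)] by simp
next
  case (Suc k)
  show ?case
    by (rule Ck_on_SucI[OF assms(1) bounded_linear.has_derivative[OF assms(2) Ck_on_has_derivative[OF Suc.prems]]])
      (use Suc in auto)
qed

lemma Ck_on_ident:
  assumes "open S"
  shows "Ck_on k (\<lambda>x. x) S"
proof (cases k)
  case (Suc j)
  show ?thesis unfolding Suc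
    by (rule Ck_on_SucI[OF assms has_derivative_ident]) (rule Ck_on_const)
qed simp

lemma Ck_on_add:
  assumes "open S" "Ck_on k f S" "Ck_on k g S"
  shows "Ck_on k (\<lambda>x. f x + g x) S"
  using assms(2,3)
proof (induction k arbitrary: f g)
  case 0
  then show ?case by (simp add: continuous_on_add)
next
  case (Suc k)
  show ?case
    by (rule Ck_on_SucI[OF assms(1)
          has_derivative_add[OF Ck_on_has_derivative[OF Suc.prems(1)] Ck_on_has_derivative[OF Suc.prems(2)]]])
      (use Suc in auto)
qed

lemma Ck_on_sum:
  assumes "open S" "\<And>i. i \<in> I \<Longrightarrow> Ck_on k (f i) S"
  shows "Ck_on k (\<lambda>x. \<Sum>i\<in>I. f i x) S"
  using assms(2)
  by (induction I rule: infinite_finite_induct) (auto intro: Ck_on_const Ck_on_add assms(1))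

lemma Ck_on_bounded_bilinear:
  assumes "open S" "bounded_bilinear bil" "Ck_on k f S" "Ck_on k g S"
  shows "Ck_on k (\<lambda>x. bil (f x) (g x)) S"
  using assms(3,4)
proof (induction k arbitrary: f g)
  case 0
  then show ?case using bounded_bilinear.continuous_on[OF assms(2)] by simp
next
  case (Suc k)
  show ?case
    by (rule Ck_on_SucI[OF assms(1) bounded_bilinear.FDERIV[OF assms(2)
          Ck_on_has_derivative[OF Suc.prems(1)] Ck_on_has_derivative[OF Suc.prems(2)]]])
      (use Suc Ck_on_Suc_imp[OF Suc.prems(1)] Ck_on_Suc_imp[OF Suc.prems(2)] in \<open>auto intro!: Ck_on_add assms(1)\<close>)
qed

lemmas Ck_on_scaleR = Ck_on_bounded_bilinear[OF _ bounded_bilinear_scaleR]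
  and Ck_on_inner = Ck_on_bounded_bilinear[OF _ bounded_bilinear_inner]
  and Ck_on_mult = Ck_on_bounded_bilinear[OF _ bounded_bilinear_mult]

lemma Ck_on_uminus: "open S \<Longrightarrow> Ck_on k f S \<Longrightarrow> Ck_on k (\<lambda>x. - f x) S"
  using Ck_on_bounded_linear[OF _ bounded_linear_minus[OF bounded_linear_ident]] by blast

lemma Ck_on_diff: "open S \<Longrightarrow> Ck_on k f S \<Longrightarrow> Ck_on k g S \<Longrightarrow> Ck_on k (\<lambda>x. f x - g x) S"
  using Ck_on_add[of S k f "\<lambda>x. - g x"] Ck_on_uminus by auto

lemma Ck_on_fst: "open S \<Longrightarrow> Ck_on k f S \<Longrightarrow> Ck_on k (\<lambda>x. fst (f x)) S"
  by (rule Ck_on_bounded_linear[OF _ bounded_linear_fst])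

lemma Ck_on_snd: "open S \<Longrightarrow> Ck_on k f S \<Longrightarrow> Ck_on k (\<lambda>x. snd (f x)) S"
  by (rule Ck_on_bounded_linear[OF _ bounded_linear_snd])

lemma Ck_on_Pair:
  assumes "open S" "Ck_on k f S" "Ck_on k g S"
  shows "Ck_on k (\<lambda>x. (f x, g x)) S"
  using Ck_on_add[OF assms(1)
      Ck_on_bounded_linear[OF assms(1) bounded_linear_Pair[OF bounded_linear_ident bounded_linear_zero] assms(2)]
      Ck_on_bounded_linear[OF assms(1) bounded_linear_Pair[OF bounded_linear_zero bounded_linear_ident] assms(3)]]
  by simp

section \<open>Linear maps depending on a parameter: application, composition, inversion\<close>

lemma linear_eq_sum_Basis:
  fixes L :: "'a::euclidean_space \<Rightarrow> 'b::real_vector"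
  assumes "linear L"
  shows "L v = (\<Sum>b\<in>Basis. (v \<bullet> b) *\<^sub>R L b)"
proof -
  have "L v = L (\<Sum>b\<in>Basis. (v \<bullet> b) *\<^sub>R b)" by (simp add: euclidean_representation)
  then show ?thesis using assms by (simp add: linear_sum linear_cmul)
qed

text \<open>C^k dependence of a linear map is expressed by its values on fixed vectors, which keeps
  operator spaces out of the notion of C^k. A varying argument is handled by expanding it in the
  basis.\<close>

lemma Ck_on_linear_apply:
  fixes L :: "'a::euclidean_space \<Rightarrow> 'b::euclidean_space \<Rightarrow> 'c::euclidean_space"
  assumes "open S" "\<And>x. x \<in> S \<Longrightarrow> linear (L x)" "\<And>b. Ck_on k (\<lambda>x. L x b) S" "Ck_on k f S"
  shows "Ck_on k (\<lambda>x. L x (f x)) S"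
proof -
  have "Ck_on k (\<lambda>x. \<Sum>b\<in>Basis. (f x \<bullet> b) *\<^sub>R L x b) S"
    by (intro Ck_on_sum Ck_on_scaleR Ck_on_inner Ck_on_const assms)
  then show ?thesis
    by (rule Ck_on_cong[OF assms(1), rotated]) (rule linear_eq_sum_Basis[OF assms(2), symmetric])
qed

text \<open>The induction varies f only: the derivative is that of f at g x, applied to that of g,
  and the induction hypothesis serves for the derivative of f on a fixed vector with the same inner
  map g.\<close>

lemma Ck_on_compose:
  assumes "open S" "open T" "g ` S \<subseteq> T" "Ck_on k f T" "Ck_on k g S"
  shows "Ck_on k (\<lambda>x. f (g x)) S"
  using assms(4,5)
proof (induction k arbitrary: f)
  case 0
  then show ?case using continuous_on_compose2 assms(3) by auto
next
  case (Suc k)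
  have f: "(f has_derivative frechet_derivative f (at (g x))) (at (g x))" if "x \<in> S" for x
    using Ck_on_has_derivative[OF Suc.prems(1)] assms(3) that by blast
  note g = Ck_on_has_derivative[OF Suc.prems(2)]
  show ?case
  proof (rule Ck_on_SucI[OF assms(1) has_derivative_compose[OF g f]])
    show "Ck_on k (\<lambda>x. frechet_derivative f (at (g x)) (frechet_derivative g (at x) v)) S" for v
    proof (rule Ck_on_linear_apply[OF assms(1), where L = "\<lambda>x. frechet_derivative f (at (g x))"])
      show "linear (frechet_derivative f (at (g x)))" if "x \<in> S" for x
        using f[OF that] has_derivative_linear by blast
      show "Ck_on k (\<lambda>x. frechet_derivative f (at (g x)) b) S" for b
        using Suc.IH[of "\<lambda>y. frechet_derivative f (at y) b"] Suc.prems Ck_on_Suc_imp by auto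
    qed (use Suc.prems in auto)
  qed auto
qed

text \<open>The product rule at a zero of f. The term containing the derivative of g would be
  multiplied by f x = 0, so continuity of g suffices; this allows differentiating an inverse that is
  so far only known to be continuous.\<close>

lemma has_derivative_scaleR_vanishing:
  fixes f :: "'a::real_normed_vector \<Rightarrow> real" and g :: "'a \<Rightarrow> 'b::real_normed_vector"
  assumes f: "(f has_derivative f') (at x)" "f x = 0" and g: "isCont g x"
  shows "((\<lambda>y. f y *\<^sub>R g y) has_derivative (\<lambda>h. f' h *\<^sub>R g x)) (at x)"
proof -
  have 1: "((\<lambda>y. f y *\<^sub>R g x) has_derivative (\<lambda>h. f' h *\<^sub>R g x)) (at x)"
    using f(1) by (auto intro!: derivative_eq_intros)
  \<comment> \<open>What remains after freezing g at x is of smaller order than y - x: f y divided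
    by the norm of y - x stays bounded while g y - g x tends to 0.\<close>
  have "((\<lambda>y. f y *\<^sub>R (g y - g x)) has_derivative (\<lambda>h. 0)) (at x)"
    unfolding has_derivative_at_within
  proof (intro conjI)
    interpret f': bounded_linear f' using f(1) by (rule has_derivative_bounded_linear)
    obtain C where C: "\<And>h. norm (f' h) \<le> norm h * C" using f'.bounded by blast
    have q: "((\<lambda>y. (1 / norm (y - x)) *\<^sub>R (f y - f x - f' (y - x))) \<longlongrightarrow> 0) (at x)"
      using f(1) unfolding has_derivative_at_within inverse_eq_divide by blast
    have gx: "((\<lambda>y. g y - g x) \<longlongrightarrow> 0) (at x)"
      using g by (simp add: isCont_def LIM_zero)
    have b: "Bfun (\<lambda>y. f' (y - x) / norm (y - x)) (at x)"
    proof (rule BfunI)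
      show "\<forall>\<^sub>F y in at x. norm (f' (y - x) / norm (y - x)) \<le> C"
      proof (rule eventually_mono[of "\<lambda>y. y \<noteq> x"])
        show "\<forall>\<^sub>F y in at x. y \<noteq> x" by (auto simp: eventually_at_filter)
        show "norm (f' (y - x) / norm (y - x)) \<le> C" if "y \<noteq> x" for y
          using C[of "y - x"] that by (simp add: divide_le_eq mult.commute)
      qed
    qed
    have "((\<lambda>y. (f' (y - x) / norm (y - x)) *\<^sub>R (g y - g x)) \<longlongrightarrow> 0) (at x)"
      using bounded_bilinear.Bfun_prod_Zfun[OF bounded_bilinear_scaleR b] gx
      by (simp add: tendsto_Zfun_iff)
    moreover have "((\<lambda>y. ((1 / norm (y - x)) *\<^sub>R (f y - f x - f' (y - x))) *\<^sub>R (g y - g x)) \<longlongrightarrow> 0) (at x)"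
      using tendsto_scaleR[OF q gx] by simp
    ultimately have lim: "((\<lambda>y. (f' (y - x) / norm (y - x)) *\<^sub>R (g y - g x)
      + ((1 / norm (y - x)) *\<^sub>R (f y - f x - f' (y - x))) *\<^sub>R (g y - g x)) \<longlongrightarrow> 0) (at x)"
      using tendsto_add by fastforce
    have eq: "(f' (y - x) / norm (y - x)) *\<^sub>R (g y - g x)
      + ((1 / norm (y - x)) *\<^sub>R (f y - f x - f' (y - x))) *\<^sub>R (g y - g x)
      = (1 / norm (y - x)) *\<^sub>R (f y *\<^sub>R (g y - g x) - f x *\<^sub>R (g x - g x) - 0)" for y
      unfolding scaleR_add_left[symmetric] by (simp add: f(2) diff_divide_distrib)
    show "((\<lambda>y. (f y *\<^sub>R (g y - g x) - f x *\<^sub>R (g x - g x) - 0) /\<^sub>R norm (y - x)) \<longlongrightarrow> 0) (at x)"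
      using lim unfolding eq inverse_eq_divide .
  qed simp
  from has_derivative_add[OF 1 this]
  have "((\<lambda>y. f y *\<^sub>R g x + f y *\<^sub>R (g y - g x)) has_derivative (\<lambda>h. f' h *\<^sub>R g x)) (at x)"
    by simp
  then show ?thesis
    by (rule has_derivative_transform_within_open[OF _ open_UNIV]) (auto simp: scaleR_diff_right)
qed

text \<open>A lower bound B for \<open>L x\<close> survives as B / 2 for \<open>L y\<close> with y
  near x. Applied to w = inv (L y) v - u with u = inv (L x) v, it bounds w by L y u - L x u, because
  L y w is the negative of that difference.\<close>

lemma isCont_inv_linear:
  fixes L :: "'a::euclidean_space \<Rightarrow> 'b::euclidean_space \<Rightarrow> 'b"
  assumes S: "open S" and lin: "\<And>x. x \<in> S \<Longrightarrow> linear (L x)" and inj: "\<And>x. x \<in> S \<Longrightarrow> inj (L x)"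
    and cont: "\<And>w. continuous_on S (\<lambda>x. L x w)" and x: "x \<in> S"
  shows "isCont (\<lambda>y. inv (L y) v) x"
proof -
  have ev: "\<forall>\<^sub>F y in at x. y \<in> S"
    using eventually_at_in_open'[OF S x] .
  have L: "((\<lambda>y. L y w - L x w) \<longlongrightarrow> 0) (at x)" for w
    using cont[of w] S x by (simp add: continuous_on_eq_continuous_at isCont_def LIM_zero)
  obtain B where B: "B > 0" "\<And>w. B * norm w \<le> norm (L x w)"
    using linear_inj_bounded_below_pos[OF lin[OF x] inj[OF x]] by blast
  have surj: "L y (inv (L y) v) = v" if "y \<in> S" for y
    using linear_injective_imp_surjective[OF lin[OF that] inj[OF that]] by (simp add: surj_f_inv_f)
  define u where "u = inv (L x) v"
  have "((\<lambda>y. \<Sum>b\<in>Basis. norm (L y b - L x b)) \<longlongrightarrow> (\<Sum>b\<in>(Basis::'b set). 0)) (at x)"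
    by (intro tendsto_sum tendsto_norm_zero L)
  then have "\<forall>\<^sub>F y in at x. (\<Sum>b\<in>Basis. norm (L y b - L x b)) < B / 2"
    using B(1) by (intro order_tendstoD) auto
  then have "\<forall>\<^sub>F y in at x. norm (inv (L y) v - u) \<le> norm (L y u - L x u) * (2 / B)"
    using ev
  proof eventually_elim
    case (elim y)
    let ?w = "inv (L y) v - u"
    have "L y ?w - L x ?w = (\<Sum>b\<in>Basis. (?w \<bullet> b) *\<^sub>R (L y b - L x b))"
      using linear_eq_sum_Basis[OF linear_compose_sub[OF lin[OF elim(2)] lin[OF x]], of ?w] .
    also have "norm \<dots> \<le> (\<Sum>b\<in>Basis. norm ?w * norm (L y b - L x b))"
      by (rule order_trans[OF norm_sum]) (auto intro!: sum_mono mult_right_mono Basis_le_norm)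
    also have "\<dots> = norm ?w * (\<Sum>b\<in>Basis. norm (L y b - L x b))"
      by (simp add: sum_distrib_left)
    also have "\<dots> \<le> norm ?w * (B / 2)"
      by (rule mult_left_mono) (use elim in auto)
    finally have "norm (L y ?w - L x ?w) \<le> norm ?w * (B / 2)" .
    moreover have "B * norm ?w \<le> norm (L x ?w)" by (rule B)
    moreover have "norm (L x ?w) \<le> norm (L y ?w) + norm (L y ?w - L x ?w)"
      using norm_triangle_sub[of "L x ?w" "L y ?w"] by (simp only: norm_minus_commute)
    ultimately have "(B / 2) * norm ?w \<le> norm (L y ?w)" by (simp add: algebra_simps)
    also have "L y ?w = - (L y u - L x u)"
      using surj[OF elim(2)] surj[OF x] linear_diff[OF lin[OF elim(2)]] by (simp add: u_def)
    finally have "(B / 2) * norm ?w \<le> norm (L y u - L x u)" by (simp only: norm_minus_cancel)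
    then show ?case using B(1) by (simp add: pos_le_divide_eq mult.commute)
  qed
  moreover have "((\<lambda>y. norm (L y u - L x u) * (2 / B)) \<longlongrightarrow> 0) (at x)"
    using tendsto_mult[OF tendsto_norm_zero[OF L[of u]] tendsto_const[of "2 / B"]] by simp
  ultimately have "((\<lambda>y. inv (L y) v - u) \<longlongrightarrow> 0) (at x)"
    by (rule Lim_null_comparison)
  then show ?thesis unfolding isCont_def u_def by (rule LIM_zero_cancel)
qed

text \<open>Induction on the formula for the derivative of an inverse, minus the composition of the
  inverse, the derivative of L and the inverse: its right side needs the inverse only at the lower
  order.\<close>

lemma Ck_on_inv_linear:
  fixes L :: "'a::euclidean_space \<Rightarrow> 'b::euclidean_space \<Rightarrow> 'b"
  assumes S: "open S" and lin: "\<And>x. x \<in> S \<Longrightarrow> linear (L x)" and inj: "\<And>x. x \<in> S \<Longrightarrow> inj (L x)"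
    and "\<And>w. Ck_on k (\<lambda>x. L x w) S"
  shows "Ck_on k (\<lambda>x. inv (L x) v) S"
  using assms(4)
proof (induction k arbitrary: v)
  case 0
  then show ?case
    using isCont_inv_linear[OF S lin inj] by (simp add: continuous_at_imp_continuous_on)
next
  case (Suc k)
  have IH: "Ck_on k (\<lambda>x. inv (L x) v) S" for v
    using Suc.IH Suc.prems Ck_on_Suc_imp by blast
  have surj: "L y (inv (L y) v) = v" if "y \<in> S" for y v
    using linear_injective_imp_surjective[OF lin[OF that] inj[OF that]] by (simp add: surj_f_inv_f)
  have linv: "linear (inv (L y))" if "y \<in> S" for y
    using lin[OF that] inj[OF that] by (rule inj_linear_imp_inv_linear)
  show ?case
  proof (rule Ck_on_SucI[OF S])
    fix x assume x: "x \<in> S"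
    define u where "u = inv (L x) v"
    define z where "z y = L y u - L x u" for y
    define z' where "z' h = frechet_derivative (\<lambda>y. L y u) (at x) h" for h
    have z': "(z has_derivative z') (at x)"
      using has_derivative_diff[OF Ck_on_has_derivative[OF Suc.prems x] has_derivative_const, of u "L x u"]
      unfolding z_def z'_def by simp
    \<comment> \<open>This sum is \<open>inv (L y) (z y)\<close> = u - \<open>inv (L y) v\<close>.
      Expanded in the basis, each term is a function vanishing at x times one that is merely known
      to be continuous.\<close>
    have "((\<lambda>y. \<Sum>b\<in>Basis. (z y \<bullet> b) *\<^sub>R inv (L y) b) has_derivative
           (\<lambda>h. \<Sum>b\<in>Basis. (z' h \<bullet> b) *\<^sub>R inv (L x) b)) (at x)"
    proof (rule has_derivative_sum, rule has_derivative_scaleR_vanishing)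
      show "isCont (\<lambda>y. inv (L y) b) x" for b
        by (rule isCont_inv_linear[OF S lin inj Ck_on_imp_continuous_on[OF Suc.prems] x])
      show "((\<lambda>y. z y \<bullet> b) has_derivative (\<lambda>h. z' h \<bullet> b)) (at x)" for b
        using z' by (rule has_derivative_inner_left)
    qed (simp add: z_def)
    from has_derivative_diff[OF has_derivative_const[of u] this]
    have "((\<lambda>y. u - (\<Sum>b\<in>Basis. (z y \<bullet> b) *\<^sub>R inv (L y) b)) has_derivative
           (\<lambda>h. - (\<Sum>b\<in>Basis. (z' h \<bullet> b) *\<^sub>R inv (L x) b))) (at x)"
      by simp
    moreover have "u - (\<Sum>b\<in>Basis. (z y \<bullet> b) *\<^sub>R inv (L y) b) = inv (L y) v" if "y \<in> S" for y
    proof -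
      have "(\<Sum>b\<in>Basis. (z y \<bullet> b) *\<^sub>R inv (L y) b) = inv (L y) (z y)"
        by (rule linear_eq_sum_Basis[OF linv[OF that], symmetric])
      also have "\<dots> = u - inv (L y) v"
        using linear_diff[OF linv[OF that]] inv_f_f[OF inj[OF that]] surj[OF x] by (simp add: z_def u_def)
      finally show ?thesis by simp
    qed
    ultimately have "((\<lambda>y. inv (L y) v) has_derivative
           (\<lambda>h. - (\<Sum>b\<in>Basis. (z' h \<bullet> b) *\<^sub>R inv (L x) b))) (at x)"
      using has_derivative_transform_within_open[OF _ S x] by fastforce
    \<comment> \<open>The vector u depends on x. Expanding it writes the derivative through the maps
      \<open>\<lambda>y. L y c\<close> with c fixed, whose order is known.\<close>
    moreover have "z' h = (\<Sum>c\<in>Basis. (inv (L x) v \<bullet> c) *\<^sub>R frechet_derivative (\<lambda>y. L y c) (at x) h)" for h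
    proof -
      have "((\<lambda>y. \<Sum>c\<in>Basis. (u \<bullet> c) *\<^sub>R L y c) has_derivative
         (\<lambda>h. \<Sum>c\<in>Basis. (u \<bullet> c) *\<^sub>R frechet_derivative (\<lambda>y. L y c) (at x) h)) (at x)"
        by (intro has_derivative_sum has_derivative_scaleR_right Ck_on_has_derivative[OF Suc.prems x])
      then have "((\<lambda>y. L y u) has_derivative
         (\<lambda>h. \<Sum>c\<in>Basis. (u \<bullet> c) *\<^sub>R frechet_derivative (\<lambda>y. L y c) (at x) h)) (at x)"
        by (rule has_derivative_transform_within_open[OF _ S x])
          (rule linear_eq_sum_Basis[OF lin, symmetric])
      from fun_cong[OF frechet_derivative_at[OF this], of h] show ?thesis
        unfolding z'_def u_def by (rule sym)
    qed
    ultimately show "((\<lambda>y. inv (L y) v) has_derivative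
      (\<lambda>h. - (\<Sum>b\<in>Basis. ((\<Sum>c\<in>Basis. (inv (L x) v \<bullet> c) *\<^sub>R frechet_derivative (\<lambda>y. L y c) (at x) h) \<bullet> b) *\<^sub>R inv (L x) b))) (at x)"
      by simp
  next
    show "Ck_on k (\<lambda>x. - (\<Sum>b\<in>Basis. ((\<Sum>c\<in>Basis. (inv (L x) v \<bullet> c) *\<^sub>R frechet_derivative (\<lambda>y. L y c) (at x) h) \<bullet> b) *\<^sub>R inv (L x) b)) S" for h
      using Suc.prems by (intro Ck_on_uminus Ck_on_sum Ck_on_scaleR Ck_on_inner Ck_on_const IH S) auto
  qed
qed

section \<open>Implicit functions and integrals with parameters\<close>

lemma Ck_on_frechet_derivative:
  "Ck_on (Suc k) f S \<Longrightarrow> Ck_on k (\<lambda>x. frechet_derivative f (at x) v) S"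
  unfolding Ck_on.simps by blast

text \<open>Local inversion of (x, y) \<mapsto> (x, G (x, y)), whose derivative is injective because
  that of G is injective in the second variable. The inverse h sends (x, 0) to the zero of G over
  x.\<close>

theorem implicit_function_Ck:
  fixes G :: "'a::euclidean_space \<times> 'b::euclidean_space \<Rightarrow> 'b"
  assumes S: "open S" "(x0, y0) \<in> S" and G: "Ck_on (Suc k) G S" "G (x0, y0) = 0"
    and inj: "\<And>v. frechet_derivative G (at (x0, y0)) (0, v) = 0 \<Longrightarrow> v = 0"
  obtains U g where "open U" "x0 \<in> U" "g x0 = y0"
    "\<And>x. x \<in> U \<Longrightarrow> (x, g x) \<in> S \<and> G (x, g x) = 0" "Ck_on (Suc k) g U"
proof -
  define \<Phi> where "\<Phi> z = (fst z, G z)" for z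
  define D where "D z h = (fst h, frechet_derivative G (at z) h)" for z h
  note dG = Ck_on_has_derivative[OF G(1)]
  have d\<Phi>: "(\<Phi> has_derivative D z) (at z)" if "z \<in> S" for z
    unfolding \<Phi>_def D_def
    by (intro has_derivative_Pair has_derivative_fst has_derivative_ident dG that)
  have bl: "bounded_linear (D z)" if "z \<in> S" for z
    using d\<Phi>[OF that] by (rule has_derivative_bounded_linear)
  have CD: "Ck_on k (\<lambda>z. D z w) S" for w
    unfolding D_def by (intro Ck_on_Pair Ck_on_const Ck_on_frechet_derivative[OF G(1)] S)
  define f' where "f' z = Blinfun (D z)" for z
  have f': "blinfun_apply (f' z) = D z" if "z \<in> S" for z
    unfolding f'_def using bl[OF that] by (rule bounded_linear_Blinfun_apply)
  have inj0: "inj (D (x0, y0))"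
    unfolding linear_injective_0[OF bounded_linear.linear[OF bl[OF S(2)]]]
    using inj by (auto simp: D_def prod_eq_iff)
  have bl_inv: "bounded_linear (inv (D (x0, y0)))"
    using inj_linear_imp_inv_linear[OF bounded_linear.linear[OF bl[OF S(2)]] inj0]
    by (simp add: linear_conv_bounded_linear)
  \<comment> \<open>The inverse function theorem wants a left inverse of the derivative among
    bounded operators, and continuity of the derivative as an operator; the latter follows from
    continuity on each fixed vector.\<close>
  have "Blinfun (inv (D (x0, y0))) o\<^sub>L f' (x0, y0) = id_blinfun"
    by (rule blinfun_eqI) (simp add: bounded_linear_Blinfun_apply[OF bl_inv] f'[OF S(2)] inv_f_f[OF inj0])
  moreover have "continuous_on S f'"
    using Ck_on_imp_continuous_on[OF CD]
    by (intro continuous_on_blinfun_componentwise) (simp add: f' cong: continuous_on_cong)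
  moreover have "(\<Phi> has_derivative blinfun_apply (f' z)) (at z)" if "z \<in> S" for z
    using d\<Phi>[OF that] f'[OF that] by simp
  ultimately obtain U' V h h' where UV: "open U'" "U' \<subseteq> S" "(x0, y0) \<in> U'" "open V" "\<Phi> (x0, y0) \<in> V"
    "homeomorphism U' V \<Phi> h"
    and h: "\<And>y. y \<in> V \<Longrightarrow> (h has_derivative (h' y)) (at y)"
      "\<And>y. y \<in> V \<Longrightarrow> h' y = inv (blinfun_apply (f' (h y)))"
      "\<And>y. y \<in> V \<Longrightarrow> bij (blinfun_apply (f' (h y)))"
    using inverse_function_theorem[of S \<Phi> f' "(x0, y0)"] S by metis
  have hU: "h y \<in> U'" and \<Phi>h: "\<Phi> (h y) = y" if "y \<in> V" for y
    using UV(6) that by (auto simp: homeomorphism_def)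
  have hS: "h y \<in> S" if "y \<in> V" for y using hU[OF that] UV(2) by blast
  \<comment> \<open>Bootstrap: the derivative of h at y is the inverse of D at \<open>h y\<close>,
    so h of order j makes this derivative of order j and h of order j + 1, as far as the order k of
    D allows.\<close>
  have Ch: "Ck_on j h V" if "j \<le> Suc k" for j
    using that
  proof (induction j)
    case 0
    then show ?case using UV(6) by (simp add: homeomorphism_def)
  next
    case (Suc j)
    show ?case
    proof (rule Ck_on_SucI[OF UV(4) h(1)])
      fix v
      have "Ck_on j (\<lambda>y. inv (D (h y)) v) V"
      proof (rule Ck_on_inv_linear[OF UV(4)])
        show "linear (D (h y))" if "y \<in> V" for y
          using bl[OF hS[OF that]] by (rule bounded_linear.linear)
        show "inj (D (h y))" if "y \<in> V" for y
          using h(3)[OF that] f'[OF hS[OF that]] by (simp add: bij_def)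
        show "Ck_on j (\<lambda>y. D (h y) w) V" for w
          using Suc by (intro Ck_on_compose[OF UV(4) S(1) _ Ck_on_le[OF CD]]) (auto simp: hS)
      qed
      then show "Ck_on j (\<lambda>y. h' y v) V"
        by (rule Ck_on_cong[OF UV(4), rotated]) (simp add: h(2) f' hS)
    qed
  qed
  define U where "U = {x. (x, 0) \<in> V}"
  have oU: "open U"
  proof -
    have "U = (\<lambda>x. (x, 0)) -` V" by (auto simp: U_def)
    then show ?thesis using UV(4) by (auto intro!: open_vimage continuous_intros)
  qed
  show thesis
  proof
    show "open U" by (rule oU)
    show "x0 \<in> U" using UV(5) G(2) by (simp add: U_def \<Phi>_def)
    have "h (\<Phi> (x0, y0)) = (x0, y0)" using UV by (simp add: homeomorphism_def)
    then show "snd (h (x0, 0)) = y0" using G(2) by (simp add: \<Phi>_def)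
    show "(x, snd (h (x, 0))) \<in> S \<and> G (x, snd (h (x, 0))) = 0" if "x \<in> U" for x
    proof -
      have V: "(x, 0) \<in> V" using that by (simp add: U_def)
      then have "fst (h (x, 0)) = x" "G (h (x, 0)) = 0" using \<Phi>h[OF V] by (auto simp: \<Phi>_def)
      then show ?thesis using hS[OF V] by (metis prod.collapse)
    qed
    show "Ck_on (Suc k) (\<lambda>x. snd (h (x, 0))) U"
    proof (rule Ck_on_snd[OF oU], rule Ck_on_compose[OF oU UV(4) _ Ch])
      show "Ck_on (Suc k) (\<lambda>x. (x, 0::'b)) U"
        by (intro Ck_on_Pair Ck_on_ident Ck_on_const oU)
    qed (auto simp: U_def)
  qed
qed

text \<open>Repeated differentiation under the integral: the derivative in direction (v, 0) is an
  integrand of the same kind. The variable t runs over all reals in the hypothesis so that f lives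
  on an open set.\<close>

lemma Ck_on_integral:
  fixes f :: "'a::euclidean_space \<times> real \<Rightarrow> 'b::euclidean_space"
  assumes S: "open S" and f: "Ck_on k f (S \<times> UNIV)"
  shows "Ck_on k (\<lambda>x. integral {0..1} (\<lambda>t. f (x, t))) S"
  using f
proof (induction k arbitrary: f)
  case 0
  then have "continuous_on (S \<times> cbox 0 1) (\<lambda>(x, t). f (x, t))"
    by (auto intro: continuous_on_subset)
  then show ?case using integral_continuous_on_param[of S 0 1 "\<lambda>x t. f (x, t)"] by simp
next
  case (Suc k)
  let ?D = "\<lambda>x t v. frechet_derivative f (at (x, t)) (v, 0)"
  have df: "((\<lambda>x. f (x, t)) has_derivative ?D x t) (at x)" if "x \<in> S" for x t
  proof -
    have "((\<lambda>x. (x, t)) has_derivative (\<lambda>v. (v, 0))) (at x)"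
      by (intro has_derivative_Pair has_derivative_ident has_derivative_const)
    from has_derivative_compose[OF this Ck_on_has_derivative[OF Suc.prems, of "(x, t)"]] that
    show ?thesis by simp
  qed
  have CD: "Ck_on k (\<lambda>z. frechet_derivative f (at z) w) (S \<times> UNIV)" for w
    using Suc.prems by (rule Ck_on_frechet_derivative)
  define fx where "fx x t = Blinfun (?D x t)" for x t
  have fx: "blinfun_apply (fx x t) = ?D x t" if "x \<in> S" for x t
    unfolding fx_def by (rule bounded_linear_Blinfun_apply[OF has_derivative_bounded_linear[OF df[OF that]]])
  have cfx: "continuous_on (S \<times> UNIV) (\<lambda>(x, t). fx x t)"
  proof (rule continuous_on_blinfun_componentwise)
    fix i :: 'a
    show "continuous_on (S \<times> UNIV) (\<lambda>z. blinfun_apply (case z of (x, t) \<Rightarrow> fx x t) i)"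
      using Ck_on_imp_continuous_on[OF CD[of "(i, 0)"]]
      by (rule continuous_on_eq) (auto simp: fx)
  qed
  have d: "((\<lambda>x. integral {0..1} (\<lambda>t. f (x, t))) has_derivative (\<lambda>v. integral {0..1} (\<lambda>t. ?D x t v))) (at x)"
    if x: "x \<in> S" for x
  proof -
    obtain r where r: "r > 0" "ball x r \<subseteq> S" using S x open_contains_ball by blast
    have "((\<lambda>x. integral (cbox 0 1) (\<lambda>t. f (x, t))) has_derivative integral (cbox 0 1) (fx x)) (at x within ball x r)"
    proof (rule leibniz_rule)
      show "((\<lambda>x. f (x, t)) has_derivative blinfun_apply (fx y t)) (at y within ball x r)" if "y \<in> ball x r" for y t
      proof -
        have y: "y \<in> S" using that r by blast
        show ?thesis using df[OF y] unfolding fx[OF y] by (rule has_derivative_at_withinI)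
      qed
      show "(\<lambda>t. f (y, t)) integrable_on cbox 0 1" if "y \<in> ball x r" for y
        using that r
        by (intro integrable_continuous continuous_on_compose2[OF Ck_on_imp_continuous_on[OF Suc.prems]])
          (auto intro!: continuous_intros)
      show "continuous_on (ball x r \<times> cbox 0 1) (\<lambda>(x, t). fx x t)"
        by (rule continuous_on_subset[OF cfx]) (use r in auto)
    qed (use r in auto)
    then have 1: "((\<lambda>x. integral (cbox 0 1) (\<lambda>t. f (x, t))) has_derivative integral (cbox 0 1) (fx x)) (at x)"
      using r by (simp add: at_within_open[of x "ball x r"])
    have "fx x integrable_on cbox 0 1"
      using x by (intro integrable_continuous)
        (auto intro!: continuous_on_compose2[OF cfx, of _ "\<lambda>t. (x, t)", simplified] continuous_intros)
    then have "blinfun_apply (integral (cbox 0 1) (fx x)) v = integral (cbox 0 1) (\<lambda>t. ?D x t v)" for v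
      using blinfun_apply_integral[of "fx x" "cbox 0 1" v] fx[OF x] by simp
    then have "blinfun_apply (integral (cbox 0 1) (fx x)) = (\<lambda>v. integral (cbox 0 1) (\<lambda>t. ?D x t v))"
      by blast
    with 1 show ?thesis by simp
  qed
  show ?case
    by (rule Ck_on_SucI[OF S d]) (use Suc.IH CD in auto)
qed

section \<open>Strictly convex functions\<close>

text \<open>Strict convexity in first-order form, so that everything in this locale is comparison
  with tangents; second derivatives enter only through the criterion
  \<open>strictly_convex_functionI\<close>.\<close>

locale strictly_convex_function =
  fixes f :: "'e::euclidean_space \<Rightarrow> real" and g :: "'e \<Rightarrow> 'e"
  assumes has_gradient: "(f has_derivative (\<lambda>v. g x \<bullet> v)) (at x)"
    and above_tangent: "x \<noteq> y \<Longrightarrow> f x + g x \<bullet> (y - x) < f y"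
begin

lemma continuous: "continuous_on S f"
  using has_gradient by (meson continuous_at_imp_continuous_on has_derivative_continuous)

lemma critical_less: "g w = 0 \<Longrightarrow> y \<noteq> w \<Longrightarrow> f w < f y"
  using above_tangent[of w y] by auto

lemma critical_le: "g w = 0 \<Longrightarrow> f w \<le> f y"
  using critical_less[of w y] by (cases "y = w") auto

lemma minimum_critical:
  assumes "\<And>y. f w \<le> f y"
  shows "g w = 0"
proof -
  have "(\<lambda>v. g w \<bullet> v) = (\<lambda>v. 0)"
    by (rule has_derivative_local_min[OF has_gradient]) (simp add: assms)
  then have "g w \<bullet> g w = 0" by meson
  then show ?thesis by simp
qed

lemma critical_unique: "g w = 0 \<Longrightarrow> g w' = 0 \<Longrightarrow> w = w'"
  using critical_less[of w w'] critical_less[of w' w] by force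

text \<open>Let \<epsilon> be the least increase of f on the unit sphere about w. By convexity the
  average increase along a ray from w never drops, so it stays at least \<epsilon> beyond the
  sphere.\<close>

lemma coercive:
  assumes w: "g w = 0"
  obtains \<epsilon> where "\<epsilon> > 0" "\<And>x. 1 \<le> norm (x - w) \<Longrightarrow> f w + \<epsilon> * norm (x - w) \<le> f x"
proof -
  have "compact (sphere w 1)" "sphere w 1 \<noteq> {}" by auto
  then obtain z where z: "z \<in> sphere w 1" "\<And>y. y \<in> sphere w 1 \<Longrightarrow> f z \<le> f y"
    using continuous_attains_inf[OF _ _ continuous[of "sphere w 1"]] by blast
  show thesis
  proof
    have "z \<noteq> w" using z(1) by auto
    then show "f z - f w > 0" using critical_less[OF w, of z] by simp
    fix x assume x: "1 \<le> norm (x - w)"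
    define R where "R = norm (x - w)"
    define u where "u = (x - w) /\<^sub>R R"
    have R: "R \<ge> 1" and xu: "x = w + R *\<^sub>R u" and u: "norm u = 1"
    proof -
      have "norm (x - w) \<noteq> 0" using x by linarith
      then show "R \<ge> 1" "x = w + R *\<^sub>R u" "norm u = 1" using x by (auto simp: R_def u_def)
    qed
    have "w + u \<in> sphere w 1" using u by (simp add: dist_norm)
    then have fz: "f z \<le> f (w + u)" by (rule z)
    \<comment> \<open>The tangent at \<open>w + u\<close>, read at w, bounds its own slope in
      direction u from below; read at x, it carries this slope outwards.\<close>
    have "f (w + u) + g (w + u) \<bullet> (w - (w + u)) \<le> f w"
      using above_tangent[of "w + u" w] u by force
    then have 1: "f (w + u) - f w \<le> g (w + u) \<bullet> u" by simp
    have "f (w + u) + g (w + u) \<bullet> (x - (w + u)) \<le> f x"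
      using above_tangent[of "w + u" x] by force
    moreover have "x - (w + u) = (R - 1) *\<^sub>R u" by (simp add: xu algebra_simps)
    ultimately have "f (w + u) + (R - 1) * (g (w + u) \<bullet> u) \<le> f x" by simp
    moreover have "(R - 1) * (f (w + u) - f w) \<le> (R - 1) * (g (w + u) \<bullet> u)"
      using 1 R by (intro mult_left_mono) auto
    moreover have "R * (f z - f w) \<le> R * (f (w + u) - f w)"
      using fz R by (intro mult_left_mono) auto
    ultimately show "f w + (f z - f w) * norm (x - w) \<le> f x"
      by (simp add: R_def[symmetric] algebra_simps)
  qed
qed

lemma compact_sublevel:
  assumes "g w = 0"
  shows "compact {x. f x \<le> c}"
proof -
  obtain \<epsilon> where \<epsilon>: "\<epsilon> > 0" "\<And>x. 1 \<le> norm (x - w) \<Longrightarrow> f w + \<epsilon> * norm (x - w) \<le> f x"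
    using coercive[OF assms] by blast
  have "{x. f x \<le> c} \<subseteq> cball w (max 1 ((c - f w) / \<epsilon>))"
  proof
    fix x assume x: "x \<in> {x. f x \<le> c}"
    show "x \<in> cball w (max 1 ((c - f w) / \<epsilon>))"
    proof (cases "norm (x - w) < 1")
      case False
      then have "f w + \<epsilon> * norm (x - w) \<le> c" using \<epsilon>(2)[of x] x by simp
      then have "norm (x - w) \<le> (c - f w) / \<epsilon>" using \<epsilon>(1) by (simp add: field_simps)
      then show ?thesis by (auto simp: dist_norm norm_minus_commute)
    qed (auto simp: dist_norm norm_minus_commute)
  qed
  moreover have "closed {x. f x \<le> c}"
    using continuous by (intro closed_Collect_le continuous_on_const)
  ultimately show ?thesis
    using bounded_subset[OF bounded_cball] compact_eq_bounded_closed by blast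
qed

lemma descends:
  assumes "g x \<bullet> v < 0"
  obtains t where "t > 0" "f (x + t *\<^sub>R v) < f x"
proof -
  have "((\<lambda>t. x + t *\<^sub>R v) has_derivative (\<lambda>t. t *\<^sub>R v)) (at 0)"
    by (auto intro!: derivative_eq_intros)
  moreover have "(f has_derivative (\<lambda>h. g x \<bullet> h)) (at (x + 0 *\<^sub>R v))" using has_gradient[of x] by simp
  ultimately have "((\<lambda>t. f (x + t *\<^sub>R v)) has_derivative (\<lambda>t. g x \<bullet> (t *\<^sub>R v))) (at 0)"
    by (rule has_derivative_compose)
  then have "DERIV (\<lambda>t. f (x + t *\<^sub>R v)) 0 :> g x \<bullet> v"
    unfolding has_field_derivative_def by (simp add: mult_commute_abs)
  from DERIV_neg_dec_right[OF this assms] obtain d where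
    "d > 0" "\<And>h. 0 < h \<Longrightarrow> h < d \<Longrightarrow> f (x + h *\<^sub>R v) < f x" by auto
  then show thesis using that[of "d / 2"] by simp
qed

text \<open>The opposite point is the minimizer of the linear form \<open>g p\<close> on the sublevel set of \<open>p\<close>; the
  multiplier comes from the fact that no descent direction of \<^term>\<open>f\<close> decreases this linear form.\<close>

lemma opposite_exists:
  assumes w: "g w = 0" and p: "p \<noteq> w"
  obtains p' s where "s > 0" "g p' = - s *\<^sub>R g p" "f p' = f p"
proof -
  define v where "v = g p"
  have v0: "v \<noteq> 0" using critical_unique[OF w] p by (auto simp: v_def)
  let ?C = "{x. f x \<le> f p}"
  have "compact ?C" "?C \<noteq> {}" using compact_sublevel[OF w] by auto
  moreover have "continuous_on ?C (\<lambda>x. v \<bullet> x)" by (intro continuous_intros)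
  ultimately obtain p' where p': "f p' \<le> f p" "\<And>y. f y \<le> f p \<Longrightarrow> v \<bullet> p' \<le> v \<bullet> y"
    using continuous_attains_inf[of ?C "\<lambda>x. v \<bullet> x"] by auto
  \<comment> \<open>Strictly below the level of p there would be room to move a little along - v,
    which lowers the linear form.\<close>
  have fp': "f p' = f p"
  proof (rule ccontr)
    assume "f p' \<noteq> f p"
    then have "p' \<in> {x. f x < f p}" using p' by simp
    moreover have "open {x. f x < f p}" using continuous by (intro open_Collect_less) auto
    ultimately obtain e where e: "e > 0" "ball p' e \<subseteq> {x. f x < f p}"
      using open_contains_ball by blast
    let ?y = "p' - (e / (2 * norm v)) *\<^sub>R v"
    have "?y \<in> ball p' e" using e v0 by (simp add: dist_norm)
    then have "?y \<in> {x. f x < f p}" using e(2) by blast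
    then have "f ?y \<le> f p" by simp
    then have "v \<bullet> p' \<le> v \<bullet> ?y" by (rule p'(2))
    then have "e / (2 * norm v) * (v \<bullet> v) \<le> 0" by (simp add: inner_diff_right)
    moreover have "e / (2 * norm v) * (v \<bullet> v) > 0" using e v0 by (intro mult_pos_pos) auto
    ultimately show False by simp
  qed
  have g0: "g p' \<noteq> 0"
  proof
    assume "g p' = 0"
    then have "p' = w" using critical_unique[OF _ w] by auto
    then show False using fp' critical_less[OF w p] by simp
  qed
  have desc: "v \<bullet> d \<ge> 0" if d: "g p' \<bullet> d < 0" for d
  proof -
    obtain t where t: "t > 0" "f (p' + t *\<^sub>R d) < f p'" using descends[OF d] .
    then have "v \<bullet> p' \<le> v \<bullet> (p' + t *\<^sub>R d)" using p'(2) fp' by simp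
    then show ?thesis using t(1) by (simp add: inner_add_right zero_le_mult_iff)
  qed
  define G where "G = g p' \<bullet> g p'"
  have G: "G > 0" using g0 by (simp add: G_def)
  \<comment> \<open>v is split into a multiple of \<open>g p'\<close> and an orthogonal rest u.
    Tilting - u by - \<epsilon> times \<open>g p'\<close> makes it a descent direction; letting
    \<epsilon> tend to 0 forces u = 0.\<close>
  define a where "a = (v \<bullet> g p') / G"
  define u where "u = v - a *\<^sub>R g p'"
  have ug: "u \<bullet> g p' = 0" using G by (simp add: u_def a_def inner_diff_left G_def)
  have vu: "v \<bullet> u = u \<bullet> u" using ug by (simp add: u_def inner_diff_left inner_diff_right inner_commute algebra_simps)
  have "u \<bullet> u \<le> \<epsilon> * (- a * G)" if "\<epsilon> > 0" for \<epsilon>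
  proof -
    have "g p' \<bullet> (- \<epsilon> *\<^sub>R g p' - u) < 0"
      using that G ug by (simp add: inner_diff_right inner_commute G_def)
    from desc[OF this] have "0 \<le> - \<epsilon> * (v \<bullet> g p') - v \<bullet> u" by (simp add: inner_diff_right)
    then show ?thesis using vu G by (simp add: a_def)
  qed
  note small = this
  have "u \<bullet> u \<le> 0"
  proof (rule field_le_epsilon)
    fix e :: real assume e: "e > 0"
    have "u \<bullet> u \<le> e / (\<bar>a * G\<bar> + 1) * (- a * G)" using e by (intro small) auto
    also have "\<dots> \<le> e / (\<bar>a * G\<bar> + 1) * (\<bar>a * G\<bar> + 1)" using e by (intro mult_left_mono) auto
    also have "\<dots> = e" by (simp add: add_nonneg_eq_0_iff)
    finally show "u \<bullet> u \<le> 0 + e" by simp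
  qed
  then have "u = 0" by (metis inner_eq_zero_iff inner_ge_zero order_antisym)
  then have va: "v = a *\<^sub>R g p'" by (simp add: u_def)
  \<comment> \<open>Steepest descent fixes the sign of a, hence that of the multiplier - 1 /
    a.\<close>
  have "0 \<le> v \<bullet> (- g p')" using G by (intro desc) (simp add: G_def)
  then have "a * G \<le> 0" by (simp add: va G_def)
  then have "a < 0" using G va v0 by (cases "a = 0") (auto simp: mult_le_0_iff)
  show thesis
  proof (rule that)
    show "- 1 / a > 0" using \<open>a < 0\<close> by simp
    show "g p' = - (- 1 / a) *\<^sub>R g p" using \<open>a < 0\<close> va by (simp add: v_def)
  qed (rule fp')
qed

text \<open>For distinct points on one level, the strict tangent inequalities at both give
  \<open>g p\<close> and \<open>g p'\<close> opposite signs on p' - p. In contrapositive form this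
  also shows that a factor without prescribed sign is negative.\<close>

lemma same_level_same_direction:
  assumes "g p' = s *\<^sub>R g p" "s \<ge> 0" "f p' = f p"
  shows "p' = p"
proof (rule ccontr)
  assume ne: "p' \<noteq> p"
  have "g p \<bullet> (p' - p) < 0" using above_tangent[of p p'] ne assms(3) by auto
  moreover have "g p' \<bullet> (p - p') < 0" using above_tangent[of p' p] ne assms(3) by auto
  then have "s * (g p \<bullet> (p' - p)) > 0" by (simp add: assms(1) inner_diff_right algebra_simps)
  ultimately show False using assms(2) by (simp add: zero_less_mult_iff)
qed

text \<open>The gradients at two opposite points of p are positive multiples of each other, so
  \<open>same_level_same_direction\<close> identifies the points.\<close>

lemma opposite_unique:
  assumes "g p \<noteq> 0" "s > 0" "g p' = - s *\<^sub>R g p" "f p' = f p"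
    "s' > 0" "g p'' = - s' *\<^sub>R g p" "f p'' = f p"
  shows "p' = p'' \<and> s = s'"
proof -
  have "g p'' = (s' / s) *\<^sub>R g p'" using assms(2,3,6) by simp
  then have "p'' = p'" using assms by (intro same_level_same_direction[of p'' "s' / s"]) auto
  then show ?thesis using assms by auto
qed

end

text \<open>Along the segment the slope of f strictly increases, and the mean value theorem turns f
  y - f x into the slope at an interior point, which exceeds the one at x.\<close>

lemma strictly_convex_functionI:
  fixes f :: "'e::euclidean_space \<Rightarrow> real"
  assumes f: "\<And>x. (f has_derivative (\<lambda>v. g x \<bullet> v)) (at x)"
    and g: "\<And>x. (g has_derivative g' x) (at x)"
    and pos: "\<And>x v. v \<noteq> 0 \<Longrightarrow> 0 < g' x v \<bullet> v"
  shows "strictly_convex_function f g"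
proof
  show "(f has_derivative (\<lambda>v. g x \<bullet> v)) (at x)" for x by (rule f)
  fix x y :: 'e assume "x \<noteq> y"
  define v where "v = y - x"
  have v: "v \<noteq> 0" using \<open>x \<noteq> y\<close> by (simp add: v_def)
  define l where "l t = x + t *\<^sub>R v" for t
  have l: "(l has_derivative (\<lambda>t. t *\<^sub>R v)) (at t)" for t
    unfolding l_def by (auto intro!: derivative_eq_intros)
  have 1: "DERIV (\<lambda>t. f (l t)) t :> g (l t) \<bullet> v" for t
    unfolding has_field_derivative_def
    using has_derivative_compose[OF l f, of t] by (simp add: mult_commute_abs)
  have 2: "DERIV (\<lambda>t. g (l t) \<bullet> v) t :> g' (l t) v \<bullet> v" for t
  proof -
    have "linear (g' (l t))" using g has_derivative_linear by blast
    then have "g' (l t) (h *\<^sub>R v) \<bullet> v = (g' (l t) v \<bullet> v) * h" for h by (simp add: linear_cmul)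
    then show ?thesis
      unfolding has_field_derivative_def
      using has_derivative_inner_left[OF has_derivative_compose[OF l g], of v t] by (simp add: mult_commute_abs)
  qed
  obtain \<xi> where \<xi>: "0 < \<xi>" "\<xi> < 1" "f (l 1) - f (l 0) = (1 - 0) * (g (l \<xi>) \<bullet> v)"
    using MVT2[of 0 1 "\<lambda>t. f (l t)" "\<lambda>t. g (l t) \<bullet> v"] 1 by auto
  have "g (l 0) \<bullet> v < g (l \<xi>) \<bullet> v"
    using DERIV_pos_imp_increasing[OF \<xi>(1), of "\<lambda>t. g (l t) \<bullet> v"] 2 pos[OF v] by blast
  then show "f x + g x \<bullet> (y - x) < f y" using \<xi>(3) by (simp add: l_def v_def)
qed

section \<open>Families of strictly convex functions\<close>

lemma has_derivative_partial_snd: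
  assumes "(f has_derivative f') (at (x, y))"
  shows "((\<lambda>y. f (x, y)) has_derivative (\<lambda>v. f' (0, v))) (at y)"
proof -
  have "((\<lambda>y. (x, y)) has_derivative (\<lambda>v. (0, v))) (at y)"
    by (intro has_derivative_Pair has_derivative_ident has_derivative_const)
  from has_derivative_compose[OF this assms] show ?thesis .
qed

text \<open>The inner product turns the vertical derivative into a vector, so that proportionality
  becomes a vector equation to which the implicit function theorem applies.\<close>

definition fiber_grad :: "('a::euclidean_space \<times> 'e::euclidean_space \<Rightarrow> real) \<Rightarrow> 'a \<times> 'e \<Rightarrow> 'e" where
  "fiber_grad K x = (\<Sum>b\<in>Basis. frechet_derivative K (at x) (0, b) *\<^sub>R b)"

text \<open>The coordinate form of \<open>breve\<close>, with critical points in place of minima;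
  convexity makes them the same.\<close>

definition bottomed :: "'a::euclidean_space set \<Rightarrow> ('a \<times> 'e::euclidean_space \<Rightarrow> real) \<Rightarrow> 'a set" where
  "bottomed P K = {q \<in> P. \<exists>w. fiber_grad K (q, w) = 0}"

definition bottom :: "('a::euclidean_space \<times> 'e::euclidean_space \<Rightarrow> real) \<Rightarrow> 'a \<Rightarrow> 'e" where
  "bottom K q = (THE w. fiber_grad K (q, w) = 0)"

text \<open>Point and factor form one unknown, of the same dimension as the pair of equations. The
  positivity of the factor selects the opposite point, where \<open>level_involution\<close> asks
  for a point other than the given one.\<close>

definition opposite :: "('a::euclidean_space \<times> 'e::euclidean_space \<Rightarrow> real) \<Rightarrow> 'a \<times> 'e \<Rightarrow> 'e \<times> real" where
  "opposite K x = (THE z. snd z > 0 \<and> fiber_grad K (fst x, fst z) = - snd z *\<^sub>R fiber_grad K x \<and>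
     K (fst x, fst z) = K x)"

definition off_bottom :: "'a::euclidean_space set \<Rightarrow> ('a \<times> 'e::euclidean_space \<Rightarrow> real) \<Rightarrow> ('a \<times> 'e) set" where
  "off_bottom P K = {x. fst x \<in> bottomed P K \<and> snd x \<noteq> bottom K (fst x)}"

locale fiber_smooth =
  fixes P :: "'a::euclidean_space set" and K :: "'a \<times> 'e::euclidean_space \<Rightarrow> real"
  assumes open_P: "open P"
    and smooth: "Ck_on k K (P \<times> UNIV)"
begin

lemma open_PU: "open (P \<times> (UNIV :: 'b::topological_space set))"
  using open_P by (intro open_Times) auto

lemma smooth_grad: "Ck_on k (fiber_grad K) (P \<times> UNIV)"
  unfolding fiber_grad_def
  by (intro Ck_on_sum Ck_on_scaleR Ck_on_const Ck_on_frechet_derivative[OF smooth] open_PU)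

lemma has_derivative_K: "q \<in> P \<Longrightarrow> (K has_derivative frechet_derivative K (at (q, p))) (at (q, p))"
  using Ck_on_has_derivative[OF smooth[of "Suc 0"]] by auto

lemma has_derivative_grad:
  "q \<in> P \<Longrightarrow> (fiber_grad K has_derivative frechet_derivative (fiber_grad K) (at (q, p))) (at (q, p))"
  using Ck_on_has_derivative[OF smooth_grad[of "Suc 0"]] by auto

lemma fiber_grad_inner:
  assumes "q \<in> P"
  shows "frechet_derivative K (at (q, p)) (0, v) = fiber_grad K (q, p) \<bullet> v"
proof -
  have "linear (\<lambda>v. frechet_derivative K (at (q, p)) (0, v))"
    using has_derivative_linear[OF has_derivative_partial_snd[OF has_derivative_K[OF assms, of p]]] .
  from linear_eq_sum_Basis[OF this, of v] show ?thesis
    by (simp add: fiber_grad_def inner_sum_left inner_commute[of v] mult.commute)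
qed

lemma K_fiber_derivative:
  "q \<in> P \<Longrightarrow> ((\<lambda>p. K (q, p)) has_derivative (\<lambda>v. fiber_grad K (q, p) \<bullet> v)) (at p)"
  using has_derivative_partial_snd[OF has_derivative_K] by (simp add: fiber_grad_inner)

end

locale fiber_convex = fiber_smooth P K
  for P :: "'a::euclidean_space set" and K :: "'a \<times> 'e::euclidean_space \<Rightarrow> real" +
  assumes hessian_pos: "q \<in> P \<Longrightarrow> v \<noteq> 0 \<Longrightarrow> 0 < frechet_derivative (fiber_grad K) (at (q, p)) (0, v) \<bullet> v"
begin

lemma fiber: "q \<in> P \<Longrightarrow> strictly_convex_function (\<lambda>p. K (q, p)) (\<lambda>p. fiber_grad K (q, p))"
  by (rule strictly_convex_functionI[OF K_fiber_derivative has_derivative_partial_snd[OF has_derivative_grad]])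
    (auto intro: hessian_pos)

lemma bottomed_subset: "q \<in> bottomed P K \<Longrightarrow> q \<in> P"
  by (simp add: bottomed_def)

lemma bottom_eqI:
  assumes "q \<in> P" "fiber_grad K (q, w) = 0"
  shows "bottom K q = w"
  unfolding bottom_def
  using assms strictly_convex_function.critical_unique[OF fiber[OF assms(1)]] by blast

lemma grad_bottom: "q \<in> bottomed P K \<Longrightarrow> fiber_grad K (q, bottom K q) = 0"
  using bottom_eqI by (auto simp: bottomed_def)

lemma grad_eq_0_iff: "q \<in> bottomed P K \<Longrightarrow> fiber_grad K (q, p) = 0 \<longleftrightarrow> p = bottom K q"
  using grad_bottom bottom_eqI bottomed_subset by metis

lemma opposite_eqI:
  assumes "q \<in> bottomed P K" "p \<noteq> bottom K q" "s > 0"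
    "fiber_grad K (q, p') = - s *\<^sub>R fiber_grad K (q, p)" "K (q, p') = K (q, p)"
  shows "opposite K (q, p) = (p', s)"
  unfolding opposite_def
proof (rule the_equality)
  interpret F: strictly_convex_function "\<lambda>p. K (q, p)" "\<lambda>p. fiber_grad K (q, p)"
    using fiber assms(1) bottomed_subset by blast
  have ne: "fiber_grad K (q, p) \<noteq> 0" using grad_eq_0_iff assms by blast
  show "z = (p', s)" if "0 < snd z \<and> fiber_grad K (fst (q, p), fst z) = - snd z *\<^sub>R fiber_grad K (q, p) \<and>
    K (fst (q, p), fst z) = K (q, p)" for z
    using F.opposite_unique[OF ne, of s p' "snd z" "fst z"] assms that by (auto simp: prod_eq_iff)
qed (use assms in auto)

lemma opposite:
  assumes "q \<in> bottomed P K" "p \<noteq> bottom K q"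
  shows "snd (opposite K (q, p)) > 0"
    "fiber_grad K (q, fst (opposite K (q, p))) = - snd (opposite K (q, p)) *\<^sub>R fiber_grad K (q, p)"
    "K (q, fst (opposite K (q, p))) = K (q, p)"
proof -
  interpret F: strictly_convex_function "\<lambda>p. K (q, p)" "\<lambda>p. fiber_grad K (q, p)"
    using fiber assms(1) bottomed_subset by blast
  obtain p' s where "s > 0" "fiber_grad K (q, p') = - s *\<^sub>R fiber_grad K (q, p)" "K (q, p') = K (q, p)"
    using F.opposite_exists[OF grad_bottom[OF assms(1)] assms(2)] .
  moreover from this have "opposite K (q, p) = (p', s)" using assms by (intro opposite_eqI)
  ultimately show "snd (opposite K (q, p)) > 0"
    "fiber_grad K (q, fst (opposite K (q, p))) = - snd (opposite K (q, p)) *\<^sub>R fiber_grad K (q, p)"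
    "K (q, fst (opposite K (q, p))) = K (q, p)" by auto
qed

lemma opposite_ne_bottom:
  assumes "q \<in> bottomed P K" "p \<noteq> bottom K q"
  shows "fst (opposite K (q, p)) \<noteq> bottom K q"
  using opposite[OF assms] grad_eq_0_iff[OF assms(1)] assms(2)
  by (metis less_irrefl neg_equal_0_iff_equal scaleR_eq_0_iff)

lemma opposite_opposite:
  assumes "q \<in> bottomed P K" "p \<noteq> bottom K q"
  shows "fst (opposite K (q, fst (opposite K (q, p)))) = p"
proof -
  have "opposite K (q, fst (opposite K (q, p))) = (p, 1 / snd (opposite K (q, p)))"
    using opposite[OF assms] opposite_ne_bottom[OF assms] assms by (intro opposite_eqI) auto
  then show ?thesis by simp
qed

text \<open>The Hessian is injective, so the implicit function theorem solves for the critical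
  point. U and the solution may depend on k, but uniqueness of critical points always makes the
  solution \<open>bottom K\<close>, which gives every order on the whole of
  \<open>bottomed P K\<close>.\<close>

lemma bottom_local:
  assumes "q0 \<in> bottomed P K"
  obtains U where "open U" "q0 \<in> U" "U \<subseteq> bottomed P K" "Ck_on (Suc k) (bottom K) U"
proof -
  have q0: "q0 \<in> P" using assms by (rule bottomed_subset)
  have inj: "v = 0" if "frechet_derivative (fiber_grad K) (at (q0, bottom K q0)) (0, v) = 0" for v
    using hessian_pos[OF q0, of v "bottom K q0"] that by (cases "v = 0") auto
  have "(q0, bottom K q0) \<in> P \<times> UNIV" using q0 by simp
  from implicit_function_Ck[OF open_PU this smooth_grad[of "Suc k"] grad_bottom[OF assms] inj]
  obtain U g where U: "open U" "q0 \<in> U" "g q0 = bottom K q0"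
    "\<And>q. q \<in> U \<Longrightarrow> (q, g q) \<in> P \<times> UNIV \<and> fiber_grad K (q, g q) = 0" "Ck_on (Suc k) g U" by blast
  show thesis
  proof
    show "U \<subseteq> bottomed P K" using U(4) by (auto simp: bottomed_def)
    show "Ck_on (Suc k) (bottom K) U"
    proof (rule Ck_on_cong[OF U(1) _ U(5)])
      show "g q = bottom K q" if "q \<in> U" for q
        using bottom_eqI[of q "g q"] U(4)[OF that] by simp
    qed
  qed (use U in auto)
qed

lemma open_bottomed: "open (bottomed P K)"
  by (subst open_subopen) (metis bottom_local)

lemma smooth_bottom: "Ck_on k (bottom K) (bottomed P K)"
  by (rule Ck_on_local) (metis bottom_local Ck_on_Suc_imp)

lemma open_off_bottom: "open (off_bottom P K)"
proof -
  have "continuous_on (bottomed P K) (bottom K)" using smooth_bottom Ck_on_imp_continuous_on by blast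
  then have "continuous_on (bottomed P K \<times> UNIV) (\<lambda>x. snd x - bottom K (fst x))"
    by (intro continuous_intros continuous_on_compose2[of "bottomed P K" "bottom K" _ fst]) auto
  from continuous_open_preimage[OF this _ open_Compl[OF closed_singleton], of 0]
  have "open ((bottomed P K \<times> UNIV) \<inter> (\<lambda>x. snd x - bottom K (fst x)) -` (- {0}))"
    using open_bottomed by (auto intro: open_Times)
  also have "(bottomed P K \<times> UNIV) \<inter> (\<lambda>x. snd x - bottom K (fst x)) -` (- {0}) = off_bottom P K"
    by (auto simp: off_bottom_def)
  finally show ?thesis .
qed

text \<open>For a kernel vector (\<delta>, \<sigma>) of the derivative in the unknowns, the Hessian
  maps \<delta> to a multiple of the gradient g at the given point, and \<delta> is orthogonal to g.
  Positivity gives \<delta> = 0, and then \<sigma> = 0 because g is nonzero off the bottom.\<close>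

lemma opposite_local:
  assumes "x0 \<in> off_bottom P K"
  obtains U where "open U" "x0 \<in> U" "Ck_on (Suc k) (opposite K) U"
proof -
  obtain q0 p0 where x0: "x0 = (q0, p0)" by (cases x0)
  have q0: "q0 \<in> bottomed P K" "p0 \<noteq> bottom K q0" "q0 \<in> P"
    using assms bottomed_subset by (auto simp: off_bottom_def x0)
  define z0 where "z0 = opposite K x0"
  obtain p1 s0 where z0: "z0 = (p1, s0)" by (cases z0)
  have z0_props: "s0 > 0" "fiber_grad K (q0, p1) = - s0 *\<^sub>R fiber_grad K (q0, p0)" "K (q0, p1) = K (q0, p0)"
    using opposite[OF q0(1,2)] z0 by (simp_all add: z0_def x0)
  define G where "G y = (fiber_grad K (fst (fst y), fst (snd y)) + snd (snd y) *\<^sub>R fiber_grad K (fst y),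
    K (fst (fst y), fst (snd y)) - K (fst y))" for y :: "('a \<times> 'e) \<times> ('e \<times> real)"
  \<comment> \<open>With the factor kept positive, every solution over \<open>off_bottom P K\<close>
    is the opposite point, by uniqueness.\<close>
  define S :: "(('a \<times> 'e) \<times> ('e \<times> real)) set" where "S = (P \<times> UNIV) \<times> (UNIV \<times> {0<..})"
  have S: "open S" unfolding S_def by (intro open_Times open_P) auto
  have pick: "Ck_on j (\<lambda>y. h (fst (fst y), fst (snd y))) S" "Ck_on j (\<lambda>y. h (fst y)) S"
    if "Ck_on j h (P \<times> UNIV)" for j and h :: "'a \<times> 'e \<Rightarrow> 'f::euclidean_space"
    by (rule Ck_on_compose[OF S open_PU _ that];
        (auto simp: S_def intro!: Ck_on_Pair Ck_on_fst Ck_on_snd Ck_on_ident S[unfolded S_def])?)+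
  have CG: "Ck_on (Suc k) G S"
    unfolding G_def
    by (intro Ck_on_Pair Ck_on_add Ck_on_diff Ck_on_scaleR pick smooth smooth_grad Ck_on_snd Ck_on_ident S)
  have x0S: "(x0, z0) \<in> S" using q0 z0_props by (simp add: S_def x0 z0)
  have G0: "G (x0, z0) = 0" using z0_props by (simp add: G_def x0 z0 prod_eq_iff)
  have inj: "v = 0" if "frechet_derivative G (at (x0, z0)) (0, v) = 0" for v
  proof -
    obtain \<delta> \<sigma> where v: "v = (\<delta>, \<sigma>)" by (cases v)
    let ?g = "fiber_grad K (q0, p0)"
    let ?D = "\<lambda>\<delta>. frechet_derivative (fiber_grad K) (at (q0, p1)) (0, \<delta>)"
    have 1: "((\<lambda>z. G (x0, z)) has_derivative (\<lambda>v. frechet_derivative G (at (x0, z0)) (0, v))) (at z0)"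
      by (rule has_derivative_partial_snd[OF Ck_on_has_derivative[OF CG x0S]])
    have f: "(fst has_derivative fst) (at z0)" "(snd has_derivative snd) (at z0)"
      by (auto intro!: bounded_linear_imp_has_derivative bounded_linear_fst bounded_linear_snd)
    have "((\<lambda>z. fiber_grad K (q0, fst z)) has_derivative (\<lambda>v. ?D (fst v))) (at z0)"
      by (rule has_derivative_compose[OF f(1)])
        (use has_derivative_partial_snd[OF has_derivative_grad[OF q0(3)]] in \<open>simp add: z0\<close>)
    moreover have "((\<lambda>z. K (q0, fst z)) has_derivative (\<lambda>v. fiber_grad K (q0, p1) \<bullet> fst v)) (at z0)"
      by (rule has_derivative_compose[OF f(1)]) (use K_fiber_derivative[OF q0(3)] in \<open>simp add: z0\<close>)
    ultimately have "((\<lambda>z. (fiber_grad K (q0, fst z) + snd z *\<^sub>R ?g, K (q0, fst z) - K (q0, p0))) has_derivative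
      (\<lambda>v. (?D (fst v) + snd v *\<^sub>R ?g, fiber_grad K (q0, p1) \<bullet> fst v - 0))) (at z0)"
      by (intro has_derivative_Pair has_derivative_add has_derivative_diff has_derivative_const
          has_derivative_scaleR_left f)
    then have 2: "((\<lambda>z. G (x0, z)) has_derivative
      (\<lambda>v. (?D (fst v) + snd v *\<^sub>R ?g, fiber_grad K (q0, p1) \<bullet> fst v))) (at z0)"
      by (simp add: G_def x0)
    have "(?D \<delta> + \<sigma> *\<^sub>R ?g, fiber_grad K (q0, p1) \<bullet> \<delta>) = 0"
      using fun_cong[OF has_derivative_unique[OF 1 2], of v] that by (simp add: v)
    \<comment> \<open>The second component says that \<delta> is orthogonal to the gradient at p1,
      which is - s0 times the one at p0, with s0 > 0.\<close>
    then have D: "?D \<delta> = - \<sigma> *\<^sub>R ?g" and "?g \<bullet> \<delta> = 0"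
      using z0_props by (auto simp: prod_eq_iff eq_neg_iff_add_eq_0)
    then have "?D \<delta> \<bullet> \<delta> = 0" by simp
    then have "\<delta> = 0" using hessian_pos[OF q0(3), of \<delta> p1] by force
    moreover have "?D 0 = 0"
      using has_derivative_linear[OF has_derivative_partial_snd[OF has_derivative_grad[OF q0(3)]], of p1]
        linear_0 by blast
    ultimately have "\<sigma> *\<^sub>R ?g = 0" using D by simp
    then show ?thesis using \<open>\<delta> = 0\<close> grad_eq_0_iff[OF q0(1)] q0(2) by (simp add: v zero_prod_def)
  qed
  from implicit_function_Ck[OF S x0S CG G0 inj]
  obtain U g where U: "open U" "x0 \<in> U" "g x0 = z0" "\<And>x. x \<in> U \<Longrightarrow> (x, g x) \<in> S \<and> G (x, g x) = 0"
    "Ck_on (Suc k) g U" by blast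
  have eq: "opposite K x = g x" if x: "x \<in> U \<inter> off_bottom P K" for x
  proof -
    obtain q p where qp: "x = (q, p)" by (cases x)
    obtain p' s where g: "g x = (p', s)" by (cases "g x")
    have "opposite K (q, p) = (p', s)"
    proof (rule opposite_eqI)
      show "q \<in> bottomed P K" "p \<noteq> bottom K q" using x by (auto simp: off_bottom_def qp)
      show "s > 0" "fiber_grad K (q, p') = - s *\<^sub>R fiber_grad K (q, p)" "K (q, p') = K (q, p)"
        using U(4)[of x] x g by (auto simp: S_def G_def qp prod_eq_iff eq_neg_iff_add_eq_0)
    qed
    then show ?thesis using g by (simp add: qp)
  qed
  show thesis
  proof
    show "open (U \<inter> off_bottom P K)" using U(1) open_off_bottom by blast
    show "x0 \<in> U \<inter> off_bottom P K" using U(2) assms by simp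
    show "Ck_on (Suc k) (opposite K) (U \<inter> off_bottom P K)"
      by (rule Ck_on_cong[OF _ eq[symmetric] Ck_on_subset[OF U(5)]]) (use U(1) open_off_bottom in auto)
  qed
qed

lemma smooth_opposite: "Ck_on k (opposite K) (off_bottom P K)"
  by (rule Ck_on_local) (metis opposite_local Ck_on_Suc_imp)

end

section \<open>Blow-up of the minimum\<close>

locale fiber_convex_centered = fiber_convex P K
  for P :: "'a::euclidean_space set" and K :: "'a \<times> 'e::euclidean_space \<Rightarrow> real" +
  assumes grad_0: "q \<in> P \<Longrightarrow> fiber_grad K (q, 0) = 0"
begin

lemma bottomed_eq: "bottomed P K = P"
  using grad_0 by (auto simp: bottomed_def)

lemma bottom_eq_0: "q \<in> P \<Longrightarrow> bottom K q = 0"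
  using bottom_eqI grad_0 by blast

lemma off_bottom_eq: "off_bottom P K = P \<times> (- {0})"
  by (auto simp: off_bottom_def bottomed_eq bottom_eq_0)

definition hessian :: "'a \<Rightarrow> 'e \<Rightarrow> 'e \<Rightarrow> 'e" where
  "hessian q p v = frechet_derivative (fiber_grad K) (at (q, p)) (0, v)"

lemma fiber_grad_has_derivative:
  "q \<in> P \<Longrightarrow> ((\<lambda>p. fiber_grad K (q, p)) has_derivative hessian q p) (at p)"
  using has_derivative_partial_snd[OF has_derivative_grad] by (simp add: hessian_def[abs_def])

lemma linear_hessian: "q \<in> P \<Longrightarrow> linear (hessian q p)"
  using fiber_grad_has_derivative has_derivative_linear by blast

text \<open>Hadamard's form of \<open>fiber_grad K (q, r *\<^sub>R \<theta>)\<close> divided by r: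
  the integral has no denominator, hence is smooth through r = 0, where it is
  \<open>hessian q 0 \<theta>\<close>.\<close>

definition blowup_grad :: "('a \<times> real) \<times> 'e \<Rightarrow> 'e" where
  "blowup_grad x = integral {0..1} (\<lambda>t. hessian (fst (fst x)) ((t * snd (fst x)) *\<^sub>R snd x) (snd x))"

text \<open>The blow-up \<open>(K (q, r *\<^sub>R \<theta>) - K (q, 0)) / r\<^sup>2\<close>, in an integral form that also makes sense for \<open>r = 0\<close>.\<close>

definition blowup :: "('a \<times> real) \<times> 'e \<Rightarrow> real" where
  "blowup x = integral {0..1} (\<lambda>t. t * (blowup_grad ((fst (fst x), t * snd (fst x)), snd x) \<bullet> snd x))"

lemma smooth_blowup_grad: "Ck_on k blowup_grad ((P \<times> UNIV) \<times> UNIV)"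
  unfolding blowup_grad_def hessian_def
proof (rule Ck_on_integral[where f = "\<lambda>y. frechet_derivative (fiber_grad K)
    (at (fst (fst (fst y)), (snd y * snd (fst (fst y))) *\<^sub>R snd (fst y))) (0, snd (fst y))", simplified])
  let ?S = "((P \<times> UNIV) \<times> UNIV) \<times> UNIV :: ((('a \<times> real) \<times> 'e) \<times> real) set"
  have S: "open ?S" by (intro open_Times open_P open_UNIV)
  show "open ((P \<times> UNIV) \<times> UNIV)" by (intro open_Times open_P open_UNIV)
  let ?\<phi> = "\<lambda>y. (fst (fst (fst y)), (snd y * snd (fst (fst y))) *\<^sub>R snd (fst y))"
  show "Ck_on k (\<lambda>y. frechet_derivative (fiber_grad K) (at (?\<phi> y)) (0, snd (fst y))) ?S"
  proof (rule Ck_on_linear_apply[OF S, where L = "\<lambda>y. frechet_derivative (fiber_grad K) (at (?\<phi> y))"])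
    show "linear (frechet_derivative (fiber_grad K) (at (?\<phi> y)))" if "y \<in> ?S" for y
      using that by (auto intro!: has_derivative_linear[OF has_derivative_grad])
    show "Ck_on k (\<lambda>y. frechet_derivative (fiber_grad K) (at (?\<phi> y)) b) ?S" for b
      by (rule Ck_on_compose[OF S open_PU _ Ck_on_frechet_derivative[OF smooth_grad]])
        (auto intro!: Ck_on_Pair Ck_on_scaleR Ck_on_mult Ck_on_fst Ck_on_snd Ck_on_ident S)
    show "Ck_on k (\<lambda>y. (0, snd (fst y))) ?S"
      by (intro Ck_on_Pair Ck_on_const Ck_on_fst Ck_on_snd Ck_on_ident S)
  qed
qed

lemma smooth_blowup: "Ck_on k blowup ((P \<times> UNIV) \<times> UNIV)"
  unfolding blowup_def
proof (rule Ck_on_integral[where f = "\<lambda>y. snd y *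
    (blowup_grad ((fst (fst (fst y)), snd y * snd (fst (fst y))), snd (fst y)) \<bullet> snd (fst y))", simplified])
  let ?S = "((P \<times> UNIV) \<times> UNIV) \<times> UNIV :: ((('a \<times> real) \<times> 'e) \<times> real) set"
  have S: "open ?S" by (intro open_Times open_P open_UNIV)
  show T: "open ((P \<times> UNIV) \<times> UNIV)" by (intro open_Times open_P open_UNIV)
  have "Ck_on k (\<lambda>y. blowup_grad ((fst (fst (fst y)), snd y * snd (fst (fst y))), snd (fst y))) ?S"
    by (rule Ck_on_compose[OF S T _ smooth_blowup_grad])
      (auto intro!: Ck_on_Pair Ck_on_mult Ck_on_fst Ck_on_snd Ck_on_ident S)
  then show "Ck_on k (\<lambda>y. snd y *
    (blowup_grad ((fst (fst (fst y)), snd y * snd (fst (fst y))), snd (fst y)) \<bullet> snd (fst y))) ?S"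
    by (intro Ck_on_mult Ck_on_inner Ck_on_fst Ck_on_snd Ck_on_ident S)
qed

text \<open>The fundamental theorem of calculus along the ray; the lower endpoint contributes
  nothing because the gradient vanishes at 0. Multiplying by r instead of dividing includes r =
  0.\<close>

lemma scaled_blowup_grad:
  assumes q: "q \<in> P"
  shows "r *\<^sub>R blowup_grad ((q, r), \<theta>) = fiber_grad K (q, r *\<^sub>R \<theta>)"
proof -
  have "((\<lambda>t. r *\<^sub>R hessian q ((t * r) *\<^sub>R \<theta>) \<theta>) has_integral
      (fiber_grad K (q, (1 * r) *\<^sub>R \<theta>) - fiber_grad K (q, (0 * r) *\<^sub>R \<theta>))) {0..1}"
  proof (rule fundamental_theorem_of_calculus)
    fix t :: real
    have "((\<lambda>t. (t * r) *\<^sub>R \<theta>) has_derivative (\<lambda>h. (h * r) *\<^sub>R \<theta>)) (at t)"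
      by (auto intro!: derivative_eq_intros)
    from has_derivative_compose[OF this fiber_grad_has_derivative[OF q]]
    have "((\<lambda>t. fiber_grad K (q, (t * r) *\<^sub>R \<theta>)) has_derivative
      (\<lambda>h. h *\<^sub>R r *\<^sub>R hessian q ((t * r) *\<^sub>R \<theta>) \<theta>)) (at t)"
      using linear_hessian[OF q] by (simp add: linear_cmul)
    then show "((\<lambda>t. fiber_grad K (q, (t * r) *\<^sub>R \<theta>)) has_vector_derivative
      r *\<^sub>R hessian q ((t * r) *\<^sub>R \<theta>) \<theta>) (at t within {0..1})"
      unfolding has_vector_derivative_def by (rule has_derivative_at_withinI)
  qed simp
  from integral_unique[OF this] show ?thesis using grad_0[OF q] by (simp add: blowup_grad_def)
qed

lemma scaled_blowup:
  assumes q: "q \<in> P"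
  shows "r\<^sup>2 * blowup ((q, r), \<theta>) = K (q, r *\<^sub>R \<theta>) - K (q, 0)"
proof -
  have "((\<lambda>t. r\<^sup>2 * (t * (blowup_grad ((q, t * r), \<theta>) \<bullet> \<theta>))) has_integral
      (K (q, (1 * r) *\<^sub>R \<theta>) - K (q, (0 * r) *\<^sub>R \<theta>))) {0..1}"
  proof (rule fundamental_theorem_of_calculus)
    fix t :: real
    have "((\<lambda>t. (t * r) *\<^sub>R \<theta>) has_derivative (\<lambda>h. (h * r) *\<^sub>R \<theta>)) (at t)"
      by (auto intro!: derivative_eq_intros)
    from has_derivative_compose[OF this K_fiber_derivative[OF q]]
    have "((\<lambda>t. K (q, (t * r) *\<^sub>R \<theta>)) has_derivative
      (\<lambda>h. h * (r\<^sup>2 * (t * (blowup_grad ((q, t * r), \<theta>) \<bullet> \<theta>))))) (at t)"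
      by (simp add: scaled_blowup_grad[OF q, symmetric] power2_eq_square mult_ac)
    then show "((\<lambda>t. K (q, (t * r) *\<^sub>R \<theta>)) has_vector_derivative
      r\<^sup>2 * (t * (blowup_grad ((q, t * r), \<theta>) \<bullet> \<theta>))) (at t within {0..1})"
      unfolding has_vector_derivative_def by (auto intro: has_derivative_at_withinI)
  qed simp
  from integral_unique[OF this] show ?thesis by (simp add: blowup_def)
qed

lemma blowup_grad_0: "blowup_grad ((q, 0), \<theta>) = hessian q 0 \<theta>"
  by (simp add: blowup_grad_def)

lemma blowup_0: "blowup ((q, 0), \<theta>) = (hessian q 0 \<theta> \<bullet> \<theta>) / 2"
proof -
  have "((\<lambda>t::real. t * (hessian q 0 \<theta> \<bullet> \<theta>)) has_integral (1 / 2) * (hessian q 0 \<theta> \<bullet> \<theta>)) {0..1}"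
    using ident_has_integral[of 0 1] by (intro has_integral_mult_left) simp
  from integral_unique[OF this] show ?thesis by (simp add: blowup_def blowup_grad_0)
qed

text \<open>For r \<noteq> 0 this is \<open>scaled_blowup\<close> differentiated in \<theta> and
  divided by the square of r. At r = 0, where this division fails, continuity of both sides in r
  gives the identity.\<close>

lemma fiber_grad_blowup:
  assumes q: "q \<in> P"
  shows "fiber_grad blowup ((q, r), \<theta>) = blowup_grad ((q, r), \<theta>)"
proof -
  have S: "open ((P \<times> (UNIV :: real set)) \<times> (UNIV :: 'e set))"
    by (intro open_Times open_P open_UNIV)
  have *: "fiber_grad blowup ((q, r), \<theta>) = blowup_grad ((q, r), \<theta>)" if r: "r \<noteq> 0" for r
  proof -
    have "(blowup has_derivative frechet_derivative blowup (at ((q, r), \<theta>))) (at ((q, r), \<theta>))"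
      using Ck_on_has_derivative[OF smooth_blowup[of "Suc 0"]] q by auto
    from has_derivative_partial_snd[OF this]
    have 1: "((\<lambda>\<theta>. blowup ((q, r), \<theta>)) has_derivative
      (\<lambda>v. frechet_derivative blowup (at ((q, r), \<theta>)) (0, v))) (at \<theta>)" .
    have "((\<lambda>\<theta>. r *\<^sub>R \<theta>) has_derivative (\<lambda>v. r *\<^sub>R v)) (at \<theta>)"
      by (auto intro!: derivative_eq_intros)
    from has_derivative_diff[OF has_derivative_compose[OF this K_fiber_derivative[OF q]] has_derivative_const]
    have "((\<lambda>\<theta>. r\<^sup>2 * blowup ((q, r), \<theta>)) has_derivative
      (\<lambda>v. r\<^sup>2 * (blowup_grad ((q, r), \<theta>) \<bullet> v))) (at \<theta>)"
      unfolding scaled_blowup[OF q]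
      by (simp add: scaled_blowup_grad[OF q, symmetric] power2_eq_square mult_ac)
    from has_derivative_mult_right[OF this, of "1 / r\<^sup>2"]
    have 2: "((\<lambda>\<theta>. blowup ((q, r), \<theta>)) has_derivative (\<lambda>v. blowup_grad ((q, r), \<theta>) \<bullet> v)) (at \<theta>)"
      using r by simp
    have "frechet_derivative blowup (at ((q, r), \<theta>)) (0, v) = blowup_grad ((q, r), \<theta>) \<bullet> v" for v
      using fun_cong[OF has_derivative_unique[OF 1 2]] .
    then show ?thesis by (simp add: fiber_grad_def euclidean_representation)
  qed
  have "continuous_on UNIV (\<lambda>r. fiber_grad blowup ((q, r), \<theta>) - blowup_grad ((q, r), \<theta>))"
  proof -
    have "continuous_on ((P \<times> UNIV) \<times> UNIV) (fiber_grad blowup)"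
      unfolding fiber_grad_def
      by (rule Ck_on_imp_continuous_on)
        (intro Ck_on_sum Ck_on_scaleR Ck_on_const Ck_on_frechet_derivative[OF smooth_blowup] S)
    moreover have "continuous_on ((P \<times> UNIV) \<times> UNIV) blowup_grad"
      using smooth_blowup_grad by (rule Ck_on_imp_continuous_on)
    ultimately show ?thesis
      using q by (intro continuous_on_diff;
          auto elim!: continuous_on_compose2 intro!: continuous_intros)
  qed
  then have "((\<lambda>r. fiber_grad blowup ((q, r), \<theta>) - blowup_grad ((q, r), \<theta>)) \<longlongrightarrow>
      fiber_grad blowup ((q, 0), \<theta>) - blowup_grad ((q, 0), \<theta>)) (at 0)"
    by (simp add: continuous_on_def)
  moreover have "((\<lambda>r. fiber_grad blowup ((q, r), \<theta>) - blowup_grad ((q, r), \<theta>)) \<longlongrightarrow> 0) (at 0)"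
    by (rule tendsto_eventually) (auto simp: eventually_at_filter *)
  ultimately have "fiber_grad blowup ((q, 0), \<theta>) - blowup_grad ((q, 0), \<theta>) = 0"
    by (rule tendsto_unique[OF at_neq_bot])
  then show ?thesis using * by (cases "r = 0") auto
qed

text \<open>The Hessian of the blow-up is the Hessian of K at a rescaled point, so its positivity is
  inherited uniformly in form, r = 0 included.\<close>

lemma blowup_grad_has_derivative:
  assumes q: "q \<in> P"
  shows "((\<lambda>\<theta>. blowup_grad ((q, r), \<theta>)) has_derivative hessian q (r *\<^sub>R \<theta>)) (at \<theta>)"
proof (cases "r = 0")
  case True
  then show ?thesis
    using linear_hessian[OF q, of 0]
    by (simp add: blowup_grad_0 linear_conv_bounded_linear bounded_linear_imp_has_derivative)
next
  case False
  have "((\<lambda>\<theta>. r *\<^sub>R \<theta>) has_derivative (\<lambda>v. r *\<^sub>R v)) (at \<theta>)"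
    by (auto intro!: derivative_eq_intros)
  from has_derivative_scaleR_right[OF has_derivative_compose[OF this fiber_grad_has_derivative[OF q]], of "1 / r"]
  show ?thesis using False linear_hessian[OF q]
    by (simp add: scaled_blowup_grad[OF q, symmetric] linear_cmul)
qed

text \<open>The scale r joins q as a parameter, over all reals so that the parameter set is open.
  The smoothness already proved off the bottom now holds for \<open>opposite blowup\<close> across r
  = 0.\<close>

lemma fiber_convex_centered_blowup: "fiber_convex_centered (P \<times> UNIV) blowup"
proof
  show S: "open (P \<times> (UNIV :: real set))" by (intro open_Times open_P open_UNIV)
  show "Ck_on k blowup ((P \<times> UNIV) \<times> UNIV)" for k by (rule smooth_blowup)
  show "fiber_grad blowup (x, 0) = 0" if "x \<in> P \<times> UNIV" for x
    using that fiber_grad_blowup linear_0[OF linear_hessian] by (cases x) (auto simp: blowup_grad_def)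
  fix x :: "'a \<times> real" and v \<theta> :: 'e
  assume x: "x \<in> P \<times> UNIV" and v: "v \<noteq> 0"
  obtain q r where x_eq: "x = (q, r)" and q: "q \<in> P" using x by (cases x) auto
  have "Ck_on (Suc 0) (fiber_grad blowup) ((P \<times> UNIV) \<times> UNIV)"
    unfolding fiber_grad_def
    by (intro Ck_on_sum Ck_on_scaleR Ck_on_const Ck_on_frechet_derivative[OF smooth_blowup])
      (intro open_Times open_P open_UNIV)+
  from has_derivative_partial_snd[OF Ck_on_has_derivative[OF this, of "(x, \<theta>)"]] x
  have "((\<lambda>\<theta>. fiber_grad blowup (x, \<theta>)) has_derivative
    (\<lambda>v. frechet_derivative (fiber_grad blowup) (at (x, \<theta>)) (0, v))) (at \<theta>)" by simp
  moreover have "((\<lambda>\<theta>. fiber_grad blowup (x, \<theta>)) has_derivative hessian q (r *\<^sub>R \<theta>)) (at \<theta>)"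
    using blowup_grad_has_derivative[OF q] by (simp add: x_eq fiber_grad_blowup[OF q])
  ultimately have "frechet_derivative (fiber_grad blowup) (at (x, \<theta>)) (0, v) = hessian q (r *\<^sub>R \<theta>) v"
    using has_derivative_unique by metis
  then show "0 < frechet_derivative (fiber_grad blowup) (at (x, \<theta>)) (0, v) \<bullet> v"
    using hessian_pos[OF q v] by (simp add: hessian_def)
qed

text \<open>Both defining equations are homogeneous: the gradients scale by r, the level differences
  by its square. The scale r is not tied to p, a freedom used when this formula is
  differentiated.\<close>

lemma opposite_blowup:
  assumes q: "q \<in> P" and p: "p \<noteq> 0" and r: "r > 0"
  shows "opposite K (q, p) =
    (r *\<^sub>R fst (opposite blowup ((q, r), p /\<^sub>R r)), snd (opposite blowup ((q, r), p /\<^sub>R r)))"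
proof -
  interpret N: fiber_convex_centered "P \<times> UNIV" blowup by (rule fiber_convex_centered_blowup)
  obtain \<eta> s where \<eta>: "opposite blowup ((q, r), p /\<^sub>R r) = (\<eta>, s)" by fastforce
  have "(q, r) \<in> bottomed (P \<times> UNIV) blowup" "p /\<^sub>R r \<noteq> bottom blowup (q, r)"
    using q p r by (auto simp: N.bottomed_eq N.bottom_eq_0)
  from N.opposite[OF this]
  have N: "s > 0" "blowup_grad ((q, r), \<eta>) = - s *\<^sub>R blowup_grad ((q, r), p /\<^sub>R r)"
    "blowup ((q, r), \<eta>) = blowup ((q, r), p /\<^sub>R r)"
    by (simp_all add: \<eta> fiber_grad_blowup[OF q])
  have "opposite K (q, p) = (r *\<^sub>R \<eta>, s)"
  proof (rule opposite_eqI)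
    show "q \<in> bottomed P K" "p \<noteq> bottom K q" using q p by (auto simp: bottomed_eq bottom_eq_0)
    have rp: "r *\<^sub>R (p /\<^sub>R r) = p" using r by simp
    show "fiber_grad K (q, r *\<^sub>R \<eta>) = - s *\<^sub>R fiber_grad K (q, p)"
      using scaled_blowup_grad[OF q, of r \<eta>] scaled_blowup_grad[OF q, of r "p /\<^sub>R r"] N(2)
      unfolding rp by (metis scaleR_left_commute)
    show "K (q, r *\<^sub>R \<eta>) = K (q, p)"
      using scaled_blowup[OF q, of r \<eta>] scaled_blowup[OF q, of r "p /\<^sub>R r"] N(3)
      unfolding rp by simp
  qed (rule N)
  then show ?thesis by (simp add: \<eta>)
qed

text \<open>At r = 0 the blow-up is a quadratic form: it is even and its gradient is odd.\<close>

lemma opposite_blowup_0: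
  assumes q: "q \<in> P" and \<theta>: "\<theta> \<noteq> 0"
  shows "opposite blowup ((q, 0), \<theta>) = (- \<theta>, 1)"
proof -
  interpret N: fiber_convex_centered "P \<times> UNIV" blowup by (rule fiber_convex_centered_blowup)
  show ?thesis
  proof (rule N.opposite_eqI)
    show "(q, 0) \<in> bottomed (P \<times> UNIV) blowup" "\<theta> \<noteq> bottom blowup (q, 0)"
      using q \<theta> by (auto simp: N.bottomed_eq N.bottom_eq_0)
  qed (simp_all add: fiber_grad_blowup[OF q] blowup_grad_0 blowup_0 linear_neg[OF linear_hessian[OF q]])
qed

end

section \<open>Estimates uniform up to r = 0\<close>

lemma linear_growth_of_vanishing:
  fixes Y :: "('a::euclidean_space \<times> real) \<times> 'e::euclidean_space \<Rightarrow> 'c::euclidean_space"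
  assumes Y: "Ck_on (Suc 0) Y S" and C: "compact C"
    and CS: "\<And>q \<theta> r. (q, \<theta>) \<in> C \<Longrightarrow> r \<in> {0..1} \<Longrightarrow> ((q, r), \<theta>) \<in> S"
    and Y0: "\<And>q \<theta>. (q, \<theta>) \<in> C \<Longrightarrow> Y ((q, 0), \<theta>) = 0"
  obtains B where "B \<ge> 0" "\<And>q \<theta> r. (q, \<theta>) \<in> C \<Longrightarrow> r \<in> {0..1} \<Longrightarrow> norm (Y ((q, r), \<theta>)) \<le> B * r"
proof -
  let ?D = "\<lambda>x. frechet_derivative Y (at x) ((0, 1), 0)"
  \<comment> \<open>This reorders the variables, so that compactness of
    \<open>C \<times> {0..1}\<close> bounds the r derivative; the mean value inequality starting
    from r = 0 then yields B * r.\<close>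
  let ?\<iota> = "\<lambda>z. ((fst (fst z), snd z), snd (fst z)) :: ('a \<times> real) \<times> 'e"
  have "continuous_on S ?D" using Y by (simp add: Ck_on_imp_continuous_on)
  then have "continuous_on (C \<times> {0..1}) (\<lambda>z. ?D (?\<iota> z))"
    by (rule continuous_on_compose2) (use CS in \<open>auto intro!: continuous_intros\<close>)
  then have "bounded ((\<lambda>z. ?D (?\<iota> z)) ` (C \<times> {0..1}))"
    by (intro compact_imp_bounded compact_continuous_image compact_Times C compact_Icc)
  then obtain B where B: "B > 0" "\<And>z. z \<in> C \<times> {0..1} \<Longrightarrow> norm (?D (?\<iota> z)) \<le> B"
    unfolding bounded_pos by blast
  show thesis
  proof
    show "B \<ge> 0" using B by simp
    fix q \<theta> and r :: real assume C: "(q, \<theta>) \<in> C" and r: "r \<in> {0..1}"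
    have d: "((\<lambda>r. Y ((q, r), \<theta>)) has_derivative (\<lambda>h. h *\<^sub>R ?D ((q, t), \<theta>))) (at t)" if "t \<in> {0..1}" for t
    proof -
      have Yd: "(Y has_derivative frechet_derivative Y (at ((q, t), \<theta>))) (at ((q, t), \<theta>))"
        by (rule Ck_on_has_derivative[OF Y CS[OF C that]])
      have "((\<lambda>r. ((q, r), \<theta>)) has_derivative (\<lambda>h. h *\<^sub>R ((0, 1), 0))) (at t)"
        by (auto intro!: derivative_eq_intros)
      from has_derivative_compose[OF this Yd] show ?thesis
        using has_derivative_linear[OF Yd] by (simp only: linear_cmul)
    qed
    have "norm (Y ((q, r), \<theta>) - Y ((q, 0), \<theta>)) \<le> B * norm (r - 0)"
    proof (rule differentiable_bound[of "{0..1}"])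
      show "((\<lambda>r. Y ((q, r), \<theta>)) has_derivative (\<lambda>h. h *\<^sub>R ?D ((q, t), \<theta>))) (at t within {0..1})"
        if "t \<in> {0..1}" for t
        using d[OF that] by (rule has_derivative_at_withinI)
      show "onorm (\<lambda>h. h *\<^sub>R ?D ((q, t), \<theta>)) \<le> B" if "t \<in> {0..1}" for t
        using B(2)[of "((q, \<theta>), t)"] C that B(1)
        by (intro onorm_le) (simp add: mult.commute[of B] mult_left_mono)
    qed (use r in auto)
    then show "norm (Y ((q, r), \<theta>)) \<le> B * r" using Y0[OF C] r by simp
  qed
qed

lemma norm_linear_le_sum:
  fixes L :: "'a::euclidean_space \<Rightarrow> 'b::real_normed_vector"
  assumes "linear L" "\<And>b. b \<in> Basis \<Longrightarrow> norm (L b) \<le> B b"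
  shows "norm (L w) \<le> (\<Sum>b\<in>Basis. B b) * norm w"
proof -
  have "norm (L w) \<le> (\<Sum>b\<in>Basis. norm ((w \<bullet> b) *\<^sub>R L b))"
    unfolding linear_eq_sum_Basis[OF assms(1), of w] by (rule norm_sum)
  also have "\<dots> \<le> (\<Sum>b\<in>Basis. norm w * B b)"
    using assms(2) by (intro sum_mono) (auto intro!: mult_mono Basis_le_norm)
  finally show ?thesis by (simp add: sum_distrib_left mult.commute)
qed

lemma norm_fst_le_norm: "norm (fst z) \<le> norm z"
  by (metis norm_fst_le prod.collapse)

lemma norm_snd_le_norm: "norm (snd z) \<le> norm z"
  by (metis norm_snd_le prod.collapse)

context fiber_convex_centered
begin

lemma opposite_has_derivative:
  assumes "q \<in> P" "p \<noteq> 0"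
  shows "(opposite K has_derivative frechet_derivative (opposite K) (at (q, p))) (at (q, p))"
  using Ck_on_has_derivative[OF smooth_opposite[of "Suc 0"], of "(q, p)"] assms
  by (simp add: off_bottom_eq)

text \<open>The subtracted pair is the opposite map of the quadratic form reached at r = 0.\<close>

definition defect :: "('a \<times> real) \<times> 'e \<Rightarrow> 'e \<times> real" where
  "defect x = opposite blowup x - (- snd x, 1)"

lemma smooth_defect: "Ck_on k defect ((P \<times> UNIV) \<times> (- {0}))"
proof -
  interpret N: fiber_convex_centered "P \<times> UNIV" blowup by (rule fiber_convex_centered_blowup)
  have S: "open ((P \<times> (UNIV :: real set)) \<times> (- {0::'e}))"
    by (intro open_Times open_P open_UNIV open_Compl closed_singleton)
  show ?thesis
    unfolding defect_def using N.smooth_opposite[of k]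
    by (intro Ck_on_diff Ck_on_Pair Ck_on_uminus Ck_on_snd Ck_on_ident Ck_on_const S)
      (simp add: N.off_bottom_eq)
qed

lemma defect_0: "q \<in> P \<Longrightarrow> \<theta> \<noteq> 0 \<Longrightarrow> defect ((q, 0), \<theta>) = 0"
  by (simp add: defect_def opposite_blowup_0)

text \<open>The defect is identically zero on the slice r = 0, so its derivatives along that slice
  vanish; no such statement is made for the r direction.\<close>

lemma defect_derivative_0:
  assumes q: "q \<in> P" and \<theta>: "\<theta> \<noteq> 0"
  shows "frechet_derivative defect (at ((q, 0), \<theta>)) ((u, 0), v) = 0"
proof -
  let ?\<iota> = "\<lambda>x. ((fst x, 0), snd x) :: ('a \<times> real) \<times> 'e"
  have "(?\<iota> has_derivative ?\<iota>) (at (q, \<theta>))"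
    by (intro has_derivative_Pair has_derivative_fst has_derivative_snd has_derivative_ident has_derivative_const)
  moreover have "(defect has_derivative frechet_derivative defect (at ((q, 0), \<theta>))) (at (?\<iota> (q, \<theta>)))"
    using Ck_on_has_derivative[OF smooth_defect[of "Suc 0"], of "((q, 0), \<theta>)"] q \<theta> by simp
  ultimately have 1: "((\<lambda>x. defect (?\<iota> x)) has_derivative
      (\<lambda>w. frechet_derivative defect (at ((q, 0), \<theta>)) (?\<iota> w))) (at (q, \<theta>))"
    by (rule has_derivative_compose)
  have "((\<lambda>x. defect (?\<iota> x)) has_derivative (\<lambda>w. 0)) (at (q, \<theta>))"
  proof (rule has_derivative_transform_within_open[OF has_derivative_const])
    show "open (P \<times> (- {0::'e}))" by (intro open_Times open_P open_Compl closed_singleton)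
  qed (use q \<theta> defect_0 in auto)
  from fun_cong[OF has_derivative_unique[OF 1 this], of "(u, v)"] show ?thesis by simp
qed

text \<open>\<open>linear_growth_of_vanishing\<close> is applied to the defect and to its
  derivatives along the basis of the (q, \<theta>) space; summing over this basis gives all
  directions. Normalising \<theta> provides compactness.\<close>

lemma defect_bounds:
  assumes C: "compact C" "C \<subseteq> P"
  obtains B where "B \<ge> 0"
    "\<And>q r \<theta>. q \<in> C \<Longrightarrow> r \<in> {0..1} \<Longrightarrow> norm \<theta> = 1 \<Longrightarrow> norm (defect ((q, r), \<theta>)) \<le> B * r"
    "\<And>q r \<theta> u v. q \<in> C \<Longrightarrow> r \<in> {0..1} \<Longrightarrow> norm \<theta> = 1 \<Longrightarrow>
       norm (frechet_derivative defect (at ((q, r), \<theta>)) ((u, 0), v)) \<le> B * r * norm (u, v)"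
proof -
  define C' where "C' = C \<times> sphere (0::'e) 1"
  have C': "compact C'" using C by (auto simp: C'_def intro!: compact_Times)
  let ?S = "(P \<times> (UNIV :: real set)) \<times> (- {0::'e})"
  have S: "((q, r), \<theta>) \<in> ?S" if "(q, \<theta>) \<in> C'" for q \<theta> r using that C by (auto simp: C'_def)
  obtain B0 where B0: "B0 \<ge> 0" "\<And>q \<theta> r. (q, \<theta>) \<in> C' \<Longrightarrow> r \<in> {0..1} \<Longrightarrow> norm (defect ((q, r), \<theta>)) \<le> B0 * r"
    using linear_growth_of_vanishing[OF smooth_defect C' S] defect_0 S by auto
  let ?\<iota> = "\<lambda>w. ((fst w, 0), snd w) :: ('a \<times> real) \<times> 'e"
  have "\<exists>B\<ge>0. \<forall>q \<theta> r. (q, \<theta>) \<in> C' \<longrightarrow> r \<in> {0..1} \<longrightarrow>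
      norm (frechet_derivative defect (at ((q, r), \<theta>)) (?\<iota> b)) \<le> B * r" for b
  proof -
    have "Ck_on (Suc 0) (\<lambda>x. frechet_derivative defect (at x) (?\<iota> b)) ?S"
      by (rule Ck_on_frechet_derivative[OF smooth_defect])
    from linear_growth_of_vanishing[OF this C' S] obtain B where "B \<ge> 0"
      "\<And>q \<theta> r. (q, \<theta>) \<in> C' \<Longrightarrow> r \<in> {0..1} \<Longrightarrow>
        norm (frechet_derivative defect (at ((q, r), \<theta>)) (?\<iota> b)) \<le> B * r"
      using defect_derivative_0 S by auto
    then show ?thesis by blast
  qed
  then obtain B where B: "\<And>b. B b \<ge> 0" "\<And>b q \<theta> r. (q, \<theta>) \<in> C' \<Longrightarrow> r \<in> {0..1} \<Longrightarrow>
      norm (frechet_derivative defect (at ((q, r), \<theta>)) (?\<iota> b)) \<le> B b * r"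
    by metis
  define B1 where "B1 = (\<Sum>b\<in>(Basis :: ('a \<times> 'e) set). B b)"
  have B1: "B1 \<ge> 0" unfolding B1_def by (intro sum_nonneg B)
  show thesis
  proof
    show "B0 + B1 \<ge> 0" using B0 B1 by simp
    fix q \<theta> and r :: real assume *: "q \<in> C" "r \<in> {0..1}" "norm (\<theta>::'e) = 1"
    have qC: "(q, \<theta>) \<in> C'" using * by (simp add: C'_def)
    show "norm (defect ((q, r), \<theta>)) \<le> (B0 + B1) * r"
      using B0(2)[OF qC *(2)] B1 *(2) by (simp add: distrib_right add_increasing2)
    fix u :: 'a and v :: 'e
    have "linear (frechet_derivative defect (at ((q, r), \<theta>)))"
      using Ck_on_has_derivative[OF smooth_defect S[OF qC]] by (rule has_derivative_linear)
    moreover have "linear ?\<iota>"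
      by (rule linearI) auto
    ultimately have "linear (\<lambda>w. frechet_derivative defect (at ((q, r), \<theta>)) (?\<iota> w))"
      using linear_compose[of ?\<iota> "frechet_derivative defect (at ((q, r), \<theta>))"] by (simp add: o_def)
    from norm_linear_le_sum[OF this B(2)[OF qC *(2)], of "(u, v)"]
    have "norm (frechet_derivative defect (at ((q, r), \<theta>)) ((u, 0), v)) \<le> B1 * r * norm (u, v)"
      by (simp add: B1_def sum_distrib_right)
    also have "\<dots> \<le> (B0 + B1) * r * norm (u, v)"
      using B0(1) *(2) by (intro mult_right_mono) auto
    finally show "norm (frechet_derivative defect (at ((q, r), \<theta>)) ((u, 0), v)) \<le> (B0 + B1) * r * norm (u, v)" .
  qed
qed

text \<open>Taking r = \<bar>p\<bar> puts \<theta> = p / r on the sphere where the defect is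
  controlled. The point is rescaled by r and the factor is not, which accounts for the extra power
  of \<bar>p\<bar> in the estimates for the point.\<close>

lemma opposite_bounds:
  assumes C: "compact C" "C \<subseteq> P"
  obtains B where "B \<ge> 0"
    "\<And>q p. q \<in> C \<Longrightarrow> p \<noteq> 0 \<Longrightarrow> norm p \<le> 1 \<Longrightarrow> norm (fst (opposite K (q, p)) + p) \<le> B * (norm p)\<^sup>2"
    "\<And>q p. q \<in> C \<Longrightarrow> p \<noteq> 0 \<Longrightarrow> norm p \<le> 1 \<Longrightarrow> \<bar>snd (opposite K (q, p)) - 1\<bar> \<le> B * norm p"
    "\<And>q p u v. q \<in> C \<Longrightarrow> p \<noteq> 0 \<Longrightarrow> norm p \<le> 1 \<Longrightarrow>
       norm (fst (frechet_derivative (opposite K) (at (q, p)) (u, v)) + v) \<le> B * norm p * norm (u, v)"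
    "\<And>q p u v. q \<in> C \<Longrightarrow> p \<noteq> 0 \<Longrightarrow> norm p \<le> 1 \<Longrightarrow>
       \<bar>snd (frechet_derivative (opposite K) (at (q, p)) (u, v))\<bar> \<le> B * norm (u, v)"
proof -
  obtain B where B: "B \<ge> 0"
    "\<And>q r \<theta>. q \<in> C \<Longrightarrow> r \<in> {0..1} \<Longrightarrow> norm \<theta> = 1 \<Longrightarrow> norm (defect ((q, r), \<theta>)) \<le> B * r"
    "\<And>q r \<theta> u v. q \<in> C \<Longrightarrow> r \<in> {0..1} \<Longrightarrow> norm \<theta> = 1 \<Longrightarrow>
       norm (frechet_derivative defect (at ((q, r), \<theta>)) ((u, 0), v)) \<le> B * r * norm (u, v)"
    using defect_bounds[OF C] by blast
  have eq: "opposite K (q, p) = (r *\<^sub>R fst (defect ((q, r), p /\<^sub>R r)) - p, snd (defect ((q, r), p /\<^sub>R r)) + 1)"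
    if "q \<in> P" "p \<noteq> 0" "r > 0" for q p r
    using that by (simp add: opposite_blowup[OF that] defect_def scaleR_add_right)
  show thesis
  proof
    show "B \<ge> 0" by (rule B)
    fix q and p :: 'e assume q: "q \<in> C" and p: "p \<noteq> 0" "norm p \<le> 1"
    define r where "r = norm p"
    define \<theta> where "\<theta> = p /\<^sub>R r"
    have qP: "q \<in> P" using q C by blast
    have r: "r > 0" "r \<le> 1" "norm \<theta> = 1" using p by (auto simp: r_def \<theta>_def)
    have Z: "norm (defect ((q, r), \<theta>)) \<le> B * r" using B(2)[OF q, of r \<theta>] r by auto
    have opp: "opposite K (q, p) = (r *\<^sub>R fst (defect ((q, r), \<theta>)) - p, snd (defect ((q, r), \<theta>)) + 1)"
      using eq[OF qP p(1) r(1)] by (simp add: \<theta>_def)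
    have "norm (fst (opposite K (q, p)) + p) = r * norm (fst (defect ((q, r), \<theta>)))"
      using r by (simp add: opp)
    also have "\<dots> \<le> r * (B * r)"
      using order_trans[OF norm_fst_le_norm Z] r by (intro mult_left_mono) auto
    finally show "norm (fst (opposite K (q, p)) + p) \<le> B * (norm p)\<^sup>2"
      by (simp add: r_def power2_eq_square mult_ac)
    show "\<bar>snd (opposite K (q, p)) - 1\<bar> \<le> B * norm p"
      using order_trans[OF norm_snd_le_norm Z] by (simp add: opp r_def)
    fix u :: 'a and v :: 'e
    define W where "W = frechet_derivative defect (at ((q, r), \<theta>)) ((u, 0), v /\<^sub>R r)"
    \<comment> \<open>As r \<le> 1, replacing v by v / r costs at most 1 / r, which the bound B * r
      for the derivative of the defect absorbs.\<close>
    have "norm (u, v /\<^sub>R r) \<le> norm (u, v) / r"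
    proof -
      have "norm (u, v /\<^sub>R r) = norm ((r *\<^sub>R u, v) /\<^sub>R r)" using r by simp
      also have "\<dots> = norm (r *\<^sub>R u, v) / r" using r by (simp add: divide_inverse_commute del: scaleR_Pair)
      also have "norm (r *\<^sub>R u, v) \<le> norm (u, v)"
        using r by (simp add: norm_Pair power_mult_distrib mult_left_le_one_le power_le_one)
      finally show ?thesis using r by (simp add: divide_right_mono)
    qed
    then have "B * r * norm (u, v /\<^sub>R r) \<le> B * r * (norm (u, v) / r)"
      using B(1) r by (intro mult_left_mono) auto
    then have W: "norm W \<le> B * norm (u, v)"
      using B(3)[OF q, of r \<theta> u "v /\<^sub>R r"] r by (simp add: W_def)
    \<comment> \<open>r stays frozen while x varies, so only derivatives of the defect without r
      component occur, and those are the ones that vanish at r = 0.\<close>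
    let ?\<psi> = "\<lambda>x. ((fst x, r), snd x /\<^sub>R r) :: ('a \<times> real) \<times> 'e"
    have "(?\<psi> has_derivative (\<lambda>w. ((fst w, 0), snd w /\<^sub>R r))) (at (q, p))"
      by (intro has_derivative_Pair has_derivative_fst has_derivative_snd has_derivative_ident
          has_derivative_const has_derivative_scaleR_right)
    moreover have "(defect has_derivative frechet_derivative defect (at ((q, r), \<theta>))) (at (?\<psi> (q, p)))"
      using Ck_on_has_derivative[OF smooth_defect[of "Suc 0"], of "((q, r), \<theta>)"] qP r p by (auto simp: \<theta>_def)
    ultimately have d: "((\<lambda>x. defect (?\<psi> x)) has_derivative
        (\<lambda>w. frechet_derivative defect (at ((q, r), \<theta>)) ((fst w, 0), snd w /\<^sub>R r))) (at (q, p))"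
      (is "(_ has_derivative ?D) _") by (rule has_derivative_compose)
    have "((\<lambda>x. (r *\<^sub>R fst (defect (?\<psi> x)) - snd x, snd (defect (?\<psi> x)) + 1)) has_derivative
        (\<lambda>w. (r *\<^sub>R fst (?D w) - snd w, snd (?D w) + 0))) (at (q, p))"
      by (intro has_derivative_Pair has_derivative_diff has_derivative_add has_derivative_scaleR_right
          has_derivative_fst has_derivative_snd has_derivative_ident has_derivative_const d)
    then have "(opposite K has_derivative (\<lambda>w. (r *\<^sub>R fst (?D w) - snd w, snd (?D w) + 0))) (at (q, p))"
    proof (rule has_derivative_transform_within_open)
      show "open (P \<times> (- {0::'e}))" by (intro open_Times open_P open_Compl closed_singleton)
      show "(r *\<^sub>R fst (defect (?\<psi> x)) - snd x, snd (defect (?\<psi> x)) + 1) = opposite K x"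
        if "x \<in> P \<times> (- {0})" for x
      proof -
        have "fst x \<in> P" "snd x \<noteq> 0" using that by auto
        from eq[OF this r(1)] show ?thesis by simp
      qed
    qed (use qP p in auto)
    from fun_cong[OF frechet_derivative_at[OF this], of "(u, v)"]
    have D: "frechet_derivative (opposite K) (at (q, p)) (u, v) = (r *\<^sub>R fst W - v, snd W)"
      by (simp add: W_def)
    have "norm (fst (frechet_derivative (opposite K) (at (q, p)) (u, v)) + v) = r * norm (fst W)"
      using r by (simp add: D)
    also have "\<dots> \<le> r * (B * norm (u, v))"
      using order_trans[OF norm_fst_le_norm W] r by (intro mult_left_mono) auto
    finally show "norm (fst (frechet_derivative (opposite K) (at (q, p)) (u, v)) + v) \<le> B * norm p * norm (u, v)"
      by (simp add: r_def mult_ac)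
    show "\<bar>snd (frechet_derivative (opposite K) (at (q, p)) (u, v))\<bar> \<le> B * norm (u, v)"
      using order_trans[OF norm_snd_le_norm W] by (simp add: D)
  qed
qed

end

section \<open>Crossing the minimum: C^1 and Lipschitz extension\<close>

lemma Ck_on_locally_lipschitz:
  fixes f :: "'a::euclidean_space \<Rightarrow> 'b::euclidean_space"
  assumes S: "open S" "x \<in> S" and f: "Ck_on (Suc 0) f S"
  obtains r L where "r > 0" "ball x r \<subseteq> S" "L-lipschitz_on (ball x r) f"
proof -
  obtain r where r: "r > 0" "cball x r \<subseteq> S" using S open_contains_cball by blast
  have "\<exists>B. \<forall>y\<in>cball x r. norm (frechet_derivative f (at y) b) \<le> B" for b
  proof -
    have "continuous_on (cball x r) (\<lambda>y. frechet_derivative f (at y) b)"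
      using f r by (auto intro: continuous_on_subset)
    then have "bounded ((\<lambda>y. frechet_derivative f (at y) b) ` cball x r)"
      by (intro compact_imp_bounded compact_continuous_image) auto
    then show ?thesis by (auto simp: bounded_iff)
  qed
  then obtain B where B: "\<And>b y. y \<in> cball x r \<Longrightarrow> norm (frechet_derivative f (at y) b) \<le> B b" by metis
  define L where "L = (\<Sum>b\<in>Basis. B b)"
  have d: "(f has_derivative frechet_derivative f (at y)) (at y)" if "y \<in> ball x r" for y
    using Ck_on_has_derivative[OF f] r that by (auto simp: subset_eq)
  have L: "norm (frechet_derivative f (at y) w) \<le> L * norm w" if "y \<in> ball x r" for y w
    unfolding L_def using that by (intro norm_linear_le_sum has_derivative_linear[OF d] B) auto
  have "0 \<le> B b" for b using order_trans[OF norm_ge_zero B[of x b]] r by simp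
  then have "L \<ge> 0" unfolding L_def by (intro sum_nonneg)
  have "L-lipschitz_on (ball x r) f"
  proof (rule bounded_derivative_imp_lipschitz)
    show "(f has_derivative frechet_derivative f (at y)) (at y within ball x r)" if "y \<in> ball x r" for y
      using d[OF that] by (rule has_derivative_at_withinI)
    show "onorm (frechet_derivative f (at y)) \<le> L" if "y \<in> ball x r" for y
      using L[OF that] by (intro onorm_le)
  qed (use \<open>L \<ge> 0\<close> in auto)
  then show thesis using that r by force
qed

lemma has_derivative_0_if_quadratic:
  fixes f :: "'a::real_normed_vector \<Rightarrow> 'b::real_normed_vector"
  assumes "e > 0" "f x = 0" "\<And>y. dist y x < e \<Longrightarrow> norm (f y) \<le> B * (norm (y - x))\<^sup>2"
  shows "(f has_derivative (\<lambda>_. 0)) (at x)"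
proof (rule has_derivativeI_sandwich[OF assms(1)])
  show "norm (f y - f x - 0) / norm (y - x) \<le> B * norm (y - x)" if "y \<noteq> x" "dist y x < e" for y
    using assms(3)[OF that(2)] that(1) assms(2) by (simp add: divide_le_eq power2_eq_square)
  have "((\<lambda>y. B * norm (y - x)) \<longlongrightarrow> B * norm (x - x)) (at x)"
    by (intro tendsto_intros)
  then show "((\<lambda>y. B * norm (y - x)) \<longlongrightarrow> 0) (at x)" by simp
qed simp

definition reflection :: "('a::euclidean_space \<times> 'e::euclidean_space \<Rightarrow> real) \<Rightarrow> 'a \<times> 'e \<Rightarrow> 'e" where
  "reflection K x = (if snd x = bottom K (fst x) then snd x else fst (opposite K x))"

definition reflection_factor :: "('a::euclidean_space \<times> 'e::euclidean_space \<Rightarrow> real) \<Rightarrow> 'a \<times> 'e \<Rightarrow> real" where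
  "reflection_factor K x = (if snd x = bottom K (fst x) then 1 else snd (opposite K x))"

context fiber_convex_centered
begin

text \<open>The compact estimates are transferred to a ball around a point of the zero section; the
  first two now also cover the section itself, where \<open>reflection\<close> and
  \<open>reflection_factor\<close> take their prescribed values.\<close>

lemma near_zero_section:
  assumes "q0 \<in> P"
  shows "\<exists>\<epsilon>>0. \<exists>B\<ge>0. ball (q0, 0::'e) \<epsilon> \<subseteq> P \<times> UNIV \<and> (\<forall>x\<in>ball (q0, 0) \<epsilon>.
    norm (reflection K x + snd x) \<le> B * (norm (snd x))\<^sup>2 \<and>
    \<bar>reflection_factor K x - 1\<bar> \<le> B * norm (snd x) \<and>
    (snd x \<noteq> 0 \<longrightarrow> (\<forall>w.
      norm (fst (frechet_derivative (opposite K) (at x) w) + snd w) \<le> B * norm (snd x) * norm w \<and>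
      \<bar>snd (frechet_derivative (opposite K) (at x) w)\<bar> \<le> B * norm w)))"
proof -
  obtain \<delta> where \<delta>: "\<delta> > 0" "cball q0 \<delta> \<subseteq> P" using assms open_P open_contains_cball by blast
  obtain B where B: "B \<ge> 0"
    "\<And>q p. q \<in> cball q0 \<delta> \<Longrightarrow> p \<noteq> 0 \<Longrightarrow> norm p \<le> 1 \<Longrightarrow> norm (fst (opposite K (q, p)) + p) \<le> B * (norm p)\<^sup>2"
    "\<And>q p. q \<in> cball q0 \<delta> \<Longrightarrow> p \<noteq> 0 \<Longrightarrow> norm p \<le> 1 \<Longrightarrow> \<bar>snd (opposite K (q, p)) - 1\<bar> \<le> B * norm p"
    "\<And>q p u v. q \<in> cball q0 \<delta> \<Longrightarrow> p \<noteq> 0 \<Longrightarrow> norm p \<le> 1 \<Longrightarrow>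
       norm (fst (frechet_derivative (opposite K) (at (q, p)) (u, v)) + v) \<le> B * norm p * norm (u, v)"
    "\<And>q p u v. q \<in> cball q0 \<delta> \<Longrightarrow> p \<noteq> 0 \<Longrightarrow> norm p \<le> 1 \<Longrightarrow>
       \<bar>snd (frechet_derivative (opposite K) (at (q, p)) (u, v))\<bar> \<le> B * norm (u, v)"
    using opposite_bounds[OF compact_cball \<delta>(2)] by blast
  have near: "fst x \<in> cball q0 \<delta>" "norm (snd x) \<le> 1" "fst x \<in> P" if "x \<in> ball (q0, 0) (min \<delta> 1)" for x :: "'a \<times> 'e"
  proof -
    have "norm (fst x - q0) \<le> norm (x - (q0, 0))" "norm (snd x - 0) \<le> norm (x - (q0, 0))"
      using norm_fst_le_norm[of "x - (q0, 0)"] norm_snd_le_norm[of "x - (q0, 0)"] by simp_all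
    moreover have "norm (x - (q0, 0)) < min \<delta> 1"
      using that by (simp add: dist_norm norm_minus_commute)
    ultimately show "fst x \<in> cball q0 \<delta>" "norm (snd x) \<le> 1" by (auto simp: dist_norm norm_minus_commute)
    then show "fst x \<in> P" using \<delta> by blast
  qed
  show ?thesis
  proof (rule exI[of _ "min \<delta> 1"], rule conjI, use \<delta> in simp, rule exI[of _ B], intro conjI ballI impI allI)
    show "ball (q0, 0::'e) (min \<delta> 1) \<subseteq> P \<times> UNIV"
    proof
      fix x :: "'a \<times> 'e" assume "x \<in> ball (q0, 0) (min \<delta> 1)"
      from near(3)[OF this] show "x \<in> P \<times> UNIV" by (simp add: mem_Times_iff)
    qed
    fix x :: "'a \<times> 'e" assume x: "x \<in> ball (q0, 0) (min \<delta> 1)"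
    note n = near[OF x]
    show "norm (reflection K x + snd x) \<le> B * (norm (snd x))\<^sup>2"
      using B(2)[OF n(1) _ n(2)] n bottom_eq_0[OF n(3)] by (simp add: reflection_def)
    show "\<bar>reflection_factor K x - 1\<bar> \<le> B * norm (snd x)"
      using B(3)[OF n(1) _ n(2)] n bottom_eq_0[OF n(3)] by (simp add: reflection_factor_def)
    fix w :: "'a \<times> 'e" assume "snd x \<noteq> 0"
    then show "norm (fst (frechet_derivative (opposite K) (at x) w) + snd w) \<le> B * norm (snd x) * norm w"
      "\<bar>snd (frechet_derivative (opposite K) (at x) w)\<bar> \<le> B * norm w"
      using B(4)[OF n(1) _ n(2), of "fst w" "snd w"] B(5)[OF n(1) _ n(2), of "fst w" "snd w"] by simp_all
  qed (use \<delta> B in auto)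
qed

lemma reflection_has_derivative_0:
  assumes q: "q \<in> P"
  shows "(reflection K has_derivative (\<lambda>w. - snd w)) (at (q, 0))"
proof -
  obtain \<epsilon> B where \<epsilon>: "\<epsilon> > 0" "B \<ge> 0"
    "\<forall>x\<in>ball (q, 0) \<epsilon>. norm (reflection K x + snd x) \<le> B * (norm (snd x))\<^sup>2"
    using near_zero_section[OF q] by blast
  have "((\<lambda>x. reflection K x + snd x) has_derivative (\<lambda>_. 0)) (at (q, 0))"
  proof (rule has_derivative_0_if_quadratic[OF \<epsilon>(1)])
    show "reflection K (q, 0) + snd (q, 0::'e) = 0" using q by (simp add: reflection_def bottom_eq_0)
    show "norm (reflection K x + snd x) \<le> B * (norm (x - (q, 0)))\<^sup>2" if "dist x (q, 0) < \<epsilon>" for x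
    proof -
      have "norm (reflection K x + snd x) \<le> B * (norm (snd x))\<^sup>2"
        using that by (intro \<epsilon>(3)[rule_format]) (simp add: dist_commute)
      also have "\<dots> \<le> B * (norm (x - (q, 0)))\<^sup>2"
        using norm_snd_le_norm[of "x - (q, 0)"] \<epsilon>(2) by (intro mult_left_mono power_mono) auto
      finally show ?thesis .
    qed
  qed
  from has_derivative_diff[OF this has_derivative_snd[OF has_derivative_ident]]
  show ?thesis by simp
qed

lemma C1_reflection_centered: "Ck_on (Suc 0) (reflection K) (P \<times> UNIV)"
proof -
  have oR: "open (P \<times> (- {0::'e}))" by (intro open_Times open_P open_Compl closed_singleton)
  have opp: "Ck_on (Suc 0) (opposite K) (P \<times> (- {0}))" using smooth_opposite by (simp add: off_bottom_eq)
  \<comment> \<open>The value on the zero section is the derivative found there, and also the limit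
    of the nearby derivatives, since these differ from it by at most B times \<bar>p\<bar> times the
    norm of w.\<close>
  define D where "D x w = (if snd x = 0 then - snd w else fst (frechet_derivative (opposite K) (at x) w))"
    for x w :: "'a \<times> 'e"
  show ?thesis
  proof (rule Ck_on_SucI[OF open_PU])
    fix x :: "'a \<times> 'e" assume "x \<in> P \<times> UNIV"
    then obtain q p where x: "x = (q, p)" "q \<in> P" by auto
    show "(reflection K has_derivative D x) (at x)"
    proof (cases "p = 0")
      case True
      then show ?thesis using reflection_has_derivative_0[OF x(2)] by (simp add: D_def[abs_def] x)
    next
      case False
      then have "((\<lambda>x. fst (opposite K x)) has_derivative D x) (at x)"
        using has_derivative_fst[OF Ck_on_has_derivative[OF opp]] x by (simp add: D_def[abs_def])
      then show ?thesis
        by (rule has_derivative_transform_within_open[OF _ oR])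
          (use x False in \<open>auto simp: reflection_def bottom_eq_0\<close>)
    qed
  next
    fix w :: "'a \<times> 'e"
    have "isCont (\<lambda>x. D x w) (q, p)" if q: "q \<in> P" for q p
    proof (cases "p = 0")
      case False
      have "continuous_on (P \<times> (- {0})) (\<lambda>x. fst (frechet_derivative (opposite K) (at x) w))"
        by (intro continuous_on_fst Ck_on_imp_continuous_on[OF Ck_on_frechet_derivative[OF opp]])
      then have "continuous_on (P \<times> (- {0})) (\<lambda>x. D x w)"
        by (rule continuous_on_eq) (auto simp: D_def)
      then show ?thesis using oR q False by (simp add: continuous_on_eq_continuous_at)
    next
      case True
      obtain \<epsilon> B where \<epsilon>: "\<epsilon> > 0" "B \<ge> 0"
        "\<forall>x\<in>ball (q, 0) \<epsilon>. snd x \<noteq> 0 \<longrightarrow> (\<forall>w.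
          norm (fst (frechet_derivative (opposite K) (at x) w) + snd w) \<le> B * norm (snd x) * norm w)"
        using near_zero_section[OF q] by blast
      have "\<forall>\<^sub>F x in at (q, 0). x \<in> ball (q, 0) \<epsilon>"
        using \<epsilon>(1) by (intro eventually_at_in_open') auto
      then have "\<forall>\<^sub>F x in at (q, 0). norm (D x w + snd w) \<le> B * norm (snd x) * norm w"
      proof eventually_elim
        case (elim x)
        show ?case
        proof (cases "snd x = 0")
          case False
          then show ?thesis using \<epsilon>(3)[rule_format, OF elim False, of w] by (simp add: D_def)
        qed (simp add: D_def)
      qed
      moreover have "((\<lambda>x. B * norm (snd x) * norm w) \<longlongrightarrow> 0) (at (q, 0))"
        using tendsto_mult[OF tendsto_mult[OF tendsto_const[of B] tendsto_norm[OF tendsto_snd[OF tendsto_ident_at]]]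
            tendsto_const[of "norm w"], of "(q, 0)" UNIV] by simp
      ultimately have "((\<lambda>x. D x w + snd w) \<longlongrightarrow> 0) (at (q, 0))"
        by (intro Lim_null_comparison[of "\<lambda>x. D x w + snd w"]) auto
      then have "((\<lambda>x. D x w - D (q, 0) w) \<longlongrightarrow> 0) (at (q, 0))" by (simp add: D_def)
      then show ?thesis using True unfolding isCont_def by (auto intro: LIM_zero_cancel)
    qed
    then show "Ck_on 0 (\<lambda>x. D x w) (P \<times> UNIV)"
      by (auto intro!: continuous_at_imp_continuous_on)
  qed
qed

text \<open>If the segment between two points meets the zero section at z, both values differ from 1
  by at most B times the distance to z, and these distances add up to the length. Otherwise the
  bounded derivative along the segment gives the estimate.\<close>

lemma lipschitz_reflection_factor_centered:
  assumes x: "x \<in> P \<times> UNIV"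
  obtains r L where "r > 0" "ball x r \<subseteq> P \<times> UNIV" "L-lipschitz_on (ball x r) (reflection_factor K)"
proof (cases "snd x = 0")
  case False
  have oR: "open (P \<times> (- {0::'e}))" by (intro open_Times open_P open_Compl closed_singleton)
  have "Ck_on (Suc 0) (\<lambda>x. snd (opposite K x)) (P \<times> (- {0}))"
    using Ck_on_snd[OF _ smooth_opposite] open_off_bottom by (simp add: off_bottom_eq)
  then have "Ck_on (Suc 0) (reflection_factor K) (P \<times> (- {0}))"
    by (rule Ck_on_cong[OF oR, rotated]) (auto simp: reflection_factor_def bottom_eq_0)
  moreover have "x \<in> P \<times> (- {0})" using x False by (auto simp: mem_Times_iff)
  ultimately obtain r L where "r > 0" "ball x r \<subseteq> P \<times> (- {0})" "L-lipschitz_on (ball x r) (reflection_factor K)"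
    using Ck_on_locally_lipschitz[OF oR] by blast
  then show thesis using that by blast
next
  case True
  then obtain q0 where x0: "x = (q0, 0)" "q0 \<in> P" using x by (cases x) auto
  obtain \<epsilon> B where \<epsilon>: "\<epsilon> > 0" "B \<ge> 0" "ball (q0, 0::'e) \<epsilon> \<subseteq> P \<times> UNIV"
    "\<forall>x\<in>ball (q0, 0) \<epsilon>. \<bar>reflection_factor K x - 1\<bar> \<le> B * norm (snd x)"
    "\<forall>x\<in>ball (q0, 0) \<epsilon>. snd x \<noteq> 0 \<longrightarrow> (\<forall>w.
       \<bar>snd (frechet_derivative (opposite K) (at x) w)\<bar> \<le> B * norm w)"
    using near_zero_section[OF x0(2)] by blast
  have "\<bar>reflection_factor K a - reflection_factor K b\<bar> \<le> B * norm (a - b)"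
    if a: "a \<in> ball (q0, 0) \<epsilon>" and b: "b \<in> ball (q0, 0) \<epsilon>" for a b
  proof -
    have seg: "closed_segment b a \<subseteq> ball (q0, 0) \<epsilon>"
      using a b by (intro closed_segment_subset convex_ball)
    show ?thesis
    proof (cases "\<exists>z \<in> closed_segment b a. snd z = 0")
      case True
      then obtain z where z: "z \<in> closed_segment b a" "snd z = 0" by blast
      have 1: "\<bar>reflection_factor K c - 1\<bar> \<le> B * norm (c - z)" if "c \<in> ball (q0, 0) \<epsilon>" for c
      proof -
        have "norm (snd c) \<le> norm (c - z)" using norm_snd_le_norm[of "c - z"] z by simp
        then show ?thesis using \<epsilon>(4)[rule_format, OF that] \<epsilon>(2) mult_left_mono order_trans by meson
      qed
      have "dist b a = dist b z + dist z a"
        using z(1) between_mem_segment between by metis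
      then have "B * norm (a - b) = B * norm (a - z) + B * norm (b - z)"
        by (simp add: dist_norm norm_minus_commute algebra_simps)
      then show ?thesis using 1[OF a] 1[OF b] by linarith
    next
      case False
      let ?D = "\<lambda>y w. snd (frechet_derivative (opposite K) (at y) w)"
      have oR: "open (P \<times> (- {0::'e}))" by (intro open_Times open_P open_Compl closed_singleton)
      have sub: "closed_segment b a \<subseteq> P \<times> (- {0})"
      proof
        fix y assume y: "y \<in> closed_segment b a"
        have "y \<in> P \<times> UNIV" using y seg \<epsilon>(3) by blast
        moreover have "snd y \<noteq> 0" using False y by blast
        ultimately show "y \<in> P \<times> (- {0})" by (simp add: mem_Times_iff)
      qed
      have d: "(reflection_factor K has_derivative ?D y) (at y)" if "y \<in> closed_segment b a" for y
      proof -
        have y: "y \<in> P \<times> (- {0})" using that sub by blast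
        then have "((\<lambda>x. snd (opposite K x)) has_derivative ?D y) (at y)"
          using opposite_has_derivative[of "fst y" "snd y"] has_derivative_snd by (auto simp: mem_Times_iff)
        then show ?thesis
          by (rule has_derivative_transform_within_open[OF _ oR y])
            (auto simp: reflection_factor_def bottom_eq_0)
      qed
      have "norm (reflection_factor K a - reflection_factor K b) \<le> B * norm (a - b)"
      proof (rule differentiable_bound[OF convex_closed_segment])
        show "(reflection_factor K has_derivative ?D y) (at y within closed_segment b a)"
          if "y \<in> closed_segment b a" for y
          using d[OF that] by (rule has_derivative_at_withinI)
        show "onorm (?D y) \<le> B" if "y \<in> closed_segment b a" for y
        proof (rule onorm_le)
          have "y \<in> ball (q0, 0) \<epsilon>" "snd y \<noteq> 0" using that seg False by blast+
          then show "norm (?D y w) \<le> B * norm w" for w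
            using \<epsilon>(5)[rule_format, of y w] by simp
        qed
      qed auto
      then show ?thesis by simp
    qed
  qed
  then have "B-lipschitz_on (ball x \<epsilon>) (reflection_factor K)"
    using \<epsilon>(2) by (intro lipschitz_onI) (auto simp: dist_norm x0)
  then show thesis using that \<epsilon>(1,3) x0 by blast
qed

end

section \<open>Translating the minimum\<close>

context fiber_convex
begin

definition centered :: "'a \<times> 'e \<Rightarrow> real" where
  "centered x = K (fst x, bottom K (fst x) + snd x)"

lemma open_bottomed_UNIV: "open (bottomed P K \<times> (UNIV :: 'e set))"
  by (intro open_Times open_bottomed open_UNIV)

lemma smooth_shift:
  "Ck_on k (\<lambda>x. (fst x, bottom K (fst x) + snd x)) (bottomed P K \<times> UNIV)"
  "Ck_on k (\<lambda>x. (fst x, snd x - bottom K (fst x))) (bottomed P K \<times> UNIV)"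
proof -
  note S = open_bottomed_UNIV
  have b: "Ck_on k (\<lambda>x. bottom K (fst x)) (bottomed P K \<times> (UNIV :: 'e set))"
    by (rule Ck_on_compose[OF S open_bottomed _ smooth_bottom]) (auto intro: Ck_on_fst[OF S Ck_on_ident[OF S]])
  show "Ck_on k (\<lambda>x. (fst x, bottom K (fst x) + snd x)) (bottomed P K \<times> UNIV)"
    "Ck_on k (\<lambda>x. (fst x, snd x - bottom K (fst x))) (bottomed P K \<times> UNIV)"
    by (intro Ck_on_Pair Ck_on_fst Ck_on_snd Ck_on_ident Ck_on_add Ck_on_diff b S)+
qed

lemma smooth_centered: "Ck_on k centered (bottomed P K \<times> UNIV)"
  unfolding centered_def
  by (rule Ck_on_compose[OF open_bottomed_UNIV open_PU _ smooth smooth_shift(1)])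
    (auto dest: bottomed_subset)

lemma fiber_grad_centered:
  assumes q: "q \<in> bottomed P K"
  shows "fiber_grad centered (q, p) = fiber_grad K (q, bottom K q + p)"
proof -
  have 1: "((\<lambda>p. centered (q, p)) has_derivative (\<lambda>v. frechet_derivative centered (at (q, p)) (0, v))) (at p)"
    by (rule has_derivative_partial_snd[OF Ck_on_has_derivative[OF smooth_centered]]) (use q in simp)
  have "((\<lambda>p. bottom K q + p) has_derivative (\<lambda>v. v)) (at p)"
    by (auto intro!: derivative_eq_intros)
  from has_derivative_compose[OF this K_fiber_derivative[OF bottomed_subset[OF q]]]
  have 2: "((\<lambda>p. centered (q, p)) has_derivative (\<lambda>v. fiber_grad K (q, bottom K q + p) \<bullet> v)) (at p)"
    by (simp add: centered_def)
  have "frechet_derivative centered (at (q, p)) (0, v) = fiber_grad K (q, bottom K q + p) \<bullet> v" for v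
    using fun_cong[OF has_derivative_unique[OF 1 2]] .
  then show ?thesis by (simp add: fiber_grad_def[of centered] euclidean_representation)
qed

lemma fiber_convex_centered: "fiber_convex_centered (bottomed P K) centered"
proof
  show "open (bottomed P K)" by (rule open_bottomed)
  show "Ck_on k centered (bottomed P K \<times> UNIV)" for k by (rule smooth_centered)
  show "fiber_grad centered (q, 0) = 0" if "q \<in> bottomed P K" for q
    using that by (simp add: fiber_grad_centered grad_bottom)
  fix q :: 'a and p v :: 'e assume q: "q \<in> bottomed P K" and v: "v \<noteq> 0"
  have "Ck_on (Suc 0) (fiber_grad centered) (bottomed P K \<times> UNIV)"
    unfolding fiber_grad_def
    by (intro Ck_on_sum Ck_on_scaleR Ck_on_const Ck_on_frechet_derivative[OF smooth_centered] open_bottomed_UNIV)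
  from has_derivative_partial_snd[OF Ck_on_has_derivative[OF this, of "(q, p)"]] q
  have 1: "((\<lambda>p. fiber_grad centered (q, p)) has_derivative
      (\<lambda>v. frechet_derivative (fiber_grad centered) (at (q, p)) (0, v))) (at p)" by simp
  have "((\<lambda>p. bottom K q + p) has_derivative (\<lambda>v. v)) (at p)"
    by (auto intro!: derivative_eq_intros)
  from has_derivative_compose[OF this has_derivative_partial_snd[OF has_derivative_grad[OF bottomed_subset[OF q]]]]
  have 2: "((\<lambda>p. fiber_grad centered (q, p)) has_derivative
      (\<lambda>v. frechet_derivative (fiber_grad K) (at (q, bottom K q + p)) (0, v))) (at p)"
    by (simp add: fiber_grad_centered[OF q])
  show "0 < frechet_derivative (fiber_grad centered) (at (q, p)) (0, v) \<bullet> v"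
    using fun_cong[OF has_derivative_unique[OF 1 2], of v] hessian_pos[OF bottomed_subset[OF q] v] by simp
qed

text \<open>Translating a fiber preserves gradients and levels, so it moves the opposite point along
  and leaves the factor unchanged.\<close>

lemma opposite_centered:
  assumes q: "q \<in> bottomed P K" and p: "p \<noteq> bottom K q"
  shows "opposite K (q, p) = (bottom K q + fst (opposite centered (q, p - bottom K q)),
    snd (opposite centered (q, p - bottom K q)))"
proof (rule opposite_eqI[OF q p])
  interpret C: fiber_convex_centered "bottomed P K" centered by (rule fiber_convex_centered)
  have "q \<in> bottomed (bottomed P K) centered" "p - bottom K q \<noteq> bottom centered q"
    using q p by (auto simp: C.bottomed_eq C.bottom_eq_0)
  from C.opposite[OF this]
  show "snd (opposite centered (q, p - bottom K q)) > 0"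
    "fiber_grad K (q, bottom K q + fst (opposite centered (q, p - bottom K q))) =
      - snd (opposite centered (q, p - bottom K q)) *\<^sub>R fiber_grad K (q, p)"
    "K (q, bottom K q + fst (opposite centered (q, p - bottom K q))) = K (q, p)"
    by (simp_all add: fiber_grad_centered[OF q]) (simp_all add: centered_def)
qed

lemma bottom_centered: "q \<in> bottomed P K \<Longrightarrow> bottom centered q = 0"
  by (rule fiber_convex_centered.bottom_eq_0[OF fiber_convex_centered])

lemma reflection_centered:
  "q \<in> bottomed P K \<Longrightarrow> reflection K (q, p) = bottom K q + reflection centered (q, p - bottom K q)"
  by (simp add: reflection_def bottom_centered opposite_centered)

lemma reflection_factor_centered:
  "q \<in> bottomed P K \<Longrightarrow> reflection_factor K (q, p) = reflection_factor centered (q, p - bottom K q)"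
  by (simp add: reflection_factor_def bottom_centered opposite_centered)

lemma reflection_reflection: "q \<in> bottomed P K \<Longrightarrow> reflection K (q, reflection K (q, p)) = p"
  by (simp add: reflection_def opposite_ne_bottom opposite_opposite)

lemma smooth_reflection: "Ck_on k (reflection K) (off_bottom P K)"
  by (rule Ck_on_cong[OF open_off_bottom _ Ck_on_fst[OF open_off_bottom smooth_opposite]])
    (auto simp: reflection_def off_bottom_def)

lemma C1_reflection: "Ck_on (Suc 0) (reflection K) (bottomed P K \<times> UNIV)"
proof -
  interpret C: fiber_convex_centered "bottomed P K" centered by (rule fiber_convex_centered)
  note S = open_bottomed_UNIV
  have "Ck_on (Suc 0) (\<lambda>x. bottom K (fst x)) (bottomed P K \<times> (UNIV :: 'e set))"
    by (rule Ck_on_compose[OF S open_bottomed _ smooth_bottom Ck_on_fst[OF S Ck_on_ident[OF S]]]) auto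
  moreover have "Ck_on (Suc 0) (\<lambda>x. reflection centered (fst x, snd x - bottom K (fst x))) (bottomed P K \<times> UNIV)"
    by (rule Ck_on_compose[OF S S _ C.C1_reflection_centered smooth_shift(2)]) auto
  ultimately have "Ck_on (Suc 0) (\<lambda>x. bottom K (fst x) + reflection centered (fst x, snd x - bottom K (fst x)))
      (bottomed P K \<times> UNIV)"
    by (rule Ck_on_add[OF S])
  then show ?thesis
    by (rule Ck_on_cong[OF S, rotated]) (auto simp: reflection_centered)
qed

text \<open>With b the minimum at q, the reflection is b + R (q, p - b), and R has derivative (u, v)
  \<mapsto> - v at the zero section. Thus b enters twice with the same sign, which is the origin of
  the coefficient 2.\<close>

lemma reflection_has_derivative_bottom:
  assumes q: "q \<in> bottomed P K"
  shows "(reflection K has_derivative (\<lambda>(u, v). 2 *\<^sub>R frechet_derivative (bottom K) (at q) u - v)) (at (q, bottom K q))"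
proof -
  interpret C: fiber_convex_centered "bottomed P K" centered by (rule fiber_convex_centered)
  let ?D = "frechet_derivative (bottom K) (at q)"
  have b: "((\<lambda>x. bottom K (fst x)) has_derivative (\<lambda>w. ?D (fst w))) (at (q, bottom K q))"
    by (rule has_derivative_compose[OF has_derivative_fst[OF has_derivative_ident]])
      (use Ck_on_has_derivative[OF smooth_bottom q] in simp)
  have "((\<lambda>x. (fst x, snd x - bottom K (fst x))) has_derivative (\<lambda>w. (fst w, snd w - ?D (fst w)))) (at (q, bottom K q))"
    by (intro has_derivative_Pair has_derivative_fst has_derivative_snd has_derivative_diff has_derivative_ident b)
  from has_derivative_compose[OF this, of "reflection centered" "\<lambda>w. - snd w"]
  have "((\<lambda>x. reflection centered (fst x, snd x - bottom K (fst x))) has_derivative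
      (\<lambda>w. - (snd w - ?D (fst w)))) (at (q, bottom K q))"
    using C.reflection_has_derivative_0[OF q] by simp
  from has_derivative_add[OF b this]
  have "(reflection K has_derivative (\<lambda>w. ?D (fst w) + - (snd w - ?D (fst w)))) (at (q, bottom K q))"
    by (rule has_derivative_transform_within_open[OF _ open_bottomed_UNIV])
      (use q in \<open>auto simp: reflection_centered\<close>)
  moreover have "(\<lambda>w. ?D (fst w) + - (snd w - ?D (fst w))) = (\<lambda>(u, v). 2 *\<^sub>R ?D u - v)"
    by (auto simp: scaleR_2)
  ultimately show ?thesis by simp
qed

lemma lipschitz_reflection_factor:
  assumes x: "x \<in> bottomed P K \<times> UNIV"
  obtains r L where "r > 0" "ball x r \<subseteq> bottomed P K \<times> UNIV" "L-lipschitz_on (ball x r) (reflection_factor K)"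
proof -
  interpret C: fiber_convex_centered "bottomed P K" centered by (rule fiber_convex_centered)
  note S = open_bottomed_UNIV
  let ?\<psi> = "\<lambda>x. (fst x, snd x - bottom K (fst x))"
  obtain r1 L1 where 1: "r1 > 0" "ball x r1 \<subseteq> bottomed P K \<times> UNIV" "L1-lipschitz_on (ball x r1) ?\<psi>"
    using Ck_on_locally_lipschitz[OF S x smooth_shift(2)] by blast
  have "?\<psi> x \<in> bottomed P K \<times> UNIV" using x by auto
  then obtain r2 L2 where 2: "r2 > 0" "L2-lipschitz_on (ball (?\<psi> x) r2) (reflection_factor centered)"
    using C.lipschitz_reflection_factor_centered by blast
  \<comment> \<open>Adding 1 keeps the divisor positive even if L1 = 0; the shift then maps the ball
    of radius r into the one of radius r2.\<close>
  define r where "r = min r1 (r2 / (L1 + 1))"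
  have L1: "L1 \<ge> 0" using 1(3) by (rule lipschitz_on_nonneg)
  then have r: "r > 0" using 1 2 by (simp add: r_def)
  have r1: "ball x r \<subseteq> ball x r1" by (auto simp: r_def)
  have "?\<psi> ` ball x r \<subseteq> ball (?\<psi> x) r2"
  proof clarsimp
    fix y :: "'a" and z :: 'e assume yz: "dist x (y, z) < r"
    have "dist (?\<psi> x) (?\<psi> (y, z)) \<le> L1 * dist x (y, z)"
      using yz 1(1) r1 by (intro lipschitz_onD[OF 1(3)]) auto
    also have "\<dots> \<le> (L1 + 1) * dist x (y, z)" by (intro mult_right_mono) auto
    also have "\<dots> < (L1 + 1) * (r2 / (L1 + 1))" using yz L1 by (intro mult_strict_left_mono) (auto simp: r_def)
    also have "\<dots> = r2" using L1 by simp
    finally show "dist (fst x, snd x - bottom K (fst x)) (y, z - bottom K y) < r2" by simp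
  qed
  then have "(L2 * L1)-lipschitz_on (ball x r) (\<lambda>y. reflection_factor centered (?\<psi> y))"
    using lipschitz_on_compose2[OF lipschitz_on_subset[OF 1(3) r1] lipschitz_on_subset[OF 2(2)]] by blast
  moreover have "reflection_factor K y = reflection_factor centered (?\<psi> y)" if "y \<in> ball x r" for y
  proof -
    have "fst y \<in> bottomed P K" using that r1 1(2) by force
    then show ?thesis using reflection_factor_centered[of "fst y" "snd y"] by simp
  qed
  ultimately have "(L2 * L1)-lipschitz_on (ball x r) (reflection_factor K)"
    by (simp add: lipschitz_on_def)
  then show thesis using that[OF r] r1 1(2) by blast
qed

end

section \<open>Cotangent charts\<close>

locale smooth_atlas =
  fixes A :: "('m, 'e::euclidean_space) chart set"
  assumes smooth_manifold: "smooth_manifold A"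
begin

lemma inj_chart: "c \<in> A \<Longrightarrow> inj_on (snd c) (fst c)"
  and open_chart: "c \<in> A \<Longrightarrow> open (snd c ` fst c)"
  and open_overlap: "c \<in> A \<Longrightarrow> d \<in> A \<Longrightarrow> open (snd c ` (fst c \<inter> fst d))"
  and smooth_transition: "c \<in> A \<Longrightarrow> d \<in> A \<Longrightarrow> Ck_on k (snd d \<circ> chart_inv c) (snd c ` (fst c \<inter> fst d))"
  using smooth_manifold by (auto simp: smooth_manifold_def)

lemma chart_inv_chart [simp]: "c \<in> A \<Longrightarrow> q \<in> fst c \<Longrightarrow> chart_inv c (snd c q) = q"
  using inj_chart by (simp add: chart_inv_def)

definition transition_deriv :: "('m, 'e) chart \<Rightarrow> ('m, 'e) chart \<Rightarrow> 'm \<Rightarrow> 'e \<Rightarrow> 'e" where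
  "transition_deriv c d q = frechet_derivative (snd d \<circ> chart_inv c) (at (snd c q))"

lemma transition_has_derivative:
  assumes "c \<in> A" "d \<in> A" "q \<in> fst c" "q \<in> fst d"
  shows "((snd d \<circ> chart_inv c) has_derivative transition_deriv c d q) (at (snd c q))"
  unfolding transition_deriv_def
  by (rule Ck_on_has_derivative[OF smooth_transition[OF assms(1,2), of "Suc 0"]]) (use assms in auto)

lemma linear_transition_deriv:
  "c \<in> A \<Longrightarrow> d \<in> A \<Longrightarrow> q \<in> fst c \<Longrightarrow> q \<in> fst d \<Longrightarrow> linear (transition_deriv c d q)"
  using transition_has_derivative has_derivative_linear by blast

text \<open>The chain rule for transition maps; this cocycle property is what makes
  \<open>covector_of\<close> obey the transformation law of covectors.\<close>

lemma transition_deriv_comp: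
  assumes A: "c \<in> A" "d \<in> A" "e \<in> A" and q: "q \<in> fst c" "q \<in> fst d" "q \<in> fst e"
  shows "transition_deriv d e q (transition_deriv c d q v) = transition_deriv c e q v"
proof -
  have "(snd e \<circ> chart_inv d has_derivative transition_deriv d e q) (at ((snd d \<circ> chart_inv c) (snd c q)))"
    using transition_has_derivative[OF A(2,3) q(2,3)] A q by simp
  from has_derivative_compose[OF transition_has_derivative[OF A(1,2) q(1,2)] this]
  have 1: "((\<lambda>y. (snd e \<circ> chart_inv d) ((snd d \<circ> chart_inv c) y)) has_derivative
      (\<lambda>v. transition_deriv d e q (transition_deriv c d q v))) (at (snd c q))" .
  have "((snd e \<circ> chart_inv c) has_derivative
      (\<lambda>v. transition_deriv d e q (transition_deriv c d q v))) (at (snd c q))"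
    by (rule has_derivative_transform_within_open[OF 1 open_overlap[OF A(1,2)]]) (use A q in auto)
  from fun_cong[OF has_derivative_unique[OF this transition_has_derivative[OF A(1,3) q(1,3)]]]
  show ?thesis .
qed

lemma transition_deriv_self:
  assumes "c \<in> A" "q \<in> fst c"
  shows "transition_deriv c c q v = v"
proof -
  have "((snd c \<circ> chart_inv c) has_derivative (\<lambda>v. v)) (at (snd c q))"
    by (rule has_derivative_transform_within_open[OF has_derivative_ident open_chart[OF assms(1)]])
      (use assms in auto)
  from fun_cong[OF has_derivative_unique[OF transition_has_derivative[OF assms(1,1,2,2)] this]]
  show ?thesis .
qed

text \<open>The covector at q whose component in the chart c is w. The sum is the adjoint of the
  transition derivative applied to w, and the default 0 is the convention of
  \<open>cotangent_space\<close>.\<close>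

definition covector_of :: "('m, 'e) chart \<Rightarrow> 'm \<Rightarrow> 'e \<Rightarrow> ('m, 'e) covector" where
  "covector_of c q w = (\<lambda>d. if d \<in> A \<and> q \<in> fst d
     then (\<Sum>b\<in>Basis. (w \<bullet> transition_deriv d c q b) *\<^sub>R b) else 0)"

lemma covector_of_inner:
  assumes "c \<in> A" "q \<in> fst c" "d \<in> A" "q \<in> fst d"
  shows "covector_of c q w d \<bullet> v = w \<bullet> transition_deriv d c q v"
proof -
  have "w \<bullet> transition_deriv d c q v = (\<Sum>b\<in>Basis. (v \<bullet> b) * (w \<bullet> transition_deriv d c q b))"
    unfolding linear_eq_sum_Basis[OF linear_transition_deriv[OF assms(3,1,4,2)], of v] by (simp add: inner_sum_right)
  then show ?thesis using assms
    by (simp add: covector_of_def inner_sum_left inner_commute[of v] mult.commute)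
qed

lemma covector_of_component:
  assumes "c \<in> A" "q \<in> fst c"
  shows "covector_of c q w c = w"
  using covector_of_inner[OF assms assms] transition_deriv_self[OF assms] by (metis vector_eq_rdot)

lemma covector_of_cotangent:
  assumes "c \<in> A" "q \<in> fst c"
  shows "covector_of c q w \<in> cotangent_space A q"
  unfolding cotangent_space_def
proof (clarify, intro conjI ballI impI allI)
  fix d e v assume *: "d \<in> A" "e \<in> A" "q \<in> fst d" "q \<in> fst e"
  show "covector_of c q w d \<bullet> v =
      covector_of c q w e \<bullet> frechet_derivative (snd e \<circ> chart_inv d) (at (snd d q)) v"
    unfolding transition_deriv_def[symmetric]
    using * assms by (simp add: covector_of_inner transition_deriv_comp)
qed (auto simp: covector_of_def)

lemma covector_of_eq:
  assumes "c \<in> A" "q \<in> fst c" "p \<in> cotangent_space A q"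
  shows "covector_of c q (p c) = p"
proof
  fix d
  show "covector_of c q (p c) d = p d"
  proof (cases "d \<in> A \<and> q \<in> fst d")
    case True
    then have "p d \<bullet> v = p c \<bullet> transition_deriv d c q v" for v
      using assms unfolding cotangent_space_def transition_deriv_def by blast
    then have "covector_of c q (p c) d \<bullet> v = p d \<bullet> v" for v
      using True assms by (simp add: covector_of_inner)
    then show ?thesis by (metis vector_eq_rdot)
  next
    case False
    then have "p d = 0" using assms(3) unfolding cotangent_space_def by blast
    then show ?thesis using False by (auto simp: covector_of_def)
  qed
qed

lemma covector_eqI:
  assumes "c \<in> A" "q \<in> fst c" "p \<in> cotangent_space A q" "p' \<in> cotangent_space A q" "p c = p' c"
  shows "p = p'"
  using covector_of_eq assms by metis

lemma fiber_shift_cotangent: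
  assumes "p \<in> cotangent_space A q" "\<delta> \<in> cotangent_space A q"
  shows "fiber_shift p t \<delta> \<in> cotangent_space A q"
  unfolding cotangent_space_def
proof (clarify, intro conjI ballI impI allI)
  fix c d v assume "c \<in> A" "d \<in> A" "q \<in> fst c" "q \<in> fst d"
  then have "p c \<bullet> v = p d \<bullet> frechet_derivative (snd d \<circ> chart_inv c) (at (snd c q)) v"
    "\<delta> c \<bullet> v = \<delta> d \<bullet> frechet_derivative (snd d \<circ> chart_inv c) (at (snd c q)) v"
    using assms unfolding cotangent_space_def by blast+
  then show "fiber_shift p t \<delta> c \<bullet> v =
      fiber_shift p t \<delta> d \<bullet> frechet_derivative (snd d \<circ> chart_inv c) (at (snd c q)) v"
    by (simp only: fiber_shift_def inner_add_left inner_scaleR_left)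
next
  fix c assume "\<not> (c \<in> A \<and> q \<in> fst c)"
  then have "p c = 0" "\<delta> c = 0" using assms unfolding cotangent_space_def by blast+
  then show "fiber_shift p t \<delta> c = 0" by (simp add: fiber_shift_def)
qed

lemma cotangent_chart_apply [simp]: "snd (cotangent_chart A c) (q, p) = (snd c q, p c)"
  by (simp add: cotangent_chart_def)

lemma in_cotangent_chart [simp]:
  "(q, p) \<in> fst (cotangent_chart A c) \<longleftrightarrow> q \<in> fst c \<and> p \<in> cotangent_space A q"
  by (simp add: cotangent_chart_def cotangent_over_def)

lemma inj_cotangent_chart: "c \<in> A \<Longrightarrow> inj_on (snd (cotangent_chart A c)) (fst (cotangent_chart A c))"
proof (rule inj_onI, clarify)
  fix q p q' p'
  assume c: "c \<in> A" and *: "(q, p) \<in> fst (cotangent_chart A c)" "(q', p') \<in> fst (cotangent_chart A c)"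
    "snd (cotangent_chart A c) (q, p) = snd (cotangent_chart A c) (q', p')"
  then have "q = q'" using inj_onD[OF inj_chart[OF c], of q q'] by simp
  then show "q = q' \<and> p = p'" using * covector_eqI[OF c, of q p p'] by simp
qed

lemma chart_inv_cotangent_chart:
  "c \<in> A \<Longrightarrow> q \<in> fst c \<Longrightarrow> p \<in> cotangent_space A q \<Longrightarrow>
    chart_inv (cotangent_chart A c) (snd c q, p c) = (q, p)"
  using inv_into_f_f[OF inj_cotangent_chart, of c "(q, p)"] by (simp add: chart_inv_def)

lemma chart_inv_cotangent_chart_covector_of:
  "c \<in> A \<Longrightarrow> q \<in> fst c \<Longrightarrow> chart_inv (cotangent_chart A c) (snd c q, w) = (q, covector_of c q w)"
  using chart_inv_cotangent_chart[of c q "covector_of c q w"] covector_of_cotangent covector_of_component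
  by simp

lemma cotangent_chart_image:
  assumes c: "c \<in> A" and W: "W \<subseteq> cotangent_bundle A"
  shows "snd (cotangent_chart A c) ` (W \<inter> fst (cotangent_chart A c)) =
    {(snd c q, w) | q w. q \<in> fst c \<and> (q, covector_of c q w) \<in> W}" (is "?L = ?R")
proof
  show "?L \<subseteq> ?R"
  proof
    fix x assume "x \<in> ?L"
    then obtain y where y: "x = snd (cotangent_chart A c) y" "y \<in> W" "y \<in> fst (cotangent_chart A c)" by blast
    obtain q p where "y = (q, p)" by fastforce
    then show "x \<in> ?R" using y covector_of_eq[OF c, of q p] by (auto intro!: exI[of _ q])
  qed
  show "?R \<subseteq> ?L"
  proof clarify
    fix q w assume q: "q \<in> fst c" "(q, covector_of c q w) \<in> W"
    show "(snd c q, w) \<in> ?L"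
    proof (rule image_eqI)
      show "(snd c q, w) = snd (cotangent_chart A c) (q, covector_of c q w)"
        using covector_of_component[OF c q(1)] by simp
      show "(q, covector_of c q w) \<in> W \<inter> fst (cotangent_chart A c)"
        using q covector_of_cotangent[OF c q(1)] by simp
    qed
  qed
qed

text \<open>The change of cotangent coordinates from c to d: the transition map on the base and the
  inverse adjoint of its derivative on the fiber.\<close>

definition cotangent_transition :: "('m, 'e) chart \<Rightarrow> ('m, 'e) chart \<Rightarrow> 'e \<times> 'e \<Rightarrow> 'e \<times> 'e" where
  "cotangent_transition c d x = (snd d (chart_inv c (fst x)), covector_of c (chart_inv c (fst x)) (snd x) d)"

lemma smooth_cotangent_transition:
  assumes A: "c \<in> A" "d \<in> A"
  shows "Ck_on k (cotangent_transition c d) (snd c ` (fst c \<inter> fst d) \<times> UNIV)"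
proof -
  let ?S = "snd c ` (fst c \<inter> fst d) \<times> (UNIV :: 'e set)"
  let ?\<tau> = "\<lambda>x. (snd d \<circ> chart_inv c) (fst x)"
  have S: "open ?S" using open_overlap[OF A] by (intro open_Times) auto
  have \<tau>: "Ck_on k ?\<tau> ?S" for k
    by (rule Ck_on_compose[OF S open_overlap[OF A] _ smooth_transition[OF A] Ck_on_fst[OF S Ck_on_ident[OF S]]]) auto
  have "Ck_on k (\<lambda>x. frechet_derivative (snd c \<circ> chart_inv d) (at (?\<tau> x)) b) ?S" for b
    by (rule Ck_on_compose[OF S open_overlap[OF A(2,1)] _ Ck_on_frechet_derivative[OF smooth_transition[OF A(2,1)]] \<tau>])
      (use A in auto)
  then have "Ck_on k (\<lambda>x. (?\<tau> x, \<Sum>b\<in>Basis. (snd x \<bullet> frechet_derivative (snd c \<circ> chart_inv d) (at (?\<tau> x)) b) *\<^sub>R b)) ?S"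
    by (intro Ck_on_Pair \<tau> Ck_on_sum Ck_on_scaleR Ck_on_inner Ck_on_const Ck_on_snd Ck_on_ident S)
  then show ?thesis
    by (rule Ck_on_cong[OF S, rotated])
      (use A in \<open>auto simp: cotangent_transition_def covector_of_def transition_deriv_def\<close>)
qed

text \<open>It suffices to know the fiber part of F in one chart c, used for source and target
  alike: as F preserves fibers, any other target chart is reached by composing with the smooth
  \<open>cotangent_transition\<close>.\<close>

lemma Ck_map_cotangentI:
  assumes W: "W \<subseteq> cotangent_bundle A"
    and F: "\<And>x. x \<in> W \<Longrightarrow> F x \<in> cotangent_bundle A \<and> fst (F x) = fst x"
    and S: "\<And>c. c \<in> A \<Longrightarrow> S c = snd (cotangent_chart A c) ` (W \<inter> fst (cotangent_chart A c))"
    and open_S: "\<And>c. c \<in> A \<Longrightarrow> open (S c)"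
    and smooth_f: "\<And>c. c \<in> A \<Longrightarrow> Ck_on k (f c) (S c)"
    and Ff: "\<And>c q p. c \<in> A \<Longrightarrow> q \<in> fst c \<Longrightarrow> (q, p) \<in> W \<Longrightarrow> snd (F (q, p)) c = f c (snd c q, p c)"
  shows "Ck_map k (cotangent_atlas A) (cotangent_atlas A) W F"
proof -
  have carrier: "manifold_carrier (cotangent_atlas A) = cotangent_bundle A"
    by (auto simp: manifold_carrier_def cotangent_atlas_def cotangent_chart_def cotangent_over_def)
  have "open D \<and> Ck_on k (snd (cotangent_chart A d) \<circ> F \<circ> chart_inv (cotangent_chart A c)) D"
    if c: "c \<in> A" and d: "d \<in> A"
      and D: "D = snd (cotangent_chart A c) ` (W \<inter> fst (cotangent_chart A c) \<inter> F -` fst (cotangent_chart A d))"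
    for c d D
  proof -
    let ?T = "snd c ` (fst c \<inter> fst d) \<times> (UNIV :: 'e set)"
    have oT: "open ?T" using open_overlap[OF c d] by (intro open_Times) auto
    have inW: "p \<in> cotangent_space A q" if "(q, p) \<in> W" for q p
      using W that unfolding cotangent_over_def by blast
    have F_eq: "F (q, p) = (q, snd (F (q, p)))" if "(q, p) \<in> W" for q p
      using F[OF that] by (simp add: prod_eq_iff)
    have inF: "snd (F (q, p)) \<in> cotangent_space A q" if "(q, p) \<in> W" for q p
      using F[OF that] unfolding cotangent_over_def by auto
    \<comment> \<open>Because F keeps the base point, the condition on the image only asks that q
      lie in the domain of d.\<close>
    have D_iff: "(q, p) \<in> W \<inter> fst (cotangent_chart A c) \<inter> F -` fst (cotangent_chart A d) \<longleftrightarrow>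
        (q, p) \<in> W \<and> q \<in> fst c \<and> q \<in> fst d" for q p
    proof -
      have "F (q, p) \<in> fst (cotangent_chart A d) \<longleftrightarrow> q \<in> fst d" if "(q, p) \<in> W"
        using in_cotangent_chart[of q "snd (F (q, p))" d] inF[OF that] unfolding F_eq[OF that, symmetric] by simp
      then show ?thesis using inW[of q p] by auto
    qed
    have "x \<in> D \<longleftrightarrow> x \<in> S c \<inter> ?T" for x
    proof
      assume "x \<in> D"
      then obtain q p where x: "x = (snd c q, p c)" "(q, p) \<in> W \<and> q \<in> fst c \<and> q \<in> fst d"
        unfolding D D_iff[symmetric] by force
      then have "x \<in> S c"
        using inW unfolding S[OF c] by (intro image_eqI[of _ _ "(q, p)"]) auto
      then show "x \<in> S c \<inter> ?T" using x by auto
    next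
      assume x: "x \<in> S c \<inter> ?T"
      then obtain q p where q: "x = (snd c q, p c)" "q \<in> fst c" "(q, p) \<in> W"
        unfolding S[OF c] by force
      moreover have "q \<in> fst d"
        using x q inj_onD[OF inj_chart[OF c]] by auto
      ultimately have "(q, p) \<in> W \<inter> fst (cotangent_chart A c) \<inter> F -` fst (cotangent_chart A d)"
        unfolding D_iff by blast
      then show "x \<in> D" unfolding D using q(1) by (intro image_eqI[of _ _ "(q, p)"]) auto
    qed
    then have D_eq: "D = S c \<inter> ?T" by blast
    have oD: "open D" unfolding D_eq using open_S[OF c] oT by (rule open_Int)
    have "Ck_on k (\<lambda>x. cotangent_transition c d (fst x, f c x)) D"
    proof (rule Ck_on_compose[OF oD oT _ smooth_cotangent_transition[OF c d]])
      show "Ck_on k (\<lambda>x. (fst x, f c x)) D"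
        using Ck_on_subset[OF smooth_f[OF c]] by (intro Ck_on_Pair Ck_on_fst Ck_on_ident oD) (auto simp: D_eq)
    qed (auto simp: D_eq)
    then have "Ck_on k (snd (cotangent_chart A d) \<circ> F \<circ> chart_inv (cotangent_chart A c)) D"
    proof (rule Ck_on_cong[OF oD, rotated])
      fix x assume "x \<in> D"
      then obtain q p where x: "x = (snd c q, p c)" "q \<in> fst c" "(q, p) \<in> W"
        unfolding D by force
      have "F (chart_inv (cotangent_chart A c) x) = F (q, p)"
        using x c inW by (simp add: chart_inv_cotangent_chart)
      then have "(snd (cotangent_chart A d) \<circ> F \<circ> chart_inv (cotangent_chart A c)) x = (snd d q, snd (F (q, p)) d)"
        using cotangent_chart_apply[of d q "snd (F (q, p))"] F_eq[OF x(3)] by simp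
      moreover have "covector_of c q (f c x) = snd (F (q, p))"
        using covector_of_eq[OF c x(2) inF[OF x(3)]] Ff[OF c x(2,3)] x(1) by simp
      ultimately show "cotangent_transition c d (fst x, f c x) =
          (snd (cotangent_chart A d) \<circ> F \<circ> chart_inv (cotangent_chart A c)) x"
        using x c by (simp add: cotangent_transition_def)
    qed
    with oD show ?thesis by blast
  qed
  then show ?thesis
    using W F unfolding Ck_map_def Let_def carrier by (auto simp: cotangent_atlas_def)
qed

end

section \<open>Hamiltonians on manifolds\<close>

locale convex_hamiltonian_on_atlas = smooth_atlas A for A :: "('m, 'e::euclidean_space) chart set" +
  fixes H :: "'m \<times> ('m, 'e) covector \<Rightarrow> real"
  assumes smooth_H: "smooth_map (cotangent_atlas A) euclidean_atlas (cotangent_bundle A) H"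
    and convex_H: "convex_hamiltonian A H"
begin

section \<open>The Hamiltonian and its intrinsic data in a chart\<close>

definition local_H :: "('m, 'e) chart \<Rightarrow> 'e \<times> 'e \<Rightarrow> real" where
  "local_H c = H \<circ> chart_inv (cotangent_chart A c)"

abbreviation coords :: "('m, 'e) chart \<Rightarrow> 'e set" where
  "coords c \<equiv> snd c ` fst c"

lemma local_H: "c \<in> A \<Longrightarrow> q \<in> fst c \<Longrightarrow> p \<in> cotangent_space A q \<Longrightarrow> local_H c (snd c q, p c) = H (q, p)"
  by (simp add: local_H_def chart_inv_cotangent_chart)

lemma cotangent_chart_image_eqI:
  assumes c: "c \<in> A" and W: "W \<subseteq> cotangent_bundle A" and T: "T \<subseteq> coords c \<times> UNIV"
    and iff: "\<And>q w. q \<in> fst c \<Longrightarrow> (q, covector_of c q w) \<in> W \<longleftrightarrow> (snd c q, w) \<in> T"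
  shows "snd (cotangent_chart A c) ` (W \<inter> fst (cotangent_chart A c)) = T"
  unfolding cotangent_chart_image[OF c W]
proof
  show "{(snd c q, w) |q w. q \<in> fst c \<and> (q, covector_of c q w) \<in> W} \<subseteq> T" using iff by blast
  show "T \<subseteq> {(snd c q, w) |q w. q \<in> fst c \<and> (q, covector_of c q w) \<in> W}"
  proof
    fix x assume x: "x \<in> T"
    then obtain q w where "x = (snd c q, w)" "q \<in> fst c" using T by blast
    then show "x \<in> {(snd c q, w) |q w. q \<in> fst c \<and> (q, covector_of c q w) \<in> W}" using iff x by blast
  qed
qed

lemma fiber_smooth_local_H:
  assumes c: "c \<in> A"
  shows "fiber_smooth (coords c) (local_H c)"
proof
  show "open (coords c)" using open_chart[OF c] .
  fix k
  have "snd (cotangent_chart A c) ` (cotangent_bundle A \<inter> fst (cotangent_chart A c)) = coords c \<times> UNIV"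
    using c covector_of_cotangent[OF c]
    by (intro cotangent_chart_image_eqI) (auto simp: cotangent_over_def manifold_carrier_def)
  moreover have "Ck_map k (cotangent_atlas A) euclidean_atlas (cotangent_bundle A) H"
    using smooth_H by (simp add: smooth_map_def)
  ultimately show "Ck_on k (local_H c) (coords c \<times> UNIV)"
    using c by (simp add: Ck_map_def Let_def euclidean_atlas_def cotangent_atlas_def local_H_def comp_assoc) metis
qed

lemma fiber_deriv_eq:
  assumes c: "c \<in> A" "q \<in> fst c" and p: "p \<in> cotangent_space A q" "\<delta> \<in> cotangent_space A q"
  shows "fiber_deriv H (q, p) \<delta> = fiber_grad (local_H c) (snd c q, p c) \<bullet> \<delta> c"
proof -
  interpret L: fiber_smooth "coords c" "local_H c" by (rule fiber_smooth_local_H[OF c(1)])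
  have "((\<lambda>t. p c + t *\<^sub>R \<delta> c) has_derivative (\<lambda>t. t *\<^sub>R \<delta> c)) (at 0)"
    by (auto intro!: derivative_eq_intros)
  from has_derivative_compose[OF this L.K_fiber_derivative[of "snd c q"]] c
  have "((\<lambda>t. local_H c (snd c q, p c + t *\<^sub>R \<delta> c)) has_derivative
      (\<lambda>t. fiber_grad (local_H c) (snd c q, p c) \<bullet> (t *\<^sub>R \<delta> c))) (at 0)" by simp
  then have "DERIV (\<lambda>t. local_H c (snd c q, p c + t *\<^sub>R \<delta> c)) 0 :> fiber_grad (local_H c) (snd c q, p c) \<bullet> \<delta> c"
    unfolding has_field_derivative_def by (simp add: mult_commute_abs)
  moreover have "local_H c (snd c q, p c + t *\<^sub>R \<delta> c) = H (q, fiber_shift p t \<delta>)" for t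
    using local_H[OF c fiber_shift_cotangent[OF p]] by (simp add: fiber_shift_def)
  ultimately show ?thesis by (simp add: fiber_deriv_def DERIV_imp_deriv)
qed

lemma fiber_hessian_eq:
  assumes c: "c \<in> A" "q \<in> fst c" and p: "p \<in> cotangent_space A q" "\<delta> \<in> cotangent_space A q"
  shows "fiber_hessian H (q, p) \<delta> \<delta> =
    frechet_derivative (fiber_grad (local_H c)) (at (snd c q, p c)) (0, \<delta> c) \<bullet> \<delta> c" (is "_ = ?h")
proof -
  interpret L: fiber_smooth "coords c" "local_H c" by (rule fiber_smooth_local_H[OF c(1)])
  let ?D = "frechet_derivative (fiber_grad (local_H c)) (at (snd c q, p c))"
  have q: "snd c q \<in> coords c" using c by simp
  have lin: "linear (\<lambda>v. ?D (0, v))"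
    by (rule has_derivative_linear[OF has_derivative_partial_snd[OF L.has_derivative_grad[OF q]]])
  have "((\<lambda>t. p c + t *\<^sub>R \<delta> c) has_derivative (\<lambda>t. t *\<^sub>R \<delta> c)) (at 0)"
    by (auto intro!: derivative_eq_intros)
  moreover have "((\<lambda>p. fiber_grad (local_H c) (snd c q, p)) has_derivative (\<lambda>v. ?D (0, v))) (at (p c + 0 *\<^sub>R \<delta> c))"
    using has_derivative_partial_snd[OF L.has_derivative_grad[OF q]] by simp
  ultimately have "((\<lambda>t. fiber_grad (local_H c) (snd c q, p c + t *\<^sub>R \<delta> c)) has_derivative
      (\<lambda>t. ?D (0, t *\<^sub>R \<delta> c))) (at 0)"
    by (rule has_derivative_compose)
  from has_derivative_inner_left[OF this, of "\<delta> c"]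
  have "((\<lambda>t. fiber_grad (local_H c) (snd c q, p c + t *\<^sub>R \<delta> c) \<bullet> \<delta> c) has_derivative (\<lambda>t. t * ?h)) (at 0)"
    unfolding linear_cmul[OF lin] by simp
  then have "DERIV (\<lambda>t. fiber_grad (local_H c) (snd c q, p c + t *\<^sub>R \<delta> c) \<bullet> \<delta> c) 0 :> ?h"
    unfolding has_field_derivative_def by (simp add: mult_commute_abs)
  moreover have "fiber_grad (local_H c) (snd c q, p c + t *\<^sub>R \<delta> c) \<bullet> \<delta> c = fiber_deriv H (q, fiber_shift p t \<delta>) \<delta>" for t
    using fiber_deriv_eq[OF c fiber_shift_cotangent[OF p] p(2)] by (simp add: fiber_shift_def)
  ultimately show ?thesis by (simp add: fiber_hessian_def DERIV_imp_deriv)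
qed

text \<open>Every coordinate vector is the component of some covector, by
  \<open>covector_of\<close>, so positivity of the intrinsic Hessian reaches all directions of the
  coordinate space.\<close>

lemma fiber_convex_local_H:
  assumes c: "c \<in> A"
  shows "fiber_convex (coords c) (local_H c)"
proof -
  interpret L: fiber_smooth "coords c" "local_H c" by (rule fiber_smooth_local_H[OF c])
  show ?thesis
  proof
    fix y p v :: 'e assume "y \<in> coords c" and v: "v \<noteq> 0"
    then obtain q where q: "q \<in> fst c" "y = snd c q" by blast
    let ?l = "covector_of c q"
    have l: "?l w \<in> cotangent_space A q" "?l w c = w" for w
      using covector_of_cotangent[OF c q(1)] covector_of_component[OF c q(1)] by auto
    have "?l v \<noteq> (\<lambda>_. 0)" using l(2)[of v] v by auto
    then have "fiber_hessian H (q, ?l p) (?l v) (?l v) > 0"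
      using convex_H l c q by (auto simp: convex_hamiltonian_def cotangent_over_def manifold_carrier_def)
    then show "0 < frechet_derivative (fiber_grad (local_H c)) (at (y, p)) (0, v) \<bullet> v"
      using fiber_hessian_eq[OF c q(1) l(1) l(1)] l(2) q(2) by simp
  qed
qed

lemma fiber_deriv_proportional_iff:
  assumes c: "c \<in> A" "q \<in> fst c" and p: "p \<in> cotangent_space A q" "p' \<in> cotangent_space A q"
  shows "(\<forall>\<delta> \<in> cotangent_space A q. fiber_deriv H (q, p') \<delta> = s * fiber_deriv H (q, p) \<delta>) \<longleftrightarrow>
    fiber_grad (local_H c) (snd c q, p' c) = s *\<^sub>R fiber_grad (local_H c) (snd c q, p c)" (is "?L \<longleftrightarrow> ?R")
proof
  assume L: ?L
  have "fiber_grad (local_H c) (snd c q, p' c) \<bullet> v = (s *\<^sub>R fiber_grad (local_H c) (snd c q, p c)) \<bullet> v" for v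
    using L[rule_format, OF covector_of_cotangent[OF c, of v]]
      fiber_deriv_eq[OF c p(1) covector_of_cotangent[OF c, of v]]
      fiber_deriv_eq[OF c p(2) covector_of_cotangent[OF c, of v]]
    by (simp add: covector_of_component[OF c])
  then show ?R by (metis vector_eq_rdot)
qed (simp add: fiber_deriv_eq[OF c] p)

text \<open>\<open>covector_of\<close> turns the minimum over covectors into one over coordinate
  vectors, where convexity identifies minima with critical points.\<close>

lemma minimizer_iff:
  assumes c: "c \<in> A" "q \<in> fst c" and p: "p \<in> cotangent_space A q"
  shows "(\<forall>p' \<in> cotangent_space A q. H (q, p) \<le> H (q, p')) \<longleftrightarrow> fiber_grad (local_H c) (snd c q, p c) = 0"
proof -
  interpret L: fiber_convex "coords c" "local_H c" by (rule fiber_convex_local_H[OF c(1)])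
  interpret F: strictly_convex_function "\<lambda>p. local_H c (snd c q, p)" "\<lambda>p. fiber_grad (local_H c) (snd c q, p)"
    using L.fiber c by blast
  have "(\<forall>p' \<in> cotangent_space A q. H (q, p) \<le> H (q, p')) \<longleftrightarrow>
      (\<forall>w. local_H c (snd c q, p c) \<le> local_H c (snd c q, w))"
    using local_H[OF c] p covector_of_cotangent[OF c] covector_of_component[OF c] by metis
  then show ?thesis using F.minimum_critical[of "p c"] F.critical_le[of "p c"] by blast
qed

lemma breve_iff:
  assumes c: "c \<in> A" "q \<in> fst c"
  shows "q \<in> breve A H \<longleftrightarrow> snd c q \<in> bottomed (coords c) (local_H c)"
proof -
  have "q \<in> manifold_carrier A" using c by (auto simp: manifold_carrier_def)
  then have "q \<in> breve A H \<longleftrightarrow> (\<exists>p\<in>cotangent_space A q. fiber_grad (local_H c) (snd c q, p c) = 0)"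
    unfolding breve_def using minimizer_iff[OF c] by blast
  also have "\<dots> \<longleftrightarrow> (\<exists>w. fiber_grad (local_H c) (snd c q, w) = 0)"
    using covector_of_cotangent[OF c] covector_of_component[OF c] by metis
  also have "\<dots> \<longleftrightarrow> snd c q \<in> bottomed (coords c) (local_H c)" using c by (simp add: bottomed_def)
  finally show ?thesis .
qed

lemma wp:
  assumes c: "c \<in> A" "q \<in> fst c" and q: "q \<in> breve A H"
  shows "wp A H q \<in> cotangent_space A q" "wp A H q c = bottom (local_H c) (snd c q)"
proof -
  interpret L: fiber_convex "coords c" "local_H c" by (rule fiber_convex_local_H[OF c(1)])
  have b: "snd c q \<in> bottomed (coords c) (local_H c)" using breve_iff[OF c] q by simp
  let ?p = "covector_of c q (bottom (local_H c) (snd c q))"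
  have p: "?p \<in> cotangent_space A q" "?p c = bottom (local_H c) (snd c q)"
    using covector_of_cotangent[OF c] covector_of_component[OF c] by auto
  have "wp A H q = ?p"
    unfolding wp_def
  proof (rule the_equality)
    show "?p \<in> cotangent_space A q \<and> (\<forall>p'\<in>cotangent_space A q. H (q, ?p) \<le> H (q, p'))"
      using minimizer_iff[OF c p(1)] p L.grad_bottom[OF b] by simp
    show "p' = ?p" if "p' \<in> cotangent_space A q \<and> (\<forall>p''\<in>cotangent_space A q. H (q, p') \<le> H (q, p''))" for p'
      using that minimizer_iff[OF c, of p'] L.grad_eq_0_iff[OF b] p
      by (intro covector_eqI[OF c]) auto
  qed
  then show "wp A H q \<in> cotangent_space A q" "wp A H q c = bottom (local_H c) (snd c q)" using p by simp_all
qed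

lemma wp_graph_iff:
  assumes c: "c \<in> A" "q \<in> fst c" and q: "q \<in> breve A H" and p: "p \<in> cotangent_space A q"
  shows "(q, p) \<in> wp_graph A H \<longleftrightarrow> p c = bottom (local_H c) (snd c q)"
proof -
  have "(q, p) \<in> wp_graph A H \<longleftrightarrow> p = wp A H q" using q by (auto simp: wp_graph_def)
  also have "\<dots> \<longleftrightarrow> p c = wp A H q c" using covector_eqI[OF c p wp(1)[OF c q]] by blast
  finally show ?thesis using wp(2)[OF c q] by simp
qed

text \<open>The factor in \<open>level_involution\<close> has no prescribed sign. A nonnegative one
  would force the point to be p itself, so it is negative and the point solves the signed equation
  that defines \<open>opposite\<close>.\<close>

lemma level_involution_eq:
  assumes c: "c \<in> A" "q \<in> fst c" and q: "q \<in> breve A H"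
    and p: "p \<in> cotangent_space A q" "(q, p) \<notin> wp_graph A H"
  shows "level_involution A H (q, p) = (q, covector_of c q (fst (opposite (local_H c) (snd c q, p c))))"
proof -
  interpret L: fiber_convex "coords c" "local_H c" by (rule fiber_convex_local_H[OF c(1)])
  have b: "snd c q \<in> bottomed (coords c) (local_H c)" using breve_iff[OF c] q by simp
  interpret F: strictly_convex_function "\<lambda>p. local_H c (snd c q, p)" "\<lambda>p. fiber_grad (local_H c) (snd c q, p)"
    using L.fiber c by blast
  have ne: "p c \<noteq> bottom (local_H c) (snd c q)" using wp_graph_iff[OF c q p(1)] p(2) by simp
  note opp = L.opposite[OF b ne]
  let ?w = "fst (opposite (local_H c) (snd c q, p c))"
  let ?p = "covector_of c q ?w"
  have p': "?p \<in> cotangent_space A q" "?p c = ?w"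
    using covector_of_cotangent[OF c] covector_of_component[OF c] by auto
  have "(THE p'. p' \<in> cotangent_space A q \<and> p' \<noteq> p \<and>
     (\<exists>s. \<forall>\<delta> \<in> cotangent_space A q. fiber_deriv H (q, p') \<delta> = s * fiber_deriv H (q, p) \<delta>) \<and>
     H (q, p') = H (q, p)) = ?p"
  proof (rule the_equality)
    \<comment> \<open>Otherwise the gradient would be a negative multiple of itself, hence zero, at
      a point that is not the minimum.\<close>
    have "?w \<noteq> p c"
    proof
      assume "?w = p c"
      then have "(1 + snd (opposite (local_H c) (snd c q, p c))) *\<^sub>R fiber_grad (local_H c) (snd c q, p c) = 0"
        using opp(2) by (simp add: scaleR_add_left eq_neg_iff_add_eq_0)
      then show False using opp(1) L.grad_eq_0_iff[OF b] ne by simp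
    qed
    then have "?p \<noteq> p" using p'(2) by auto
    moreover have "H (q, ?p) = H (q, p)"
      using local_H[OF c p'(1)] local_H[OF c p(1)] opp(3) p'(2) by simp
    moreover have "\<forall>\<delta> \<in> cotangent_space A q. fiber_deriv H (q, ?p) \<delta> =
        - snd (opposite (local_H c) (snd c q, p c)) * fiber_deriv H (q, p) \<delta>"
      unfolding fiber_deriv_proportional_iff[OF c p(1) p'(1)] p'(2) by (rule opp(2))
    ultimately show "?p \<in> cotangent_space A q \<and> ?p \<noteq> p \<and>
       (\<exists>s. \<forall>\<delta> \<in> cotangent_space A q. fiber_deriv H (q, ?p) \<delta> = s * fiber_deriv H (q, p) \<delta>) \<and>
       H (q, ?p) = H (q, p)" using p'(1) by blast
  next
    fix p' assume *: "p' \<in> cotangent_space A q \<and> p' \<noteq> p \<and>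
       (\<exists>s. \<forall>\<delta> \<in> cotangent_space A q. fiber_deriv H (q, p') \<delta> = s * fiber_deriv H (q, p) \<delta>) \<and>
       H (q, p') = H (q, p)"
    then have pq: "p' \<in> cotangent_space A q" by blast
    obtain s where s: "fiber_grad (local_H c) (snd c q, p' c) = s *\<^sub>R fiber_grad (local_H c) (snd c q, p c)"
      using * fiber_deriv_proportional_iff[OF c p(1) pq] by blast
    have level: "local_H c (snd c q, p' c) = local_H c (snd c q, p c)"
      using local_H[OF c pq] local_H[OF c p(1)] * by simp
    have "p' c \<noteq> p c" using covector_eqI[OF c pq p(1)] * by blast
    then have "s < 0" using F.same_level_same_direction[OF s _ level] by force
    then have "opposite (local_H c) (snd c q, p c) = (p' c, - s)"
      using s level by (intro L.opposite_eqI[OF b ne]) auto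
    then have "?p c = p' c" using p'(2) by simp
    then show "p' = ?p" using covector_eqI[OF c pq p'(1)] by simp
  qed
  then show ?thesis by (simp add: level_involution_def)
qed

text \<open>Off the graph the gradient is nonzero, so the proportionality already determines the
  coefficient.\<close>

lemma varsig_eq:
  assumes c: "c \<in> A" "q \<in> fst c" and q: "q \<in> breve A H"
    and p: "p \<in> cotangent_space A q" "(q, p) \<notin> wp_graph A H"
  shows "varsig A H (q, p) = snd (opposite (local_H c) (snd c q, p c))"
proof -
  interpret L: fiber_convex "coords c" "local_H c" by (rule fiber_convex_local_H[OF c(1)])
  have b: "snd c q \<in> bottomed (coords c) (local_H c)" using breve_iff[OF c] q by simp
  have ne: "p c \<noteq> bottom (local_H c) (snd c q)" using wp_graph_iff[OF c q p(1)] p(2) by simp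
  note opp = L.opposite[OF b ne]
  let ?p = "covector_of c q (fst (opposite (local_H c) (snd c q, p c)))"
  have p': "?p \<in> cotangent_space A q" "?p c = fst (opposite (local_H c) (snd c q, p c))"
    using covector_of_cotangent[OF c] covector_of_component[OF c] by auto
  have proportional: "(\<forall>\<delta> \<in> cotangent_space A q. fiber_deriv H (q, ?p) \<delta> = - s * fiber_deriv H (q, p) \<delta>) \<longleftrightarrow>
      s = snd (opposite (local_H c) (snd c q, p c))" for s
    unfolding fiber_deriv_proportional_iff[OF c p(1) p'(1)] p'(2) opp(2)
    using L.grad_eq_0_iff[OF b] ne by auto
  show ?thesis
    unfolding varsig_def level_involution_eq[OF c q p] fst_conv proportional using opp(1) by (intro the_equality) auto
qed

section \<open>The extended involution and factor on the cotangent bundle\<close>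

definition involution :: "'m \<times> ('m, 'e) covector \<Rightarrow> 'm \<times> ('m, 'e) covector" where
  "involution x = (if x \<in> wp_graph A H then x else level_involution A H x)"

definition factor :: "'m \<times> ('m, 'e) covector \<Rightarrow> real" where
  "factor x = (if x \<in> wp_graph A H then 1 else varsig A H x)"

text \<open>\<open>involution\<close> is defined without charts, so this formula in each chart
  transports the local theorems with no gluing.\<close>

lemma involution_eq:
  assumes c: "c \<in> A" "q \<in> fst c" and q: "q \<in> breve A H" and p: "p \<in> cotangent_space A q"
  shows "involution (q, p) = (q, covector_of c q (reflection (local_H c) (snd c q, p c)))"
  using wp_graph_iff[OF c q p] level_involution_eq[OF c q p] covector_of_eq[OF c p]
  by (auto simp: involution_def reflection_def)

lemma factor_eq:
  assumes c: "c \<in> A" "q \<in> fst c" and q: "q \<in> breve A H" and p: "p \<in> cotangent_space A q"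
  shows "factor (q, p) = reflection_factor (local_H c) (snd c q, p c)"
  using wp_graph_iff[OF c q p] varsig_eq[OF c q p] by (simp add: factor_def reflection_factor_def)

lemma chart_at:
  assumes "x \<in> cotangent_over A (breve A H)"
  obtains c q p where "x = (q, p)" "c \<in> A" "q \<in> fst c" "q \<in> breve A H" "p \<in> cotangent_space A q"
proof -
  obtain q p where "x = (q, p)" "q \<in> breve A H" "p \<in> cotangent_space A q"
    using assms by (auto simp: cotangent_over_def)
  moreover from this obtain c where "c \<in> A" "q \<in> fst c"
    unfolding breve_def manifold_carrier_def by blast
  ultimately show thesis using that by blast
qed

lemma over_breve_subset: "cotangent_over A (breve A H) \<subseteq> cotangent_bundle A"
  by (auto simp: cotangent_over_def breve_def)

lemma over_breve_image:
  assumes c: "c \<in> A"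
  shows "snd (cotangent_chart A c) ` (cotangent_over A (breve A H) \<inter> fst (cotangent_chart A c)) =
    bottomed (coords c) (local_H c) \<times> UNIV"
proof (rule cotangent_chart_image_eqI[OF c over_breve_subset])
  show "(q, covector_of c q w) \<in> cotangent_over A (breve A H) \<longleftrightarrow>
      (snd c q, w) \<in> bottomed (coords c) (local_H c) \<times> UNIV" if "q \<in> fst c" for q w
    using breve_iff[OF c that] covector_of_cotangent[OF c that] by (simp add: cotangent_over_def)
qed (auto simp: bottomed_def)

lemma off_graph_image:
  assumes c: "c \<in> A"
  shows "snd (cotangent_chart A c) ` ((cotangent_over A (breve A H) - wp_graph A H) \<inter> fst (cotangent_chart A c)) =
    off_bottom (coords c) (local_H c)"
proof (rule cotangent_chart_image_eqI[OF c])
  show "cotangent_over A (breve A H) - wp_graph A H \<subseteq> cotangent_bundle A" using over_breve_subset by blast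
  show "off_bottom (coords c) (local_H c) \<subseteq> coords c \<times> UNIV" by (auto simp: off_bottom_def bottomed_def)
  show "(q, covector_of c q w) \<in> cotangent_over A (breve A H) - wp_graph A H \<longleftrightarrow>
      (snd c q, w) \<in> off_bottom (coords c) (local_H c)" if q: "q \<in> fst c" for q w
    using breve_iff[OF c q] wp_graph_iff[OF c q _ covector_of_cotangent[OF c q], of w]
      covector_of_cotangent[OF c q, of w] covector_of_component[OF c q, of w]
    by (auto simp: cotangent_over_def off_bottom_def)
qed

lemma involution_in:
  assumes "x \<in> cotangent_over A (breve A H)"
  shows "involution x \<in> cotangent_over A (breve A H)" "fst (involution x) = fst x" "involution (involution x) = x"
proof -
  obtain c q p where x: "x = (q, p)" "c \<in> A" "q \<in> fst c" "q \<in> breve A H" "p \<in> cotangent_space A q"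
    using chart_at[OF assms] by blast
  interpret L: fiber_convex "coords c" "local_H c" by (rule fiber_convex_local_H[OF x(2)])
  have b: "snd c q \<in> bottomed (coords c) (local_H c)" using breve_iff[OF x(2,3)] x(4) by simp
  note l = covector_of_cotangent[OF x(2,3)] covector_of_component[OF x(2,3)]
  note i = involution_eq[OF x(2-4)]
  show "fst (involution x) = fst x" "involution x \<in> cotangent_over A (breve A H)"
    using i[OF x(5)] x l by (auto simp: cotangent_over_def)
  show "involution (involution x) = x"
    using i[OF x(5)] i[OF l(1)] l(2) L.reflection_reflection[OF b] covector_of_eq[OF x(2,3,5)] x(1) by simp
qed

lemma bij_involution: "bij_betw involution (cotangent_over A (breve A H)) (cotangent_over A (breve A H))"
  by (rule bij_betw_byWitness[where f' = involution]) (auto simp: involution_in)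

lemma inv_involution:
  assumes "x \<in> cotangent_over A (breve A H)"
  shows "inv_into (cotangent_over A (breve A H)) involution x = involution x"
  using inv_into_f_f[OF bij_betw_imp_inj_on[OF bij_involution] involution_in(1)[OF assms]] involution_in(3)[OF assms]
  by simp

text \<open>F need only agree with \<open>involution\<close> on W, which covers
  \<open>involution\<close> itself, its inverse given by \<open>inv_into\<close>, and
  \<open>level_involution\<close> off the graph.\<close>

lemma Ck_map_like_involution:
  assumes W: "W \<subseteq> cotangent_over A (breve A H)"
    and S: "\<And>c. c \<in> A \<Longrightarrow> S c = snd (cotangent_chart A c) ` (W \<inter> fst (cotangent_chart A c))"
    and open_S: "\<And>c. c \<in> A \<Longrightarrow> open (S c)"
    and smooth: "\<And>c. c \<in> A \<Longrightarrow> Ck_on k (reflection (local_H c)) (S c)"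
    and F: "\<And>x. x \<in> W \<Longrightarrow> F x = involution x"
  shows "Ck_map k (cotangent_atlas A) (cotangent_atlas A) W F"
proof (rule Ck_map_cotangentI[OF _ _ S open_S smooth])
  show "W \<subseteq> cotangent_bundle A" using W over_breve_subset by blast
  show "F x \<in> cotangent_bundle A \<and> fst (F x) = fst x" if "x \<in> W" for x
    using involution_in[of x] W F[OF that] that over_breve_subset by auto
  fix c q p assume c: "c \<in> A" "q \<in> fst c" and x: "(q, p) \<in> W"
  then have "q \<in> breve A H" "p \<in> cotangent_space A q" using W by (auto simp: cotangent_over_def)
  then show "snd (F (q, p)) c = reflection (local_H c) (snd c q, p c)"
    using involution_eq[OF c] F[OF x] covector_of_component[OF c] by simp
qed

lemma C1_diffeo_involution: "Ck_diffeo_of 1 (cotangent_atlas A) (cotangent_over A (breve A H)) involution"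
proof -
  have "Ck_map 1 (cotangent_atlas A) (cotangent_atlas A) (cotangent_over A (breve A H)) F"
    if "\<And>x. x \<in> cotangent_over A (breve A H) \<Longrightarrow> F x = involution x" for F
    using that fiber_convex.open_bottomed_UNIV[OF fiber_convex_local_H]
      fiber_convex.C1_reflection[OF fiber_convex_local_H]
    by (intro Ck_map_like_involution[OF order_refl over_breve_image[symmetric]]) auto
  then show ?thesis
    unfolding Ck_diffeo_of_def using bij_involution inv_involution by blast
qed

lemma smooth_involution:
  "smooth_map (cotangent_atlas A) (cotangent_atlas A) (cotangent_over A (breve A H) - wp_graph A H)
     (level_involution A H)"
  unfolding smooth_map_def
  using fiber_convex.open_off_bottom[OF fiber_convex_local_H] fiber_convex.smooth_reflection[OF fiber_convex_local_H]
  by (intro allI Ck_map_like_involution[OF _ off_graph_image[symmetric]]) (auto simp: involution_def)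

lemma locally_lipschitz_factor:
  "locally_lipschitz_fun (cotangent_atlas A) (cotangent_over A (breve A H)) factor"
  unfolding locally_lipschitz_fun_def cotangent_atlas_def
proof (intro ballI, elim imageE[of _ "cotangent_chart A"], hypsubst)
  fix c x assume c: "c \<in> A"
    and x: "x \<in> snd (cotangent_chart A c) ` (cotangent_over A (breve A H) \<inter> fst (cotangent_chart A c))"
  interpret L: fiber_convex "coords c" "local_H c" by (rule fiber_convex_local_H[OF c])
  let ?S = "bottomed (coords c) (local_H c) \<times> UNIV"
  obtain r L where rL: "r > 0" "ball x r \<subseteq> ?S" "L-lipschitz_on (ball x r) (reflection_factor (local_H c))"
    using L.lipschitz_reflection_factor x unfolding over_breve_image[OF c] by blast
  have "(factor \<circ> chart_inv (cotangent_chart A c)) z = reflection_factor (local_H c) z" if zS: "z \<in> ?S" for z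
  proof -
    obtain q w where z: "z = (snd c q, w)" "q \<in> fst c" using zS by (cases z) (auto simp: bottomed_def)
    then have "q \<in> breve A H" using breve_iff[OF c z(2)] zS by simp
    from factor_eq[OF c z(2) this covector_of_cotangent[OF c z(2)]] show ?thesis
      using z by (simp add: chart_inv_cotangent_chart_covector_of[OF c z(2)] covector_of_component[OF c z(2)])
  qed
  then have "L-lipschitz_on (ball x r \<inter> ?S) (factor \<circ> chart_inv (cotangent_chart A c))"
    using lipschitz_on_subset[OF rL(3), of "ball x r \<inter> ?S"] by (simp add: lipschitz_on_def)
  then show "\<exists>r>0. \<exists>L. L-lipschitz_on (ball x r \<inter>
      snd (cotangent_chart A c) ` (cotangent_over A (breve A H) \<inter> fst (cotangent_chart A c)))
      (factor \<circ> chart_inv (cotangent_chart A c))"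
    unfolding over_breve_image[OF c] using rL(1) by blast
qed

text \<open>In the chart, the component of \<open>wp\<close> is \<open>bottom\<close> on an open
  set, so the two have the same derivative and the local formula at the minimum carries
  over.\<close>

lemma involution_has_derivative:
  assumes c: "c \<in> A" "q \<in> fst c" and q: "q \<in> breve A H"
  shows "((snd (cotangent_chart A c) \<circ> involution \<circ> chart_inv (cotangent_chart A c)) has_derivative
    (\<lambda>(u, v). (u, 2 *\<^sub>R frechet_derivative (\<lambda>y. wp A H (chart_inv c y) c) (at (snd c q)) u - v)))
    (at (snd (cotangent_chart A c) (q, wp A H q)))"
proof -
  interpret L: fiber_convex "coords c" "local_H c" by (rule fiber_convex_local_H[OF c(1)])
  let ?B = "bottomed (coords c) (local_H c)" and ?K = "local_H c"
  have b: "snd c q \<in> ?B" using breve_iff[OF c] q by simp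
  have "frechet_derivative (bottom ?K) (at (snd c q)) = frechet_derivative (\<lambda>y. wp A H (chart_inv c y) c) (at (snd c q))"
  proof (rule frechet_derivative_transform_within_open[OF _ L.open_bottomed b])
    show "bottom ?K differentiable at (snd c q)" using L.smooth_bottom[of "Suc 0"] b by simp
    show "bottom ?K y = wp A H (chart_inv c y) c" if y: "y \<in> ?B" for y
    proof -
      obtain q' where q': "y = snd c q'" "q' \<in> fst c" using y by (auto simp: bottomed_def)
      then have "q' \<in> breve A H" using breve_iff[OF c(1) q'(2)] y by simp
      from wp(2)[OF c(1) q'(2) this] show ?thesis using q' c by simp
    qed
  qed
  moreover have "((\<lambda>x. (fst x, reflection ?K x)) has_derivative
      (\<lambda>w. (fst w, case w of (u, v) \<Rightarrow> 2 *\<^sub>R frechet_derivative (bottom ?K) (at (snd c q)) u - v)))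
      (at (snd c q, bottom ?K (snd c q)))"
    by (intro has_derivative_Pair has_derivative_fst has_derivative_ident L.reflection_has_derivative_bottom[OF b])
  then have "((snd (cotangent_chart A c) \<circ> involution \<circ> chart_inv (cotangent_chart A c)) has_derivative
      (\<lambda>w. (fst w, case w of (u, v) \<Rightarrow> 2 *\<^sub>R frechet_derivative (bottom ?K) (at (snd c q)) u - v)))
      (at (snd c q, bottom ?K (snd c q)))"
  proof (rule has_derivative_transform_within_open[OF _ L.open_bottomed_UNIV])
    show "(snd c q, bottom ?K (snd c q)) \<in> ?B \<times> UNIV" using b by simp
    fix x assume x: "x \<in> ?B \<times> (UNIV :: 'e set)"
    then obtain q' w where q': "x = (snd c q', w)" "q' \<in> fst c" by (cases x) (auto simp: bottomed_def)
    then have "q' \<in> breve A H" using breve_iff[OF c(1) q'(2)] x by simp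
    from involution_eq[OF c(1) q'(2) this covector_of_cotangent[OF c(1) q'(2)]]
    show "(fst x, reflection ?K x) = (snd (cotangent_chart A c) \<circ> involution \<circ> chart_inv (cotangent_chart A c)) x"
      using q' by (simp add: chart_inv_cotangent_chart_covector_of[OF c(1) q'(2)] covector_of_component[OF c(1) q'(2)])
  qed
  ultimately show ?thesis using wp(2)[OF c q] by (simp add: case_prod_beta')
qed

end

theorem proposition2:
  fixes A :: "('m, 'e::euclidean_space) chart set"
    and H :: "'m \<times> ('m, 'e) covector \<Rightarrow> real"
  assumes "smooth_manifold A"
    and "smooth_map (cotangent_atlas A) euclidean_atlas (cotangent_bundle A) H"
    and "convex_hamiltonian A H"
  shows "(\<exists>\<sigma>. (\<forall>x \<in> cotangent_over A (breve A H) - wp_graph A H. \<sigma> x = varsig A H x) \<and>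
           (\<forall>x \<in> wp_graph A H. \<sigma> x = 1) \<and>
           locally_lipschitz_fun (cotangent_atlas A) (cotangent_over A (breve A H)) \<sigma>)
    \<and> smooth_map (cotangent_atlas A) (cotangent_atlas A)
        (cotangent_over A (breve A H) - wp_graph A H) (level_involution A H)
    \<and> (\<exists>F. (\<forall>x \<in> cotangent_over A (breve A H) - wp_graph A H. F x = level_involution A H x) \<and>
           Ck_diffeo_of 1 (cotangent_atlas A) (cotangent_over A (breve A H)) F \<and>
           (\<forall>x \<in> cotangent_over A (breve A H). fst (F x) = fst x) \<and>
           (\<forall>x \<in> wp_graph A H. F x = x) \<and>
           (\<forall>c\<in>A. \<forall>q \<in> breve A H \<inter> fst c.
              ((snd (cotangent_chart A c) \<circ> F \<circ> chart_inv (cotangent_chart A c)) has_derivative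
                 (\<lambda>(u, v). (u, 2 *\<^sub>R frechet_derivative
                    (\<lambda>y. wp A H (chart_inv c y) c) (at (snd c q)) u - v)))
              (at (snd (cotangent_chart A c) (q, wp A H q)))))"
proof -
  interpret convex_hamiltonian_on_atlas A H
    using assms by unfold_locales
  show ?thesis
  proof (intro conjI exI[of _ factor] exI[of _ involution] smooth_involution locally_lipschitz_factor
      C1_diffeo_involution ballI involution_in(2))
    fix c q assume "c \<in> A" "q \<in> breve A H \<inter> fst c"
    then show "((snd (cotangent_chart A c) \<circ> involution \<circ> chart_inv (cotangent_chart A c)) has_derivative
        (\<lambda>(u, v). (u, 2 *\<^sub>R frechet_derivative (\<lambda>y. wp A H (chart_inv c y) c) (at (snd c q)) u - v)))
        (at (snd (cotangent_chart A c) (q, wp A H q)))"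
      using involution_has_derivative by blast
  qed (auto simp: factor_def involution_def)
qed

end
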